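(* Let $Z\subset\mathbb{C}^2$ be a strongly pseudoconvex circular hypersurface. Then $$\mathcal{Q}(Z)\le 8\pi,$$ with equality holding if and only if $Z$ is the $\mathbb{C}$-linear image of a sphere.
   Context: Hypersurfaces are smooth real hypersurfaces. A circular hypersurface in $\mathbb{C}^2$ is a hypersurface intersecting each complex line through the origin in a circle centered at the origin; such a $Z$ admits a defining function of the form $e^{G(z,w)}(|z|^2+|w|^2)-1$ with $G$ real-valued on $\mathbb{C}^2\setminus\{0\}$ and invariant under $(z,w)\mapsto(\lambda z,\lambda w)$ for $\lambda\in\mathbb{C}\setminus\{0\}$. For a strongly pseudoconvex hypersurface $Z\subset\mathbb{C}^2$ with defining function $\rho$, Fefferman's measure is $\mathcal{F}(Z)=\int_Z\sigma_Z$, where $\sigma_Z$ is the positive $3$-form on $Z$ uniquely determined by $$\sigma_Z\wedge d\rho = 2^{4/3} M(\rho)^{1/3}\,\omega_{\mathbb{C}^2},\qquad M(\rho)=-\det\begin{pmatrix}0&\rho_{z_j}\\ \rho_{\bar z_k}&\rho_{z_j\bar z_k}\end{pmatrix}_{1\le j,k\le 2},$$ with $\omega_{\mathbb{C}^2}$ the euclidean volume form and subscripts denoting differentiation; $\sigma_Z$ does not depend on the choice of $\rho$. If $Z$ is the compact boundary of a bounded domain, $\mathcal{V}(Z)$ denotes the euclidean volume enclosed by $Z$, and the isoperimetric quotient is $\mathcal{Q}(Z)=\mathcal{F}(Z)^{3/2}/\mathcal{V}(Z)$. *)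

theory Defs
  imports "HOL-Analysis.Analysis"
begin

section \<open>Smooth maps and Wirtinger derivatives\<close>

primrec Ck_on :: "nat \<Rightarrow> ('a::euclidean_space) set \<Rightarrow> ('a \<Rightarrow> 'b::real_normed_vector) \<Rightarrow> bool" where
  "Ck_on 0 U f \<longleftrightarrow> continuous_on U f"
| "Ck_on (Suc k) U f \<longleftrightarrow> (\<forall>x\<in>U. f differentiable (at x)) \<and>
     (\<forall>b\<in>Basis. Ck_on k U (\<lambda>x. frechet_derivative f (at x) b))"

definition smooth_on :: "('a::euclidean_space) set \<Rightarrow> ('a \<Rightarrow> 'b::real_normed_vector) \<Rightarrow> bool" where
  "smooth_on U f \<longleftrightarrow> open U \<and> (\<forall>k. Ck_on k U f)"

definition dz :: "2 \<Rightarrow> (complex^2 \<Rightarrow> complex) \<Rightarrow> complex^2 \<Rightarrow> complex" where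
  "dz j f p = (frechet_derivative f (at p) (axis j 1) - \<i> * frechet_derivative f (at p) (axis j \<i>)) / 2"

definition dzbar :: "2 \<Rightarrow> (complex^2 \<Rightarrow> complex) \<Rightarrow> complex^2 \<Rightarrow> complex" where
  "dzbar j f p = (frechet_derivative f (at p) (axis j 1) + \<i> * frechet_derivative f (at p) (axis j \<i>)) / 2"


section \<open>Strongly pseudoconvex real hypersurfaces\<close>

definition defining_function :: "(complex^2) set \<Rightarrow> (complex^2) set \<Rightarrow> (complex^2 \<Rightarrow> real) \<Rightarrow> bool" where
  "defining_function Z U \<rho> \<longleftrightarrow> smooth_on U \<rho> \<and> Z \<inter> U = {x \<in> U. \<rho> x = 0} \<and>
     (\<forall>p \<in> Z \<inter> U. frechet_derivative \<rho> (at p) \<noteq> (\<lambda>v. 0))"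

definition hypersurface :: "(complex^2) set \<Rightarrow> bool" where
  "hypersurface Z \<longleftrightarrow> (\<forall>p\<in>Z. \<exists>U \<rho>. p \<in> U \<and> defining_function Z U \<rho>)"

definition levi_form :: "(complex^2 \<Rightarrow> real) \<Rightarrow> complex^2 \<Rightarrow> complex^2 \<Rightarrow> real" where
  "levi_form \<rho> p t =
     Re (\<Sum>j\<in>UNIV. \<Sum>k\<in>UNIV. dzbar k (dz j (\<lambda>x. complex_of_real (\<rho> x))) p * (t $ j) * cnj (t $ k))"

text \<open>The sign of the local defining function is part of the choice: \<open>Z\<close> is strongly
  pseudoconvex at \<open>p\<close> if the Levi form is positive for one of the two sides.\<close>

definition strongly_pseudoconvex :: "(complex^2) set \<Rightarrow> bool" where
  "strongly_pseudoconvex Z \<longleftrightarrow> (\<forall>p\<in>Z. \<exists>U \<rho>. p \<in> U \<and> defining_function Z U \<rho> \<and>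
     (\<forall>t. t \<noteq> 0 \<and> (\<Sum>j\<in>UNIV. dz j (\<lambda>x. complex_of_real (\<rho> x)) p * (t $ j)) = 0
          \<longrightarrow> levi_form \<rho> p t > 0))"

definition complex_line :: "complex^2 \<Rightarrow> (complex^2) set" where
  "complex_line v = range (\<lambda>c::complex. c *s v)"

definition circular_hypersurface :: "(complex^2) set \<Rightarrow> bool" where
  "circular_hypersurface Z \<longleftrightarrow> hypersurface Z \<and>
     (\<forall>v. v \<noteq> 0 \<longrightarrow> (\<exists>r>0. Z \<inter> complex_line v = complex_line v \<inter> sphere 0 r))"


section \<open>Fefferman's measure\<close>

definition M_op :: "(complex^2 \<Rightarrow> real) \<Rightarrow> complex^2 \<Rightarrow> real" where
  "M_op \<rho> p = (let r = (\<lambda>x. complex_of_real (\<rho> x)) in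
     - Re (det (vector [
         vector [0,           dz 1 r p,           dz 2 r p],
         vector [dzbar 1 r p, dzbar 1 (dz 1 r) p, dzbar 1 (dz 2 r) p],
         vector [dzbar 2 r p, dzbar 2 (dz 1 r) p, dzbar 2 (dz 2 r) p]] :: complex^3^3)))"

definition real_coords :: "complex^2 \<Rightarrow> real^4" where
  "real_coords v = vector [Re (v $ 1), Im (v $ 1), Re (v $ 2), Im (v $ 2)]"

definition volume_form :: "complex^2 \<Rightarrow> complex^2 \<Rightarrow> complex^2 \<Rightarrow> complex^2 \<Rightarrow> real" where
  "volume_form v1 v2 v3 v4 =
     det (vector [real_coords v1, real_coords v2, real_coords v3, real_coords v4] :: real^4^4)"

definition alternating_3form :: "('a::real_vector \<Rightarrow> 'a \<Rightarrow> 'a \<Rightarrow> real) \<Rightarrow> bool" where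
  "alternating_3form s \<longleftrightarrow>
     (\<forall>u v. linear (\<lambda>x. s x u v) \<and> linear (\<lambda>x. s u x v) \<and> linear (\<lambda>x. s u v x)) \<and>
     (\<forall>u v. s u u v = 0 \<and> s u v u = 0 \<and> s v u u = 0)"

definition wedge_3_1 :: "('a \<Rightarrow> 'a \<Rightarrow> 'a \<Rightarrow> real) \<Rightarrow> ('a \<Rightarrow> real) \<Rightarrow> 'a \<Rightarrow> 'a \<Rightarrow> 'a \<Rightarrow> 'a \<Rightarrow> real" where
  "wedge_3_1 s a v1 v2 v3 v4 =
     s v1 v2 v3 * a v4 - s v1 v2 v4 * a v3 + s v1 v3 v4 * a v2 - s v2 v3 v4 * a v1"

text \<open>A form on \<open>Z\<close> is represented by forms \<open>\<sigma> p\<close> on the whole of the ambient space, one for each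
  \<open>p \<in> Z\<close>; only the restriction to the tangent spaces of \<open>Z\<close> is determined, and only
  this restriction enters the integral below. The function \<^const>\<open>root\<close>\<open> 3\<close> is odd, so the
  equation is unaffected by replacing \<open>\<rho>\<close> by \<open>- \<rho>\<close>.\<close>

definition fefferman_form ::
    "(complex^2) set \<Rightarrow> (complex^2 \<Rightarrow> complex^2 \<Rightarrow> complex^2 \<Rightarrow> complex^2 \<Rightarrow> real) \<Rightarrow> bool" where
  "fefferman_form Z \<sigma> \<longleftrightarrow> (\<forall>p\<in>Z. alternating_3form (\<sigma> p) \<and>
     (\<forall>U \<rho>. p \<in> U \<and> defining_function Z U \<rho> \<longrightarrow>
       (\<forall>v1 v2 v3 v4. wedge_3_1 (\<sigma> p) (frechet_derivative \<rho> (at p)) v1 v2 v3 v4 =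
          2 powr (4/3) * root 3 (M_op \<rho> p) * volume_form v1 v2 v3 v4)))"

definition local_param :: "(complex^2) set \<Rightarrow> (real^3) set \<Rightarrow> (real^3 \<Rightarrow> complex^2) \<Rightarrow> bool" where
  "local_param Z U \<phi> \<longleftrightarrow> smooth_on U \<phi> \<and> openin (top_of_set Z) (\<phi> ` U) \<and>
     (\<exists>\<psi>. homeomorphism U (\<phi> ` U) \<phi> \<psi>) \<and> (\<forall>x\<in>U. inj (frechet_derivative \<phi> (at x)))"

definition pullback_coeff ::
    "(complex^2 \<Rightarrow> complex^2 \<Rightarrow> complex^2 \<Rightarrow> complex^2 \<Rightarrow> real) \<Rightarrow> (real^3 \<Rightarrow> complex^2) \<Rightarrow> real^3 \<Rightarrow> real" where
  "pullback_coeff \<sigma> \<phi> x = (let D = frechet_derivative \<phi> (at x) in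
     \<sigma> (\<phi> x) (D (axis 1 1)) (D (axis 2 1)) (D (axis 3 1)))"

text \<open>The integral over \<open>Z\<close> of a 3-form, with \<open>Z\<close> oriented so that the form is
  positive (hence the absolute value), computed by cutting \<open>Z\<close> into countably many Borel pieces
  each of which lies in the image of a local parametrization.\<close>

definition has_positive_form_integral ::
    "(complex^2 \<Rightarrow> complex^2 \<Rightarrow> complex^2 \<Rightarrow> complex^2 \<Rightarrow> real) \<Rightarrow> ennreal \<Rightarrow> (complex^2) set \<Rightarrow> bool" where
  "has_positive_form_integral \<sigma> I Z \<longleftrightarrow> (\<exists>U \<phi> A.
     (\<forall>n::nat. local_param Z (U n) (\<phi> n) \<and> A n \<in> sets borel \<and> A n \<subseteq> U n) \<and>
     disjoint_family (\<lambda>n. \<phi> n ` A n) \<and> Z = (\<Union>n. \<phi> n ` A n) \<and>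
     I = (\<Sum>n. \<integral>\<^sup>+x\<in>A n. ennreal \<bar>pullback_coeff \<sigma> (\<phi> n) x\<bar> \<partial>lborel))"

definition fefferman_measure :: "(complex^2) set \<Rightarrow> real" where
  "fefferman_measure Z =
     enn2real (THE I. \<exists>\<sigma>. fefferman_form Z \<sigma> \<and> has_positive_form_integral \<sigma> I Z)"


section \<open>The isoperimetric quotient\<close>

definition enclosed_domain :: "(complex^2) set \<Rightarrow> (complex^2) set" where
  "enclosed_domain Z = (THE D. open D \<and> connected D \<and> bounded D \<and> frontier D = Z)"

definition enclosed_volume :: "(complex^2) set \<Rightarrow> real" where
  "enclosed_volume Z = measure lborel (enclosed_domain Z)"

definition isoperimetric_quotient :: "(complex^2) set \<Rightarrow> real" where
  "isoperimetric_quotient Z = fefferman_measure Z powr (3/2) / enclosed_volume Z"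

end

theory Submission
  imports Defs "HOL-Complex_Analysis.Cauchy_Integral_Formula"
begin

text \<open>Let \<open>N\<close> be the gauge of \<open>Z\<close>, the function that is homogeneous of degree one under all complex
  dilations and equals one exactly on \<open>Z\<close>, and let \<open>u = ln N\<close>. A ray tangent to \<open>Z\<close> would
  contradict strong pseudoconvexity (\<open>transversal\<close>), so the implicit function theorem makes \<open>N\<close> smooth, and
  \<open>u\<close> is a global defining function.

  At a point \<open>p\<close> of \<open>Z\<close> the operator \<open>M\<close> satisfies \<open>M(\<rho>) = (d\<rho>(p))\<^sup>3 M(u)\<close> for every local defining function
  \<open>\<rho>\<close>, where \<open>d\<rho>(p)\<close> is the derivative in the direction of the position vector. Hence Fefferman's form is \<open>2\<^bsup>4/3\<^esup> M(u)\<^bsup>1/3\<^esup>\<close> times the contraction of the volume form with the position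
  vector. Polar coordinates turn its integral over any chart into four times an integral over the cone below the
  chart, so that
  \<open>F(Z) = 4 \<integral> 2\<^bsup>4/3\<^esup> M(u)\<^bsup>1/3\<^esup>\<close> over \<open>{N < 1}\<close>, with the integrand extended to be constant along rays
  (\<open>cone_integral\<close>, \<open>form_integral_value\<close>). This is independent of all choices.

  Put \<open>\<psi>(\<zeta>) = u(1, \<zeta>)\<close>. In the coordinates \<open>(z, z\<zeta>)\<close> the integral over \<open>z\<close> is elementary
  (\<open>nn_integral_enclosed\<close>) and
  \<open>V(Z) = \<pi>/2 \<integral> exp(-4\<psi>)\<close>, \<open>F(Z) = 2\<pi> \<integral> (\<Delta>\<psi>)\<^bsup>1/3\<^esup> exp(-4\<psi>)\<^bsup>2/3\<^esup>\<close>. Since \<open>\<psi>\<close> grows like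
  \<open>ln \<bar>\<zeta>\<bar>\<close>, Green's theorem on large squares gives \<open>\<integral> \<Delta>\<psi> = 2\<pi>\<close> (\<open>nn_integral_lap\<close>). Hoelder's inequality
  with exponents \<open>3\<close> and \<open>3/2\<close> is then exactly the bound \<open>8\<pi>\<close>.

  Equality forces Liouville's equation \<open>\<Delta>\<psi> = c exp(-4\<psi>)\<close>. For a solution and \<open>E = exp(2\<psi>)\<close>, the
  quotient \<open>E\<^sub>\<zeta>\<^sub>\<zeta> / E\<close> is entire and tends to zero at infinity, so it vanishes
  (\<open>liouville_holomorphic_zero\<close>). Then \<open>E\<close> is a quadratic polynomial, \<open>N\<^sup>2\<close> is a positive hermitian form, and
  \<open>Z\<close> is a linear image of the unit sphere. Conversely a linear image of a sphere has such an \<open>E\<close>, and these solve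
  Liouville's equation.\<close>

section \<open>Calculus of smooth maps\<close>

abbreviation Der :: "('a::real_normed_vector \<Rightarrow> 'b::real_normed_vector) \<Rightarrow> 'a \<Rightarrow> 'a \<Rightarrow> 'b" where
  "Der f x \<equiv> frechet_derivative f (at x)"

lemma Der_works: "f differentiable (at x) \<Longrightarrow> (f has_derivative Der f x) (at x)"
  using frechet_derivative_works by blast

lemma Der_eq: "(f has_derivative f') (at x) \<Longrightarrow> Der f x = f'"
  using frechet_derivative_at by metis

lemma Der_cong:
  assumes "open U" "x \<in> U" "\<And>y. y \<in> U \<Longrightarrow> f y = g y"
  shows "Der f x = Der g x"
proof -
  have "(f has_derivative f') (at x) \<longleftrightarrow> (g has_derivative f') (at x)" for f'
    using has_derivative_transform_within_open[of f f' x UNIV U g]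
      has_derivative_transform_within_open[of g f' x UNIV U f] assms by auto
  then show ?thesis by (simp add: frechet_derivative_def)
qed

lemma Ck_on_cong:
  assumes "open U" "\<And>y. y \<in> U \<Longrightarrow> f y = g y" "Ck_on k U f"
  shows "Ck_on k U g"
  using assms
proof (induction k arbitrary: f g)
  case 0
  then show ?case by (simp cong: continuous_on_cong)
next
  case (Suc k)
  have "g differentiable at x" if "x \<in> U" for x
    using Suc.prems that
    by (simp add: differentiable_def) (meson has_derivative_transform_within_open)
  moreover have "Ck_on k U (\<lambda>x. Der g x b)" if "b \<in> Basis" for b
    by (rule Suc.IH[of "\<lambda>x. Der f x b"])
       (use Suc.prems that Der_cong[of U _ f g] in auto)
  ultimately show ?case by simp
qed

lemma Ck_on_continuous: "Ck_on k U f \<Longrightarrow> open U \<Longrightarrow> continuous_on U f"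
  by (cases k) (auto intro!: continuous_at_imp_continuous_on differentiable_imp_continuous_within)

lemma Ck_on_Suc_imp: "open U \<Longrightarrow> Ck_on (Suc k) U f \<Longrightarrow> Ck_on k U f"
proof (induction k arbitrary: f)
  case 0
  then show ?case using Ck_on_continuous[OF 0(2,1)] by simp
next
  case (Suc k)
  then show ?case by (metis Ck_on.simps(2))
qed

lemma Ck_on_subset:
  "Ck_on k U f \<Longrightarrow> V \<subseteq> U \<Longrightarrow> Ck_on k V f"
  by (induction k arbitrary: f) (auto intro: continuous_on_subset)

lemma Ck_on_local:
  assumes "\<And>x. x \<in> U \<Longrightarrow> \<exists>V. open V \<and> x \<in> V \<and> Ck_on k V f"
  shows "Ck_on k U f"
  using assms
proof (induction k arbitrary: f)
  case 0
  then have "isCont f x" if "x \<in> U" for x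
    using that by (metis Ck_on.simps(1) continuous_on_eq_continuous_at)
  then show ?case by (simp add: continuous_at_imp_continuous_on)
next
  case (Suc k)
  have "Ck_on k U (\<lambda>x. Der f x b)" if "b \<in> Basis" for b
    using Suc.prems that by (intro Suc.IH) fastforce
  then show ?case using Suc.prems by fastforce
qed

lemma Ck_on_const: "Ck_on k U (\<lambda>x. c)"
  by (induction k arbitrary: c) (simp_all add: frechet_derivative_const)

lemma Ck_on_linear:
  assumes "bounded_linear f"
  shows "Ck_on k U f"
proof (cases k)
  case 0
  then show ?thesis using assms linear_continuous_on by auto
next
  case (Suc j)
  have "Der f x = f" for x
    by (rule Der_eq) (rule bounded_linear_imp_has_derivative[OF assms])
  then show ?thesis
    using Suc bounded_linear_imp_differentiable[OF assms] by (simp add: Ck_on_const)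
qed

lemma Ck_on_add:
  assumes "open U" "Ck_on k U f" "Ck_on k U g"
  shows "Ck_on k U (\<lambda>x. f x + g x)"
  using assms
proof (induction k arbitrary: f g)
  case 0
  then show ?case by (simp add: continuous_on_add)
next
  case (Suc k)
  have "Ck_on k U (\<lambda>x. Der (\<lambda>x. f x + g x) x b)" if "b \<in> Basis" for b
  proof (rule Ck_on_cong[OF Suc.prems(1), of "\<lambda>x. Der f x b + Der g x b"])
    show "Der f y b + Der g y b = Der (\<lambda>x. f x + g x) y b" if "y \<in> U" for y
      using Suc.prems that
      by (subst Der_eq[OF has_derivative_add[OF Der_works Der_works]]) auto
    show "Ck_on k U (\<lambda>x. Der f x b + Der g x b)"
      using Suc that by auto
  qed
  then show ?case using Suc.prems by (auto intro: differentiable_add)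
qed

lemma Ck_on_sum:
  assumes "open U" "\<And>i. i \<in> I \<Longrightarrow> Ck_on k U (f i)"
  shows "Ck_on k U (\<lambda>x. \<Sum>i\<in>I. f i x)"
  using assms
proof (induction I rule: infinite_finite_induct)
  case (insert i I)
  then show ?case using Ck_on_add[of U k "f i"] by auto
qed (auto intro: Ck_on_const)

lemma Ck_on_bilinear:
  assumes "bounded_bilinear h" "open U" "Ck_on k U f" "Ck_on k U g"
  shows "Ck_on k U (\<lambda>x. h (f x) (g x))"
  using assms(2-)
proof (induction k arbitrary: f g)
  case 0
  then show ?case using assms(1) by (simp add: bounded_bilinear.continuous_on)
next
  case (Suc k)
  have D: "((\<lambda>x. h (f x) (g x)) has_derivative (\<lambda>b. h (f y) (Der g y b) + h (Der f y b) (g y))) (at y)"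
    if "y \<in> U" for y
    using Suc.prems that by (intro bounded_bilinear.FDERIV[OF assms(1)] Der_works) auto
  have "Ck_on k U (\<lambda>x. Der (\<lambda>x. h (f x) (g x)) x b)" if "b \<in> Basis" for b
  proof (rule Ck_on_cong[OF Suc.prems(1)])
    show "h (f y) (Der g y b) + h (Der f y b) (g y) = Der (\<lambda>x. h (f x) (g x)) y b" if "y \<in> U" for y
      by (simp add: Der_eq[OF D[OF that]])
    show "Ck_on k U (\<lambda>y. h (f y) (Der g y b) + h (Der f y b) (g y))"
      using Suc.prems that Ck_on_Suc_imp[OF Suc.prems(1,2)] Ck_on_Suc_imp[OF Suc.prems(1,3)]
      by (intro Ck_on_add Suc.IH) simp_all
  qed
  then show ?case using D by (auto simp: differentiable_def)
qed

lemma Ck_on_compose: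
  fixes f :: "'a::euclidean_space \<Rightarrow> 'b::euclidean_space" and g :: "'b \<Rightarrow> 'c::real_normed_vector"
  assumes "open U" "open V" "f ` U \<subseteq> V" "Ck_on k U f" "Ck_on k V g"
  shows "Ck_on k U (\<lambda>x. g (f x))"
  using assms(4-)
proof (induction k arbitrary: g)
  case 0
  then show ?case using assms(3) by (auto intro: continuous_on_compose2)
next
  case (Suc k)
  have D: "((\<lambda>x. g (f x)) has_derivative (\<lambda>b. Der g (f y) (Der f y b))) (at y)"
    if "y \<in> U" for y
  proof -
    have "(f has_derivative Der f y) (at y)" "(g has_derivative Der g (f y)) (at (f y))"
      using Suc.prems that assms(3) by (auto intro!: Der_works)
    from has_derivative_compose[OF this] show ?thesis .
  qed
  have lin: "linear (Der g (f y))" if "y \<in> U" for y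
    using Suc.prems assms(3) that by (intro linear_frechet_derivative) auto
  have "Ck_on k U (\<lambda>x. Der (\<lambda>x. g (f x)) x b)" if b: "b \<in> Basis" for b
  proof (rule Ck_on_cong[OF assms(1)])
    show "(\<Sum>c\<in>Basis. (Der f y b \<bullet> c) *\<^sub>R Der g (f y) c) = Der (\<lambda>x. g (f x)) y b" if "y \<in> U" for y
    proof -
      have "Der g (f y) (Der f y b) = Der g (f y) (\<Sum>c\<in>Basis. (Der f y b \<bullet> c) *\<^sub>R c)"
        by (simp add: euclidean_representation)
      also have "\<dots> = (\<Sum>c\<in>Basis. (Der f y b \<bullet> c) *\<^sub>R Der g (f y) c)"
        using lin[OF that] by (simp add: linear_sum linear_scale)
      finally show ?thesis by (simp add: Der_eq[OF D[OF that]])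
    qed
    show "Ck_on k U (\<lambda>y. \<Sum>c\<in>Basis. (Der f y b \<bullet> c) *\<^sub>R Der g (f y) c)"
    proof (intro Ck_on_sum Ck_on_bilinear[OF bounded_bilinear_scaleR] assms(1))
      fix c :: 'b assume c: "c \<in> Basis"
      show "Ck_on k U (\<lambda>x. Der f x b \<bullet> c)"
        using Suc.prems b by (intro Ck_on_bilinear[OF bounded_bilinear_inner] Ck_on_const assms(1)) auto
      show "Ck_on k U (\<lambda>x. Der g (f x) c)"
        using Suc.prems c Ck_on_Suc_imp[OF assms(1), of k f] by (intro Suc.IH) auto
    qed
  qed
  then show ?case using D by (auto simp: differentiable_def)
qed

lemma smooth_onI: "open U \<Longrightarrow> (\<And>k. Ck_on k U f) \<Longrightarrow> smooth_on U f"
  by (simp add: smooth_on_def)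

lemma smooth_on_open: "smooth_on U f \<Longrightarrow> open U"
  by (simp add: smooth_on_def)

lemma smooth_on_cong: "smooth_on U f \<Longrightarrow> (\<And>y. y \<in> U \<Longrightarrow> f y = g y) \<Longrightarrow> smooth_on U g"
  by (auto simp: smooth_on_def intro: Ck_on_cong)

lemma smooth_on_subset: "smooth_on U f \<Longrightarrow> open V \<Longrightarrow> V \<subseteq> U \<Longrightarrow> smooth_on V f"
  by (auto simp: smooth_on_def intro: Ck_on_subset)

lemma smooth_on_local:
  assumes "open U" "\<And>x. x \<in> U \<Longrightarrow> \<exists>V. x \<in> V \<and> smooth_on V f"
  shows "smooth_on U f"
  by (rule smooth_onI[OF assms(1)], rule Ck_on_local) (use assms(2) in \<open>auto simp: smooth_on_def\<close>)

lemma smooth_on_continuous: "smooth_on U f \<Longrightarrow> continuous_on U f"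
  using Ck_on_continuous smooth_on_def by blast

lemma smooth_on_differentiable: "smooth_on U f \<Longrightarrow> x \<in> U \<Longrightarrow> f differentiable (at x)"
  using Ck_on.simps(2)[of 0 U f] smooth_on_def by blast

lemma smooth_on_has_derivative: "smooth_on U f \<Longrightarrow> x \<in> U \<Longrightarrow> (f has_derivative Der f x) (at x)"
  by (intro Der_works smooth_on_differentiable)

lemma smooth_on_linear_Der: "smooth_on U f \<Longrightarrow> x \<in> U \<Longrightarrow> linear (Der f x)"
  by (intro linear_frechet_derivative smooth_on_differentiable)

lemma Der_basis_expand:
  fixes f :: "'a::euclidean_space \<Rightarrow> 'b::real_normed_vector"
  assumes "linear (Der f x)"
  shows "Der f x v = (\<Sum>b\<in>Basis. (v \<bullet> b) *\<^sub>R Der f x b)"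
proof -
  have "Der f x v = Der f x (\<Sum>b\<in>Basis. (v \<bullet> b) *\<^sub>R b)"
    by (simp add: euclidean_representation)
  then show ?thesis using assms by (simp add: linear_sum linear_scale)
qed

lemma smooth_on_const: "open U \<Longrightarrow> smooth_on U (\<lambda>x. c)"
  by (simp add: smooth_on_def Ck_on_const)

lemma smooth_on_linear: "bounded_linear f \<Longrightarrow> open U \<Longrightarrow> smooth_on U f"
  by (simp add: smooth_on_def Ck_on_linear)

lemma smooth_on_add: "smooth_on U f \<Longrightarrow> smooth_on U g \<Longrightarrow> smooth_on U (\<lambda>x. f x + g x)"
  by (simp add: smooth_on_def Ck_on_add)

lemma smooth_on_sum:
  "open U \<Longrightarrow> (\<And>i. i \<in> I \<Longrightarrow> smooth_on U (f i)) \<Longrightarrow> smooth_on U (\<lambda>x. \<Sum>i\<in>I. f i x)"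
  by (simp add: smooth_on_def Ck_on_sum)

lemma smooth_on_bilinear:
  "bounded_bilinear h \<Longrightarrow> smooth_on U f \<Longrightarrow> smooth_on U g \<Longrightarrow> smooth_on U (\<lambda>x. h (f x) (g x))"
  by (simp add: smooth_on_def Ck_on_bilinear)

lemmas smooth_on_scaleR = smooth_on_bilinear[OF bounded_bilinear_scaleR]
lemmas smooth_on_mult = smooth_on_bilinear[OF bounded_bilinear_mult]
lemmas smooth_on_inner = smooth_on_bilinear[OF bounded_bilinear_inner]

lemma smooth_on_compose:
  fixes f :: "'a::euclidean_space \<Rightarrow> 'b::euclidean_space" and g :: "'b \<Rightarrow> 'c::real_normed_vector"
  assumes "smooth_on U f" "smooth_on V g" "f ` U \<subseteq> V"
  shows "smooth_on U (\<lambda>x. g (f x))"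
  using assms Ck_on_compose[of U V f _ g] by (simp add: smooth_on_def)

lemma smooth_on_bounded_linear_compose:
  assumes "bounded_linear h" "smooth_on U f"
  shows "smooth_on U (\<lambda>x. h (f x))"
proof -
  have "bounded_bilinear (\<lambda>(r::real) x. r *\<^sub>R h x)"
    using bounded_bilinear.comp[OF bounded_bilinear_scaleR bounded_linear_ident assms(1)] .
  from smooth_on_bilinear[OF this smooth_on_const[of U 1] assms(2)] show ?thesis
    using smooth_on_open[OF assms(2)] by simp
qed

lemma smooth_on_minus: "smooth_on U f \<Longrightarrow> smooth_on U (\<lambda>x. - f x)"
  by (rule smooth_on_bounded_linear_compose[OF bounded_linear_minus[OF bounded_linear_ident]])

lemma smooth_on_diff: "smooth_on U f \<Longrightarrow> smooth_on U g \<Longrightarrow> smooth_on U (\<lambda>x. f x - g x)"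
  using smooth_on_add[of U f "\<lambda>x. - g x"] smooth_on_minus by auto

lemma smooth_on_power:
  fixes f :: "'a::euclidean_space \<Rightarrow> 'b::real_normed_algebra_1"
  assumes "smooth_on U f" shows "smooth_on U (\<lambda>x. f x ^ n)"
proof (induction n)
  case 0
  then show ?case using smooth_on_const smooth_on_open[OF assms] by auto
next
  case (Suc n)
  then show ?case using smooth_on_mult[OF assms] by auto
qed

lemma smooth_on_Der_Basis:
  assumes "smooth_on U f" "b \<in> Basis"
  shows "smooth_on U (\<lambda>x. Der f x b)"
  using assms Ck_on.simps(2)[of _ U f] by (simp add: smooth_on_def)

lemma smooth_on_Der:
  assumes "smooth_on U f"
  shows "smooth_on U (\<lambda>x. Der f x v)"
proof (rule smooth_on_cong)
  show "smooth_on U (\<lambda>x. \<Sum>b\<in>Basis. (v \<bullet> b) *\<^sub>R Der f x b)"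
    using assms smooth_on_open[OF assms]
    by (intro smooth_on_sum smooth_on_scaleR smooth_on_const smooth_on_Der_Basis)
  show "(\<Sum>b\<in>Basis. (v \<bullet> b) *\<^sub>R Der f y b) = Der f y v" if "y \<in> U" for y
    using Der_basis_expand smooth_on_linear_Der[OF assms that] by metis
qed

lemma Ck_on_Suc_real:
  fixes g :: "real \<Rightarrow> real"
  assumes "open V" "\<And>x. x \<in> V \<Longrightarrow> (g has_real_derivative g' x) (at x)" "Ck_on k V g'"
  shows "Ck_on (Suc k) V g"
proof -
  have D: "(g has_derivative (*) (g' x)) (at x)" if "x \<in> V" for x
    using assms(2)[OF that] by (simp add: has_field_derivative_def)
  have "Ck_on k V (\<lambda>x. Der g x 1)"
    by (rule Ck_on_cong[OF assms(1) _ assms(3)]) (simp add: Der_eq[OF D])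
  then show ?thesis using D by (auto simp: differentiable_def)
qed

lemma Ck_on_inverse_real: "Ck_on k (- {0}) (inverse :: real \<Rightarrow> real)"
proof (induction k)
  case 0
  then show ?case by (auto intro!: continuous_intros)
next
  case (Suc k)
  show ?case
  proof (rule Ck_on_Suc_real)
    show "(inverse has_real_derivative - (inverse x * inverse x)) (at x)" if "x \<in> - {0}" for x :: real
      using DERIV_inverse[of x UNIV] that by (simp add: power2_eq_square)
    have *: "Ck_on k (- {0::real}) (\<lambda>x. inverse x * inverse x)"
      by (intro Ck_on_bilinear[OF bounded_bilinear_mult] Suc) auto
    have "Ck_on k (- {0::real}) (\<lambda>x. (-1) * (inverse x * inverse x))"
      by (intro Ck_on_bilinear[OF bounded_bilinear_mult _ Ck_on_const *]) auto
    then show "Ck_on k (- {0}) (\<lambda>x::real. - (inverse x * inverse x))" by simp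
  qed auto
qed

lemma smooth_on_inverse:
  fixes f :: "'a::euclidean_space \<Rightarrow> real"
  assumes "smooth_on U f" "\<And>x. x \<in> U \<Longrightarrow> f x \<noteq> 0"
  shows "smooth_on U (\<lambda>x. inverse (f x))"
proof -
  have "smooth_on (- {0}) (inverse :: real \<Rightarrow> real)"
    using Ck_on_inverse_real by (simp add: smooth_on_def open_Compl)
  moreover have "f ` U \<subseteq> - {0}" using assms(2) by fastforce
  ultimately show ?thesis by (rule smooth_on_compose[OF assms(1)])
qed

lemma smooth_on_ln:
  fixes f :: "'a::euclidean_space \<Rightarrow> real"
  assumes "smooth_on U f" "\<And>x. x \<in> U \<Longrightarrow> f x > 0"
  shows "smooth_on U (\<lambda>x. ln (f x))"
proof -
  have "Ck_on k {0<..} (ln :: real \<Rightarrow> real)" for k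
  proof (cases k)
    case 0
    then show ?thesis by (auto intro!: continuous_on_ln continuous_on_id)
  next
    case (Suc j)
    have "Ck_on (Suc j) {0<..} (ln :: real \<Rightarrow> real)"
      by (rule Ck_on_Suc_real[where g' = inverse])
        (auto intro!: derivative_eq_intros Ck_on_subset[OF Ck_on_inverse_real] simp: divide_inverse)
    then show ?thesis using Suc by simp
  qed
  then have "smooth_on {0<..} (ln :: real \<Rightarrow> real)" by (simp add: smooth_on_def)
  from smooth_on_compose[OF assms(1) this] assms(2) show ?thesis by auto
qed


section \<open>Second derivatives\<close>

definition hess :: "('a::euclidean_space \<Rightarrow> 'b::real_normed_vector) \<Rightarrow> 'a \<Rightarrow> 'a \<Rightarrow> 'a \<Rightarrow> 'b" where
  "hess f p v w = Der (\<lambda>x. Der f x v) p w"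

lemma smooth_on_hess: "smooth_on U f \<Longrightarrow> smooth_on U (\<lambda>x. hess f x v w)"
  unfolding hess_def by (intro smooth_on_Der)

lemma hess_has_derivative:
  "smooth_on U f \<Longrightarrow> p \<in> U \<Longrightarrow> ((\<lambda>x. Der f x v) has_derivative hess f p v) (at p)"
  using smooth_on_has_derivative[OF smooth_on_Der, of U f p v] by (simp add: hess_def[abs_def])

lemma hess_linear_right: "smooth_on U f \<Longrightarrow> p \<in> U \<Longrightarrow> linear (hess f p v)"
  using smooth_on_linear_Der[OF smooth_on_Der, of U f p v] by (simp add: hess_def[abs_def])

lemma hess_linear_left:
  assumes "smooth_on U f" "p \<in> U"
  shows "linear (\<lambda>v. hess f p v w)"
proof (rule linearI)
  fix v v'
  have "Der (\<lambda>x. Der f x (v + v')) p = Der (\<lambda>x. Der f x v + Der f x v') p"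
    using smooth_on_open[OF assms(1)] assms
    by (rule_tac Der_cong[of U]) (auto simp: linear_add smooth_on_linear_Der)
  then show "hess f p (v + v') w = hess f p v w + hess f p v' w"
    using Der_eq[OF has_derivative_add[OF hess_has_derivative[OF assms, of v] hess_has_derivative[OF assms, of v']]]
    by (simp add: hess_def)
next
  fix r v
  have "Der (\<lambda>x. Der f x (r *\<^sub>R v)) p = Der (\<lambda>x. r *\<^sub>R Der f x v) p"
    using smooth_on_open[OF assms(1)] assms
    by (rule_tac Der_cong[of U]) (auto simp: linear_scale smooth_on_linear_Der)
  then show "hess f p (r *\<^sub>R v) w = r *\<^sub>R hess f p v w"
    using Der_eq[OF has_derivative_scaleR_right[OF hess_has_derivative[OF assms, of v], of r]]
    by (simp add: hess_def)
qed

lemma hess_bilinear: "smooth_on U f \<Longrightarrow> p \<in> U \<Longrightarrow> bilinear (hess f p)"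
  by (simp add: bilinear_def hess_linear_left hess_linear_right)

text \<open>The second difference is symmetric in \<open>a\<close> and \<open>b\<close>, while the mean value theorem, applied first in direction
  \<open>a\<close> and then in direction \<open>b\<close>, exhibits it as a value of one mixed derivative. Letting \<open>h\<close> tend to
  zero proves the symmetry of second derivatives below.\<close>

lemma second_difference_quotient:
  fixes f :: "'a::euclidean_space \<Rightarrow> real"
  assumes f: "smooth_on (ball p r) f" and h: "h > 0" "h * (norm a + norm b) < r"
  obtains s t where "0 < s" "s < h" "0 < t" "t < h"
    "f (p + h *\<^sub>R a + h *\<^sub>R b) - f (p + h *\<^sub>R a) - f (p + h *\<^sub>R b) + f p
       = h\<^sup>2 * hess f (p + s *\<^sub>R a + t *\<^sub>R b) a b"
proof -
  have in_ball: "p + s *\<^sub>R a + t *\<^sub>R b \<in> ball p r" if "0 \<le> s" "s \<le> h" "0 \<le> t" "t \<le> h" for s t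
  proof -
    have "norm (s *\<^sub>R a + t *\<^sub>R b) \<le> s * norm a + t * norm b"
      using norm_triangle_ineq[of "s *\<^sub>R a" "t *\<^sub>R b"] that by simp
    also have "\<dots> \<le> h * (norm a + norm b)"
      using that by (simp add: distrib_left add_mono mult_right_mono)
    finally have "norm (s *\<^sub>R a + t *\<^sub>R b) < r" using h by simp
    moreover have "dist (p + s *\<^sub>R a + t *\<^sub>R b) p = norm (s *\<^sub>R a + t *\<^sub>R b)"
      by (simp add: dist_norm add.assoc)
    ultimately show ?thesis by (simp add: dist_commute)
  qed
  have d1: "((\<lambda>s. f (p + s *\<^sub>R a + c)) has_real_derivative Der f (p + s *\<^sub>R a + c) a) (at s)"
    if "p + s *\<^sub>R a + c \<in> ball p r" for s c
  proof -
    have "((\<lambda>s. p + s *\<^sub>R a + c) has_derivative (\<lambda>s. s *\<^sub>R a)) (at s)"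
      by (auto intro!: derivative_eq_intros)
    from has_derivative_compose[OF this smooth_on_has_derivative[OF f that]]
    have "((\<lambda>s. f (p + s *\<^sub>R a + c)) has_derivative (\<lambda>t. Der f (p + s *\<^sub>R a + c) (t *\<^sub>R a))) (at s)" .
    moreover have "Der f (p + s *\<^sub>R a + c) (t *\<^sub>R a) = Der f (p + s *\<^sub>R a + c) a * t" for t
      using linear_scale[OF smooth_on_linear_Der[OF f that]] by simp
    ultimately show ?thesis by (simp add: has_field_derivative_def)
  qed
  have d2: "((\<lambda>t. Der f (c + t *\<^sub>R b) a) has_real_derivative hess f (c + t *\<^sub>R b) a b) (at t)"
    if "c + t *\<^sub>R b \<in> ball p r" for t c
  proof -
    have "((\<lambda>t. c + t *\<^sub>R b) has_derivative (\<lambda>t. t *\<^sub>R b)) (at t)"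
      by (auto intro!: derivative_eq_intros)
    from has_derivative_compose[OF this hess_has_derivative[OF f that]]
    have "((\<lambda>t. Der f (c + t *\<^sub>R b) a) has_derivative (\<lambda>s. hess f (c + t *\<^sub>R b) a (s *\<^sub>R b))) (at t)" .
    moreover have "hess f (c + t *\<^sub>R b) a (s *\<^sub>R b) = hess f (c + t *\<^sub>R b) a b * s" for s
      using linear_scale[OF hess_linear_right[OF f that]] by simp
    ultimately show ?thesis by (simp add: has_field_derivative_def)
  qed
  define g where "g s = f (p + s *\<^sub>R a + h *\<^sub>R b) - f (p + s *\<^sub>R a + 0)" for s
  have "\<exists>s. 0 < s \<and> s < h \<and> g h - g 0 = (h - 0) * (Der f (p + s *\<^sub>R a + h *\<^sub>R b) a - Der f (p + s *\<^sub>R a + 0) a)"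
    using h in_ball[of _ h] in_ball[of _ 0] unfolding g_def
    by (intro MVT2 DERIV_diff d1) auto
  then obtain s where s: "0 < s" "s < h"
    "g h - g 0 = h * (Der f (p + s *\<^sub>R a + h *\<^sub>R b) a - Der f (p + s *\<^sub>R a + 0 *\<^sub>R b) a)" by auto
  have "\<exists>t. 0 < t \<and> t < h \<and> Der f (p + s *\<^sub>R a + h *\<^sub>R b) a - Der f (p + s *\<^sub>R a + 0 *\<^sub>R b) a
      = (h - 0) * hess f (p + s *\<^sub>R a + t *\<^sub>R b) a b"
    using h s in_ball[of s] by (intro MVT2 d2) auto
  then obtain t where t: "0 < t" "t < h" "Der f (p + s *\<^sub>R a + h *\<^sub>R b) a - Der f (p + s *\<^sub>R a + 0 *\<^sub>R b) a
      = h * hess f (p + s *\<^sub>R a + t *\<^sub>R b) a b" by auto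
  show ?thesis
    using that[of s t] s t by (simp add: g_def power2_eq_square algebra_simps)
qed

lemma hess_symmetric:
  fixes f :: "'a::euclidean_space \<Rightarrow> real"
  assumes f: "smooth_on U f" and p: "p \<in> U"
  shows "hess f p a b = hess f p b a"
proof (rule ccontr)
  assume neq: "hess f p a b \<noteq> hess f p b a"
  define e where "e = \<bar>hess f p a b - hess f p b a\<bar> / 2"
  have e: "e > 0" using neq by (simp add: e_def)
  obtain r where r: "r > 0" "ball p r \<subseteq> U"
    using smooth_on_open[OF f] p open_contains_ball by blast
  have fr: "smooth_on (ball p r) f" using smooth_on_subset[OF f] r by auto
  have cont: "isCont (\<lambda>x. hess f x v w) p" for v w
    using smooth_on_continuous[OF smooth_on_hess[OF f]] p smooth_on_open[OF f]
    by (simp add: continuous_on_eq_continuous_at)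
  obtain d1 where d1: "d1 > 0" "\<And>x. dist x p < d1 \<Longrightarrow> \<bar>hess f x a b - hess f p a b\<bar> < e"
    using cont[of a b] e unfolding continuous_at_eps_delta dist_real_def by blast
  obtain d2 where d2: "d2 > 0" "\<And>x. dist x p < d2 \<Longrightarrow> \<bar>hess f x b a - hess f p b a\<bar> < e"
    using cont[of b a] e unfolding continuous_at_eps_delta dist_real_def by blast
  define d where "d = min r (min d1 d2)"
  define h where "h = d / (norm a + norm b + 1)"
  have d: "d > 0" using r d1 d2 by (simp add: d_def)
  have h: "h > 0" using d by (simp add: h_def add_nonneg_pos)
  have "h * (norm a + norm b) = d * (norm a + norm b) / (norm a + norm b + 1)"
    by (simp add: h_def)
  also have "\<dots> < d"
    by (subst pos_divide_less_eq) (use d in \<open>simp_all add: add_nonneg_pos\<close>)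
  finally have "h * (norm a + norm b) < d" .
  then have hr: "h * (norm a + norm b) < r" "h * (norm b + norm a) < r" and hd: "h * (norm a + norm b) < d"
    by (auto simp: d_def add.commute)
  have near: "dist (p + s *\<^sub>R a + t *\<^sub>R b) p < d" if "0 < s" "s < h" "0 < t" "t < h" for s t
  proof -
    have "norm (s *\<^sub>R a + t *\<^sub>R b) \<le> s * norm a + t * norm b"
      using norm_triangle_ineq[of "s *\<^sub>R a" "t *\<^sub>R b"] that by simp
    also have "\<dots> \<le> h * (norm a + norm b)"
      using that by (simp add: distrib_left add_mono mult_right_mono)
    finally show ?thesis using hd by (simp add: dist_norm add.assoc)
  qed
  obtain s t where st: "0 < s" "s < h" "0 < t" "t < h"
    "f (p + h *\<^sub>R a + h *\<^sub>R b) - f (p + h *\<^sub>R a) - f (p + h *\<^sub>R b) + f p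
       = h\<^sup>2 * hess f (p + s *\<^sub>R a + t *\<^sub>R b) a b"
    by (rule second_difference_quotient[OF fr h hr(1)])
  obtain s' t' where st': "0 < s'" "s' < h" "0 < t'" "t' < h"
    "f (p + h *\<^sub>R b + h *\<^sub>R a) - f (p + h *\<^sub>R b) - f (p + h *\<^sub>R a) + f p
       = h\<^sup>2 * hess f (p + s' *\<^sub>R b + t' *\<^sub>R a) b a"
    by (rule second_difference_quotient[OF fr h hr(2)])
  have eq: "hess f (p + s *\<^sub>R a + t *\<^sub>R b) a b = hess f (p + s' *\<^sub>R b + t' *\<^sub>R a) b a"
    using st(5) st'(5) h by (simp add: add.commute add.left_commute) (simp add: algebra_simps)
  have "dist (p + s' *\<^sub>R b + t' *\<^sub>R a) p < d"
    using near[of t' s'] st' by (simp add: add.commute add.left_commute)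
  then have "\<bar>hess f (p + s' *\<^sub>R b + t' *\<^sub>R a) b a - hess f p b a\<bar> < e"
    by (intro d2) (simp add: d_def)
  moreover have "\<bar>hess f (p + s *\<^sub>R a + t *\<^sub>R b) a b - hess f p a b\<bar> < e"
    using near[of s t] st by (intro d1) (simp add: d_def)
  ultimately show False using eq unfolding e_def by (smt (verit) field_sum_of_halves)
qed

lemma Der_along_curve:
  fixes c :: "real \<Rightarrow> 'a::euclidean_space" and f :: "'a \<Rightarrow> 'b::real_normed_vector"
  assumes f: "smooth_on U f" and "c t \<in> U" "(c has_vector_derivative c1) (at t)"
  shows "((\<lambda>t. f (c t)) has_vector_derivative Der f (c t) c1) (at t)"
proof -
  have "((\<lambda>t. f (c t)) has_derivative (\<lambda>h. Der f (c t) (h *\<^sub>R c1))) (at t)"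
    using has_derivative_compose[OF assms(3)[unfolded has_vector_derivative_def]
        smooth_on_has_derivative[OF f assms(2)]] by simp
  then show ?thesis
    using smooth_on_linear_Der[OF f assms(2)] by (simp add: has_vector_derivative_def linear_scale)
qed

lemma hess_along_curve:
  fixes c :: "real \<Rightarrow> 'a::euclidean_space" and f :: "'a \<Rightarrow> real"
  assumes f: "smooth_on U f" and I: "open I" "t0 \<in> I"
    and c: "\<And>t. t \<in> I \<Longrightarrow> c t \<in> U" "\<And>t. t \<in> I \<Longrightarrow> (c has_vector_derivative c1 t) (at t)"
    and c1: "(c1 has_vector_derivative c2) (at t0)"
  shows "((\<lambda>t. Der f (c t) (c1 t)) has_real_derivative
            hess f (c t0) (c1 t0) (c1 t0) + Der f (c t0) c2) (at t0)"
proof -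
  let ?E = "\<lambda>t. \<Sum>b\<in>Basis. (c1 t \<bullet> b) * Der f (c t) b"
  have p: "c t0 \<in> U" using c I by auto
  have "(?E has_real_derivative
     (\<Sum>b\<in>Basis. (c1 t0 \<bullet> b) * hess f (c t0) b (c1 t0) + (c2 \<bullet> b) * Der f (c t0) b)) (at t0)"
  proof (rule DERIV_sum)
    fix b :: 'a assume b: "b \<in> Basis"
    have 1: "((\<lambda>t. c1 t \<bullet> b) has_real_derivative c2 \<bullet> b) (at t0)"
      using bounded_linear.has_vector_derivative[OF bounded_linear_inner_left c1, of b]
      by (simp add: has_real_derivative_iff_has_vector_derivative)
    have 2: "((\<lambda>t. Der f (c t) b) has_real_derivative hess f (c t0) b (c1 t0)) (at t0)"
      using Der_along_curve[OF smooth_on_Der[OF f] p c(2)[OF I(2)], of b]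
      by (simp add: hess_def has_real_derivative_iff_has_vector_derivative)
    show "((\<lambda>t. (c1 t \<bullet> b) * Der f (c t) b) has_real_derivative
       (c1 t0 \<bullet> b) * hess f (c t0) b (c1 t0) + (c2 \<bullet> b) * Der f (c t0) b) (at t0)"
      using DERIV_mult[OF 1 2] by (simp add: algebra_simps)
  qed
  also have "(\<Sum>b\<in>Basis. (c1 t0 \<bullet> b) * hess f (c t0) b (c1 t0) + (c2 \<bullet> b) * Der f (c t0) b)
     = hess f (c t0) (c1 t0) (c1 t0) + Der f (c t0) c2"
  proof -
    have "hess f (c t0) (c1 t0) (c1 t0) = hess f (c t0) (\<Sum>b\<in>Basis. (c1 t0 \<bullet> b) *\<^sub>R b) (c1 t0)"
      by (simp add: euclidean_representation)
    also have "\<dots> = (\<Sum>b\<in>Basis. (c1 t0 \<bullet> b) * hess f (c t0) b (c1 t0))"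
      by (simp only: linear_sum[OF hess_linear_left[OF f p, of "c1 t0"]]
          linear_scale[OF hess_linear_left[OF f p, of "c1 t0"]] real_scaleR_def)
    finally show ?thesis
      using Der_basis_expand[OF smooth_on_linear_Der[OF f p], of c2] by (simp add: sum.distrib)
  qed
  finally show ?thesis
  proof (rule has_field_derivative_transform_within_open[OF _ I])
    fix t assume "t \<in> I"
    then show "?E t = Der f (c t) (c1 t)"
      using Der_basis_expand[OF smooth_on_linear_Der[OF f c(1)], of t "c1 t"] by simp
  qed
qed

text \<open>Along a curve in a level set the second derivative of the function in the tangent direction is determined by its
  first derivative in the direction of the acceleration. This compares the Hessians of two defining functions of
  the same hypersurface without writing one as a multiple of the other.\<close>

lemma level_curve:
  fixes c :: "real \<Rightarrow> 'a::euclidean_space" and f :: "'a \<Rightarrow> real"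
  assumes f: "smooth_on U f" and I: "open I" "t0 \<in> I"
    and c: "\<And>t. t \<in> I \<Longrightarrow> c t \<in> U" "\<And>t. t \<in> I \<Longrightarrow> (c has_vector_derivative c1 t) (at t)"
    and c1: "(c1 has_vector_derivative c2) (at t0)"
    and zero: "\<And>t. t \<in> I \<Longrightarrow> f (c t) = 0"
  shows "Der f (c t0) (c1 t0) = 0"
    and "hess f (c t0) (c1 t0) (c1 t0) = - Der f (c t0) c2"
proof -
  have first: "Der f (c t) (c1 t) = 0" if "t \<in> I" for t
  proof -
    have "((\<lambda>t. 0::real) has_vector_derivative Der f (c t) (c1 t)) (at t)"
      by (rule has_vector_derivative_transform_within_open[OF Der_along_curve[OF f c(1)[OF that] c(2)[OF that]] I(1) that])
        (use zero in auto)
    then show ?thesis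
      using vector_derivative_unique_at[of "\<lambda>t. 0::real" _ t 0] by auto
  qed
  then show "Der f (c t0) (c1 t0) = 0" using I by auto
  have "((\<lambda>t. 0) has_real_derivative (hess f (c t0) (c1 t0) (c1 t0) + Der f (c t0) c2)) (at t0)"
    by (rule has_field_derivative_transform_within_open[OF hess_along_curve[OF f I c c1] I]) (use first in auto)
  then show "hess f (c t0) (c1 t0) (c1 t0) = - Der f (c t0) c2"
    using DERIV_unique[OF _ DERIV_const[of 0 "at t0"]] by force
qed

section \<open>The Levi form\<close>

lemma vec2_expand:
  fixes t :: "complex^2"
  shows "t = Re (t$1) *\<^sub>R axis 1 1 + Im (t$1) *\<^sub>R axis 1 \<i> + Re (t$2) *\<^sub>R axis 2 1 + Im (t$2) *\<^sub>R axis 2 \<i>"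
  by (simp add: vec_eq_iff forall_2 axis_def complex_eq_iff)

lemma linear_vec2:
  fixes t :: "complex^2" and f :: "complex^2 \<Rightarrow> real"
  assumes "linear f"
  shows "f t = Re (t$1) * f (axis 1 1) + Im (t$1) * f (axis 1 \<i>)
     + Re (t$2) * f (axis 2 1) + Im (t$2) * f (axis 2 \<i>)"
proof -
  have "f t = f (Re (t$1) *\<^sub>R axis 1 1 + Im (t$1) *\<^sub>R axis 1 \<i> + Re (t$2) *\<^sub>R axis 2 1 + Im (t$2) *\<^sub>R axis 2 \<i>)"
    by (rule arg_cong[OF vec2_expand])
  then show ?thesis using assms by (simp add: linear_add linear_scale)
qed

lemma dz_real:
  assumes "smooth_on U \<rho>" "p \<in> U"
  shows "dz j (\<lambda>x. complex_of_real (\<rho> x)) p = Complex (Der \<rho> p (axis j 1) / 2) (- Der \<rho> p (axis j \<i>) / 2)"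
    and "dzbar j (\<lambda>x. complex_of_real (\<rho> x)) p = Complex (Der \<rho> p (axis j 1) / 2) (Der \<rho> p (axis j \<i>) / 2)"
proof -
  have "((\<lambda>x. complex_of_real (\<rho> x)) has_derivative (\<lambda>v. complex_of_real (Der \<rho> p v))) (at p)"
    by (rule has_derivative_of_real[OF smooth_on_has_derivative[OF assms]])
  then have "Der (\<lambda>x. complex_of_real (\<rho> x)) p = (\<lambda>v. complex_of_real (Der \<rho> p v))"
    by (rule Der_eq)
  then show "dz j (\<lambda>x. complex_of_real (\<rho> x)) p = Complex (Der \<rho> p (axis j 1) / 2) (- Der \<rho> p (axis j \<i>) / 2)"
    "dzbar j (\<lambda>x. complex_of_real (\<rho> x)) p = Complex (Der \<rho> p (axis j 1) / 2) (Der \<rho> p (axis j \<i>) / 2)"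
    by (auto simp: dz_def dzbar_def complex_eq_iff)
qed

lemma dzbar_dz_real:
  assumes "smooth_on U \<rho>" "p \<in> U"
  shows "dzbar k (dz j (\<lambda>x. complex_of_real (\<rho> x))) p =
    Complex ((hess \<rho> p (axis j 1) (axis k 1) + hess \<rho> p (axis j \<i>) (axis k \<i>)) / 4)
            ((hess \<rho> p (axis j 1) (axis k \<i>) - hess \<rho> p (axis j \<i>) (axis k 1)) / 4)"
proof -
  let ?g = "\<lambda>x. (complex_of_real (Der \<rho> x (axis j 1)) - \<i> * complex_of_real (Der \<rho> x (axis j \<i>))) / 2"
  have d: "((\<lambda>x. complex_of_real (Der \<rho> x v)) has_derivative (\<lambda>w. complex_of_real (hess \<rho> p v w))) (at p)" for v
    by (rule has_derivative_of_real[OF hess_has_derivative[OF assms]])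
  have "((\<lambda>x. (1/2) * (complex_of_real (Der \<rho> x (axis j 1)) - \<i> * complex_of_real (Der \<rho> x (axis j \<i>))))
      has_derivative (\<lambda>v. (1/2) * (complex_of_real (hess \<rho> p (axis j 1) v) - \<i> * complex_of_real (hess \<rho> p (axis j \<i>) v)))) (at p)"
    by (rule has_derivative_mult_right[OF has_derivative_diff[OF d has_derivative_mult_right[OF d]]])
  then have "(?g has_derivative (\<lambda>v. (complex_of_real (hess \<rho> p (axis j 1) v) - \<i> * complex_of_real (hess \<rho> p (axis j \<i>) v)) / 2)) (at p)"
    by simp
  moreover have "Der (dz j (\<lambda>x. complex_of_real (\<rho> x))) p = Der ?g p"
    by (rule Der_cong[OF smooth_on_open[OF assms(1)] assms(2)])
      (auto simp: dz_real[OF assms(1)] complex_eq_iff)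
  ultimately have "Der (dz j (\<lambda>x. complex_of_real (\<rho> x))) p =
    (\<lambda>v. (complex_of_real (hess \<rho> p (axis j 1) v) - \<i> * complex_of_real (hess \<rho> p (axis j \<i>) v)) / 2)"
    by (simp only: Der_eq)
  then show ?thesis by (simp add: dzbar_def complex_eq_iff)
qed

text \<open>The Levi form is a quarter of the Laplacian of \<open>\<rho>\<close> along the complex line through \<open>p\<close> in direction
  \<open>t\<close>. Taking the real part already removes the antisymmetric part of the Hessian.\<close>

lemma levi_form_hess:
  assumes "smooth_on U \<rho>" "p \<in> U"
  shows "levi_form \<rho> p t = (hess \<rho> p t t + hess \<rho> p (\<i> *s t) (\<i> *s t)) / 4"
proof -
  have L: "hess \<rho> p v w = Re (v$1) * hess \<rho> p (axis 1 1) w + Im (v$1) * hess \<rho> p (axis 1 \<i>) w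
     + Re (v$2) * hess \<rho> p (axis 2 1) w + Im (v$2) * hess \<rho> p (axis 2 \<i>) w" for v w
    by (rule linear_vec2[OF hess_linear_left[OF assms]])
  have R: "hess \<rho> p v w = Re (w$1) * hess \<rho> p v (axis 1 1) + Im (w$1) * hess \<rho> p v (axis 1 \<i>)
     + Re (w$2) * hess \<rho> p v (axis 2 1) + Im (w$2) * hess \<rho> p v (axis 2 \<i>)" for v w
    by (rule linear_vec2[OF hess_linear_right[OF assms]])
  define h where "h j k = hess \<rho> p j k" for j k
  obtain a b where ab: "t$1 = Complex a b" by (metis complex_surj)
  obtain c d where cd: "t$2 = Complex c d" by (metis complex_surj)
  have "4 * levi_form \<rho> p t = hess \<rho> p t t + hess \<rho> p (\<i> *s t) (\<i> *s t)"
    unfolding L[of t t] L[of "\<i> *s t" "\<i> *s t"] R[of "axis 1 1" "t"] R[of "axis 1 \<i>" "t"] R[of "axis 2 1" "t"] R[of "axis 2 \<i>" "t"]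
      R[of "axis 1 1" "\<i> *s t"] R[of "axis 1 \<i>" "\<i> *s t"] R[of "axis 2 1" "\<i> *s t"] R[of "axis 2 \<i>" "\<i> *s t"]
      levi_form_def dzbar_dz_real[OF assms] sum_2 vector_smult_component ab cd
    unfolding h_def[symmetric]
    apply simp
    by algebra
  then show ?thesis by simp
qed

lemma levi_form_scale: "levi_form \<rho> p (\<mu> *s t) = (cmod \<mu>)\<^sup>2 * levi_form \<rho> p t"
proof -
  have "(\<Sum>j\<in>UNIV. \<Sum>k\<in>UNIV. dzbar k (dz j (\<lambda>x. complex_of_real (\<rho> x))) p * ((\<mu> *s t) $ j) * cnj ((\<mu> *s t) $ k))
    = complex_of_real ((cmod \<mu>)\<^sup>2) * (\<Sum>j\<in>UNIV. \<Sum>k\<in>UNIV. dzbar k (dz j (\<lambda>x. complex_of_real (\<rho> x))) p * (t $ j) * cnj (t $ k))"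
    unfolding complex_norm_square sum_2 vector_smult_component complex_cnj_mult by (simp add: algebra_simps)
  then show ?thesis unfolding levi_form_def by (simp only: Re_complex_of_real times_complex.simps Im_complex_of_real mult_zero_left diff_zero)
qed

lemma complex_tangent_iff:
  assumes "smooth_on U \<rho>" "p \<in> U"
  shows "(\<Sum>j\<in>UNIV. dz j (\<lambda>x. complex_of_real (\<rho> x)) p * (t $ j)) =
    Complex (Der \<rho> p t / 2) (- Der \<rho> p (\<i> *s t) / 2)"
  unfolding dz_real[OF assms] sum_2
  apply (subst linear_vec2[OF smooth_on_linear_Der[OF assms], of t])
  apply (subst linear_vec2[OF smooth_on_linear_Der[OF assms], of "\<i> *s t"])
  by (simp add: complex_eq_iff field_simps)

text \<open>The bordered determinant is the Levi form evaluated on \<open>(\<rho>\<^sub>2, -\<rho>\<^sub>1)\<close>, the generator of the complex tangent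
  line that the gradient provides.\<close>

lemma M_op_levi:
  assumes "smooth_on U \<rho>" "p \<in> U"
  shows "M_op \<rho> p = levi_form \<rho> p
     (vector [dz 2 (\<lambda>x. complex_of_real (\<rho> x)) p, - dz 1 (\<lambda>x. complex_of_real (\<rho> x)) p])"
  unfolding M_op_def Let_def levi_form_def dzbar_dz_real[OF assms] dz_real[OF assms] sum_2
  by (simp add: det_3 vector_3 vector_2 algebra_simps)


section \<open>Implicitly defined smooth functions\<close>

lemma Ck_on_graph:
  fixes g :: "'a::euclidean_space \<Rightarrow> real"
  assumes "open V" "Ck_on k V g"
  shows "Ck_on k V (\<lambda>v. (g v, v))"
proof -
  have "Ck_on k V (\<lambda>v. g v *\<^sub>R (1::real, 0::'a) + (0, v))"
    by (intro Ck_on_add Ck_on_bilinear[OF bounded_bilinear_scaleR] Ck_on_const Ck_on_linear assms)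
      (auto intro!: bounded_linear_Pair bounded_linear_ident bounded_linear_zero)
  then show ?thesis by simp
qed

text \<open>The inverse function theorem for \<open>(t, v) \<mapsto> (F (t, v), v)\<close> yields one derivative of \<open>g\<close>. The formula for this
  derivative is a rational expression in derivatives of \<open>F\<close> along the graph of \<open>g\<close>, so every degree of smoothness
  of \<open>g\<close> implies the next one. Uniqueness of the zero in all of \<open>W\<close> identifies \<open>g\<close> with the local solution.\<close>

lemma smooth_implicit_function:
  fixes F :: "real \<times> 'a::euclidean_space \<Rightarrow> real"
  assumes F: "smooth_on W F" and v0: "(g v0, v0) \<in> W" "F (g v0, v0) = 0"
    and nz: "Der F (g v0, v0) (1, 0) \<noteq> 0"
    and uniq: "\<And>t v. (t, v) \<in> W \<Longrightarrow> F (t, v) = 0 \<Longrightarrow> t = g v"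
  shows "\<exists>V. v0 \<in> V \<and> smooth_on V g"
proof -
  let ?f = "\<lambda>x. (F x, snd x)"
  define f' where "f' x = Blinfun (\<lambda>b. (Der F x b, snd b))" for x
  have der: "(?f has_derivative (\<lambda>b. (Der F x b, snd b))) (at x)" if "x \<in> W" for x
    by (intro has_derivative_Pair smooth_on_has_derivative[OF F that] has_derivative_snd has_derivative_ident)
  have f'_app: "blinfun_apply (f' x) = (\<lambda>b. (Der F x b, snd b))" if "x \<in> W" for x
    unfolding f'_def by (rule bounded_linear_Blinfun_apply) (rule has_derivative_bounded_linear[OF der[OF that]])
  have cont: "continuous_on W f'"
  proof (rule continuous_on_blinfun_componentwise)
    fix i :: "real \<times> 'a" assume "i \<in> Basis"
    have "continuous_on W (\<lambda>x. (Der F x i, snd i))"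
      by (intro continuous_on_Pair continuous_on_const smooth_on_continuous smooth_on_Der F)
    then show "continuous_on W (\<lambda>x. blinfun_apply (f' x) i)"
      by (simp add: f'_app cong: continuous_on_cong)
  qed
  let ?x0 = "(g v0, v0)"
  let ?D = "Der F ?x0"
  have linD: "linear ?D" by (rule smooth_on_linear_Der[OF F v0(1)])
  have Dsplit: "Der F x (a, b) = a * Der F x (1, 0) + Der F x (0, b)" if "x \<in> W" for x a b
  proof -
    have "Der F x (a *\<^sub>R (1, 0) + (0, b)) = a * Der F x (1, 0) + Der F x (0, b)"
      by (simp only: linear_add[OF smooth_on_linear_Der[OF F that]]
          linear_scale[OF smooth_on_linear_Der[OF F that]] real_scaleR_def)
    then show ?thesis by simp
  qed
  have bD: "bounded_linear ?D"
    using linD linear_conv_bounded_linear by blast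
  define invf where "invf = Blinfun (\<lambda>y. ((fst y - ?D (0, snd y)) / ?D (1, 0), snd y))"
  have "bounded_linear (\<lambda>y::real \<times> 'a. ((fst y - ?D (0, snd y)) / ?D (1, 0), snd y))"
    by (intro bounded_linear_Pair bounded_linear_snd
        bounded_linear_compose[OF bounded_linear_divide] bounded_linear_sub bounded_linear_fst
        bounded_linear_compose[OF bD] bounded_linear_zero)
  then have invf_app: "blinfun_apply invf = (\<lambda>y. ((fst y - ?D (0, snd y)) / ?D (1, 0), snd y))"
    unfolding invf_def by (rule bounded_linear_Blinfun_apply)
  have inv: "invf o\<^sub>L f' ?x0 = id_blinfun"
  proof (rule blinfun_eqI)
    fix i :: "real \<times> 'a"
    show "blinfun_apply (invf o\<^sub>L f' ?x0) i = blinfun_apply id_blinfun i"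
      using nz Dsplit[OF v0(1), of "fst i" "snd i"] by (simp add: invf_app f'_app[OF v0(1)])
  qed
  obtain U' V G G' where G: "open U'" "U' \<subseteq> W" "?x0 \<in> U'" "open V" "?f ?x0 \<in> V"
     "homeomorphism U' V ?f G"
     and G': "\<And>y. y \<in> V \<Longrightarrow> (G has_derivative (G' y)) (at y)"
     and bij: "\<And>y. y \<in> V \<Longrightarrow> bij (blinfun_apply (f' (G y)))"
  proof (rule inverse_function_theorem[OF smooth_on_open[OF F] _ cont v0(1) inv])
    show "(?f has_derivative blinfun_apply (f' x)) (at x)" if "x \<in> W" for x
      using der[OF that] by (simp add: f'_app[OF that])
  qed blast
  define V' where "V' = {v. (0::real, v) \<in> V}"
  have V': "open V'"
  proof -
    have "open ((\<lambda>v. (0::real, v)) -` V)" by (intro open_vimage G continuous_intros)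
    then show ?thesis by (simp add: V'_def vimage_def)
  qed
  have v0': "v0 \<in> V'" using G(5) v0(2) by (simp add: V'_def)
  have Gg: "G (0, v) = (g v, v)" "(g v, v) \<in> W" "F (g v, v) = 0" "Der F (g v, v) (1, 0) \<noteq> 0"
    if "v \<in> V'" for v
  proof -
    have V: "(0, v) \<in> V" using that by (simp add: V'_def)
    then have GU: "G (0, v) \<in> U'" and fG: "?f (G (0, v)) = (0, v)"
      using G(6) by (auto simp: homeomorphism_def)
    obtain t where t: "G (0, v) = (t, v)" using fG by (cases "G (0, v)") auto
    have W: "(t, v) \<in> W" "F (t, v) = 0" using GU G(2) fG t by auto
    have tg: "t = g v" by (rule uniq[OF W])
    show "G (0, v) = (g v, v)" "(g v, v) \<in> W" "F (g v, v) = 0" using t W tg by auto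
    show "Der F (g v, v) (1, 0) \<noteq> 0"
    proof
      assume 0: "Der F (g v, v) (1, 0) = 0"
      have "inj (blinfun_apply (f' (g v, v)))"
        using bij[OF V] t tg bij_is_inj by auto
      moreover have "blinfun_apply (f' (g v, v)) (1, 0) = blinfun_apply (f' (g v, v)) (0, 0)"
        using 0 W tg f'_app linear_0[OF smooth_on_linear_Der[OF F, of "(t, v)"]]
        by (simp add: zero_prod_def)
      ultimately have "(1::real, 0::'a) = (0, 0)" by (rule injD)
      then show False by simp
    qed
  qed
  have g_diff: "g differentiable (at v)" if "v \<in> V'" for v
  proof -
    have "((\<lambda>v. fst (G (0, v))) has_derivative (\<lambda>b. fst (G' (0, v) (0, b)))) (at v)"
      using that by (intro has_derivative_fst has_derivative_compose[OF _ G'] has_derivative_Pair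
          has_derivative_const has_derivative_ident) (simp add: V'_def)
    then have "(g has_derivative (\<lambda>b. fst (G' (0, v) (0, b)))) (at v)"
      by (rule has_derivative_transform_within_open[OF _ V' that]) (simp add: Gg(1))
    then show ?thesis by (auto simp: differentiable_def)
  qed
  have Dg: "Der g v b = - (Der F (g v, v) (0, b) * inverse (Der F (g v, v) (1, 0)))" if "v \<in> V'" for v b
  proof -
    have "((\<lambda>v. (g v, v)) has_derivative (\<lambda>b. (Der g v b, b))) (at v)"
      by (intro has_derivative_Pair Der_works g_diff that has_derivative_ident)
    from has_derivative_compose[OF this smooth_on_has_derivative[OF F Gg(2)[OF that]]]
    have "((\<lambda>v. F (g v, v)) has_derivative (\<lambda>b. Der F (g v, v) (Der g v b, b))) (at v)" .
    then have "((\<lambda>v. 0) has_derivative (\<lambda>b. Der F (g v, v) (Der g v b, b))) (at v)"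
      by (rule has_derivative_transform_within_open[OF _ V' that]) (simp add: Gg(3))
    then have "(\<lambda>b. Der F (g v, v) (Der g v b, b)) = (\<lambda>b. 0)"
      by (rule has_derivative_unique[OF _ has_derivative_const])
    then have "Der F (g v, v) (Der g v b, b) = 0" by (rule fun_cong)
    then have "Der g v b * Der F (g v, v) (1, 0) + Der F (g v, v) (0, b) = 0"
      by (simp only: Dsplit[OF Gg(2)[OF that], of "Der g v b" b])
    then show ?thesis using Gg(4)[OF that] by (simp add: field_simps)
  qed
  have "Ck_on k V' g" for k
  proof (induction k)
    case 0
    then show ?case using g_diff
      by (auto intro!: continuous_at_imp_continuous_on differentiable_imp_continuous_within)
  next
    case (Suc k)
    have comp: "Ck_on k V' (\<lambda>v. Der F (g v, v) w)" for w
      by (rule Ck_on_compose[OF V' smooth_on_open[OF F] _ Ck_on_graph[OF V' Suc]])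
        (use Gg(2) smooth_on_Der[OF F] in \<open>auto simp: smooth_on_def\<close>)
    have inv: "Ck_on k V' (\<lambda>v. inverse (Der F (g v, v) (1, 0)))"
      by (rule Ck_on_compose[OF V' _ _ comp Ck_on_inverse_real]) (use Gg(4) in \<open>auto simp: open_Compl\<close>)
    have "Ck_on k V' (\<lambda>v. Der g v b)" for b
    proof (rule Ck_on_cong[OF V'])
      show "(-1) * (Der F (g v, v) (0, b) * inverse (Der F (g v, v) (1, 0))) = Der g v b" if "v \<in> V'" for v
        using Dg[OF that] by simp
      show "Ck_on k V' (\<lambda>v. (-1) * (Der F (g v, v) (0, b) * inverse (Der F (g v, v) (1, 0))))"
        by (intro Ck_on_bilinear[OF bounded_bilinear_mult V'] Ck_on_const comp inv)
    qed
    then show ?case using g_diff by simp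
  qed
  then show ?thesis using V' v0' by (auto simp: smooth_on_def)
qed


section \<open>The gauge of a circular hypersurface\<close>

lemma norm_vector_scalar_mult: "norm (c *s (v::complex^2)) = cmod c * norm v"
  by (simp add: norm_vec_def L2_set_right_distrib norm_mult)

lemma scaleR_eq_vector_scalar_mult: "r *\<^sub>R (v::complex^2) = complex_of_real r *s v"
  by (simp add: vec_eq_iff scaleR_conv_of_real[where 'a=complex])

lemma bounded_linear_vector_scalar_mult_left: "bounded_linear (\<lambda>c. c *s (v::complex^2))"
  by (rule bounded_linear_intro[where K = "norm v"])
    (auto simp: vector_sadd_rdistrib norm_vector_scalar_mult scaleR_eq_vector_scalar_mult
      scaleR_conv_of_real)

lemma bounded_linear_vector_scalar_mult_right: "bounded_linear (\<lambda>v. c *s (v::complex^2))"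
  by (rule bounded_linear_intro[where K = "cmod c"])
    (auto simp: vector_add_ldistrib norm_vector_scalar_mult scaleR_eq_vector_scalar_mult mult.commute)

definition radius_of :: "(complex^2) set \<Rightarrow> complex^2 \<Rightarrow> real" where
  "radius_of Z v = (THE r. r > 0 \<and> Z \<inter> complex_line v = complex_line v \<inter> sphere 0 r)"

text \<open>The Minkowski functional of the domain that a circular surface bounds; it is one exactly on the
  surface.\<close>

definition gauge_of :: "(complex^2) set \<Rightarrow> complex^2 \<Rightarrow> real" where
  "gauge_of Z v = norm v / radius_of Z v"

lemma complex_line_scale:
  assumes "c \<noteq> 0" shows "complex_line (c *s v) = complex_line v"
proof -
  have "b *s v \<in> range (\<lambda>a. a *s (c *s v))" for b
    by (rule range_eqI[of _ _ "b / c"]) (use assms in simp)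
  then show ?thesis unfolding complex_line_def by auto
qed

lemma linear_attains_negative: "linear f \<Longrightarrow> f \<noteq> (\<lambda>v. 0::real) \<Longrightarrow> \<exists>n. f n < 0"
  by (metis linear_neg linorder_neqE_linordered_idom neg_0_less_iff_less neg_less_0_iff_less)

lemma mem_complex_line: "v \<in> complex_line v"
  unfolding complex_line_def by (rule range_eqI[of _ _ 1]) simp

lemma rotation_curve:
  "((\<lambda>t. exp (\<i> * complex_of_real t) *s (p::complex^2)) has_vector_derivative
     (\<i> * exp (\<i> * complex_of_real t)) *s p) (at t)"
proof -
  have "((\<lambda>z. exp (\<i> * z)) has_field_derivative \<i> * exp (\<i> * complex_of_real t)) (at (complex_of_real t))"
    by (auto intro!: derivative_eq_intros)
  from has_vector_derivative_real_field[OF this, of UNIV]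
  have "((\<lambda>t. exp (\<i> * complex_of_real t)) has_vector_derivative \<i> * exp (\<i> * complex_of_real t)) (at t)" .
  from bounded_linear.has_vector_derivative[OF bounded_linear_vector_scalar_mult_left this]
  show ?thesis .
qed

lemma line_derivatives:
  fixes f :: "complex^2 \<Rightarrow> real"
  assumes f: "smooth_on U f" and "q + s *\<^sub>R v \<in> U"
  shows "((\<lambda>s. f (q + s *\<^sub>R v)) has_real_derivative Der f (q + s *\<^sub>R v) v) (at s)"
    and "((\<lambda>s. Der f (q + s *\<^sub>R v) w) has_real_derivative hess f (q + s *\<^sub>R v) w v) (at s)"
proof -
  have c: "((\<lambda>s. q + s *\<^sub>R v) has_vector_derivative v) (at s)"
    unfolding has_vector_derivative_def by (auto intro!: derivative_eq_intros)
  show "((\<lambda>s. f (q + s *\<^sub>R v)) has_real_derivative Der f (q + s *\<^sub>R v) v) (at s)"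
    using Der_along_curve[OF f assms(2) c] by (simp add: has_real_derivative_iff_has_vector_derivative)
  show "((\<lambda>s. Der f (q + s *\<^sub>R v) w) has_real_derivative hess f (q + s *\<^sub>R v) w v) (at s)"
    using Der_along_curve[OF smooth_on_Der[OF f] assms(2) c]
    by (simp add: has_real_derivative_iff_has_vector_derivative hess_def)
qed

lemma strict_local_min:
  fixes g g1 :: "real \<Rightarrow> real"
  assumes r: "r > 0" and g: "\<And>s. \<bar>s\<bar> < r \<Longrightarrow> (g has_real_derivative g1 s) (at s)"
    and g1: "(g1 has_real_derivative c) (at 0)" "c > 0" and "g 0 = 0" "g1 0 = 0"
  shows "\<exists>d>0. \<forall>h. 0 < h \<and> h < d \<longrightarrow> g h > 0 \<and> g (- h) > 0"
proof -
  obtain d1 where d1: "d1 > 0" "\<And>h. 0 < h \<Longrightarrow> h < d1 \<Longrightarrow> g1 0 < g1 (0 + h)"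
    using DERIV_pos_inc_right[OF g1] by auto
  obtain d2 where d2: "d2 > 0" "\<And>h. 0 < h \<Longrightarrow> h < d2 \<Longrightarrow> g1 (0 - h) < g1 0"
    using DERIV_pos_inc_left[OF g1] by auto
  define d where "d = min r (min d1 d2)"
  have "g h > 0 \<and> g (- h) > 0" if h: "0 < h" "h < d" for h
  proof
    have "\<exists>z. 0 < z \<and> z < h \<and> g h - g 0 = (h - 0) * g1 z"
      using h by (intro MVT2 g) (auto simp: d_def)
    then obtain z where z: "0 < z" "z < h" "g h = h * g1 z" using assms by auto
    then have "g1 z > 0" using d1(2)[of z] h assms by (simp add: d_def)
    then show "g h > 0" using z h by simp
    have "\<exists>z. -h < z \<and> z < 0 \<and> g 0 - g (-h) = (0 - (-h)) * g1 z"
      using h by (intro MVT2 g) (auto simp: d_def)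
    then obtain z where z: "-h < z" "z < 0" "g (-h) = - h * g1 z" using assms by auto
    then have "g1 z < 0" using d2(2)[of "-z"] h assms by (simp add: d_def)
    then show "g (- h) > 0" using z h by (simp add: mult_pos_neg)
  qed
  moreover have "d > 0" using d1 d2 r by (simp add: d_def)
  ultimately show ?thesis by blast
qed

locale circular_surface =
  fixes Z :: "(complex^2) set"
  assumes circular: "circular_hypersurface Z" and spc: "strongly_pseudoconvex Z"
begin

abbreviation "N \<equiv> gauge_of Z"

lemma radius_of:
  assumes "v \<noteq> 0"
  shows "radius_of Z v > 0" "Z \<inter> complex_line v = complex_line v \<inter> sphere 0 (radius_of Z v)"
proof -
  obtain r where r: "r > 0" "Z \<inter> complex_line v = complex_line v \<inter> sphere 0 r"
    using circular assms unfolding circular_hypersurface_def by blast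
  have "radius_of Z v = r"
    unfolding radius_of_def
  proof (rule the_equality)
    fix s assume s: "s > 0 \<and> Z \<inter> complex_line v = complex_line v \<inter> sphere 0 s"
    have "complex_of_real (r / norm v) *s v \<in> complex_line v \<inter> sphere 0 r"
      using r(1) assms by (simp add: complex_line_def norm_vector_scalar_mult norm_divide)
    then have "complex_of_real (r / norm v) *s v \<in> sphere 0 s" using r s by blast
    then show "s = r" using r(1) assms by (simp add: norm_vector_scalar_mult norm_divide)
  qed (use r in auto)
  then show "radius_of Z v > 0" "Z \<inter> complex_line v = complex_line v \<inter> sphere 0 (radius_of Z v)"
    using r by auto
qed

lemma gauge_pos: "v \<noteq> 0 \<Longrightarrow> N v > 0"
  by (simp add: gauge_of_def radius_of)

lemma gauge_0 [simp]: "N 0 = 0"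
  by (simp add: gauge_of_def)

lemma zero_notin: "0 \<notin> Z"
proof
  assume "0 \<in> Z"
  define v where "v = (axis 1 1 :: complex^2)"
  have v: "v \<noteq> 0" by (simp add: v_def axis_eq_0_iff)
  have "0 \<in> complex_line v" unfolding complex_line_def by (rule range_eqI[of _ _ 0]) simp
  then have "0 \<in> sphere (0::complex^2) (radius_of Z v)"
    using \<open>0 \<in> Z\<close> radius_of(2)[OF v] by blast
  then show False using radius_of(1)[OF v] by simp
qed

lemma mem_iff: "v \<in> Z \<longleftrightarrow> N v = 1"
proof (cases "v = 0")
  case False
  have "v \<in> Z \<longleftrightarrow> v \<in> Z \<inter> complex_line v" using mem_complex_line by simp
  also have "\<dots> \<longleftrightarrow> norm v = radius_of Z v"
    unfolding radius_of(2)[OF False] using mem_complex_line by simp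
  finally show ?thesis using radius_of(1)[OF False] False by (auto simp: gauge_of_def field_simps)
qed (use zero_notin in simp)

lemma gauge_scale: "N (c *s v) = cmod c * N v"
proof (cases "c = 0")
  case False
  then show ?thesis
    by (simp add: gauge_of_def radius_of_def complex_line_scale norm_vector_scalar_mult)
qed simp

lemma gauge_scaleR: "N (r *\<^sub>R v) = \<bar>r\<bar> * N v"
  by (simp add: scaleR_eq_vector_scalar_mult gauge_scale)

lemma radial_projection: "v \<noteq> 0 \<Longrightarrow> inverse (N v) *\<^sub>R v \<in> Z"
  using gauge_pos[of v] by (simp add: mem_iff gauge_scaleR)

lemma circle_derivatives:
  assumes U: "p \<in> U" "defining_function Z U \<rho>" and p: "p \<in> Z"
  shows "Der \<rho> p (\<i> *s p) = 0" and "hess \<rho> p (\<i> *s p) (\<i> *s p) = Der \<rho> p p"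
proof -
  have \<rho>: "smooth_on U \<rho>" and Z: "Z \<inter> U = {x \<in> U. \<rho> x = 0}"
    using U by (auto simp: defining_function_def)
  let ?c = "\<lambda>t. exp (\<i> * complex_of_real t) *s p"
  let ?c1 = "\<lambda>t. (\<i> * exp (\<i> * complex_of_real t)) *s p"
  define I where "I = ?c -` U"
  have "isCont ?c t" for t
    by (rule has_vector_derivative_continuous[OF rotation_curve])
  then have I: "open I" unfolding I_def
    using smooth_on_open[OF \<rho>] by (intro open_vimage continuous_at_imp_continuous_on) auto
  have I0: "0 \<in> I" using U by (simp add: I_def)
  have c1: "(?c1 has_vector_derivative - p) (at 0)"
    using bounded_linear.has_vector_derivative[OF bounded_linear_vector_scalar_mult_right rotation_curve, of \<i> p 0]
    by (simp add: vector_smult_assoc)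
  have zero: "\<rho> (?c t) = 0" if "t \<in> I" for t
  proof -
    have "?c t \<in> Z" using p by (simp add: mem_iff gauge_scale)
    then show ?thesis using that Z by (auto simp: I_def)
  qed
  have inU: "?c t \<in> U" if "t \<in> I" for t using that by (simp add: I_def)
  note L = level_curve[OF \<rho> I I0 inU rotation_curve c1 zero]
  show "Der \<rho> p (\<i> *s p) = 0" using L(1) by simp
  have "Der \<rho> p (- p) = - Der \<rho> p p" by (rule linear_neg[OF smooth_on_linear_Der[OF \<rho> U(1)]])
  then show "hess \<rho> p (\<i> *s p) (\<i> *s p) = Der \<rho> p p" using L(2) by simp
qed

text \<open>Suppose the ray through \<open>p\<close> were tangent to the surface. The circle through \<open>p\<close> supplies the other real
  direction, so the complex line through \<open>p\<close> would be the complex tangent, and along it the Levi form would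
  reduce to the second radial derivative of \<open>\<rho>\<close>. Positivity would give \<open>\<rho>\<close> a strict minimum at \<open>p\<close> along the
  ray. Displacing the ray towards the side where \<open>\<rho>\<close> is negative would then produce two points of the surface
  on one ray.\<close>

lemma transversal:
  assumes U: "p \<in> U" "defining_function Z U \<rho>" and p: "p \<in> Z"
    and levi: "\<And>t. t \<noteq> 0 \<Longrightarrow> (\<Sum>j\<in>UNIV. dz j (\<lambda>x. complex_of_real (\<rho> x)) p * (t $ j)) = 0 \<Longrightarrow> levi_form \<rho> p t > 0"
  shows "Der \<rho> p p \<noteq> 0"
proof
  assume 0: "Der \<rho> p p = 0"
  have \<rho>: "smooth_on U \<rho>" and Z: "Z \<inter> U = {x \<in> U. \<rho> x = 0}" and nz: "Der \<rho> p \<noteq> (\<lambda>v. 0)"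
    using U p by (auto simp: defining_function_def)
  have p0: "p \<noteq> 0" using p zero_notin by auto
  have "levi_form \<rho> p p > 0"
  proof (rule levi[OF p0])
    show "(\<Sum>j\<in>UNIV. dz j (\<lambda>x. complex_of_real (\<rho> x)) p * (p $ j)) = 0"
      unfolding complex_tangent_iff[OF \<rho> U(1)] using 0 circle_derivatives(1)[OF assms(1-3)]
      by (simp add: complex_eq_iff)
  qed
  then have H: "hess \<rho> p p p > 0"
    using circle_derivatives(2)[OF assms(1-3)] 0 unfolding levi_form_hess[OF \<rho> U(1)] by simp
  obtain R where R: "R > 0" "ball p R \<subseteq> U"
    using smooth_on_open[OF \<rho>] U(1) open_contains_ball by blast
  have np: "norm p > 0" using p0 by simp
  have inU: "p + s *\<^sub>R p \<in> U" if "\<bar>s\<bar> < R / norm p" for s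
    using that np R by (intro subsetD[OF R(2)]) (simp add: dist_norm field_simps)
  have "\<rho> p = 0" using p U Z by auto
  have "\<exists>d>0. \<forall>h. 0 < h \<and> h < d \<longrightarrow> \<rho> (p + h *\<^sub>R p) > 0 \<and> \<rho> (p + (- h) *\<^sub>R p) > 0"
  proof (rule strict_local_min[of "R / norm p" _ "\<lambda>s. Der \<rho> (p + s *\<^sub>R p) p" "hess \<rho> p p p"])
    show "((\<lambda>s. \<rho> (p + s *\<^sub>R p)) has_real_derivative Der \<rho> (p + s *\<^sub>R p) p) (at s)" if "\<bar>s\<bar> < R / norm p" for s
      by (rule line_derivatives[OF \<rho> inU[OF that]])
    show "((\<lambda>s. Der \<rho> (p + s *\<^sub>R p) p) has_real_derivative hess \<rho> p p p) (at 0)"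
      using line_derivatives(2)[OF \<rho> inU[of 0]] R np by simp
  qed (use R np H 0 \<open>\<rho> p = 0\<close> in auto)
  then obtain d where d: "d > 0" "\<And>h. 0 < h \<Longrightarrow> h < d \<Longrightarrow> \<rho> (p + h *\<^sub>R p) > 0 \<and> \<rho> (p + (- h) *\<^sub>R p) > 0"
    by blast
  define h where "h = min (d/2) (min (1/2) (R / (2 * norm p)))"
  have h: "0 < h" "h < d" "h < 1" "h * norm p \<le> R / 2"
  proof -
    have "h \<le> R / (2 * norm p)" by (simp add: h_def)
    then show "h * norm p \<le> R / 2" using np by (simp add: field_simps)
  qed (use d R np in \<open>auto simp: h_def\<close>)
  (* n points to the side where rho is negative; p + e n is negative while its multiples by 1 + h and 1 - h
     stay positive for small e. *)
  obtain n where n: "Der \<rho> p n < 0"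
    using linear_attains_negative[OF smooth_on_linear_Der[OF \<rho> U(1)] nz] by blast
  have n0: "norm n > 0" using n linear_0[OF smooth_on_linear_Der[OF \<rho> U(1)]] by (cases "n = 0") auto
  let ?q = "\<lambda>e. p + e *\<^sub>R n"
  have seg: "s *\<^sub>R ?q e \<in> U" if "\<bar>e\<bar> < R / (4 * norm n)" "1 - h \<le> s" "s \<le> 1 + h" for s e
  proof -
    have "s *\<^sub>R ?q e - p = (s - 1) *\<^sub>R p + (s * e) *\<^sub>R n" by (simp add: algebra_simps)
    then have "norm (s *\<^sub>R ?q e - p) \<le> \<bar>s - 1\<bar> * norm p + \<bar>s\<bar> * (\<bar>e\<bar> * norm n)"
      using norm_triangle_ineq[of "(s - 1) *\<^sub>R p" "(s * e) *\<^sub>R n"] by (simp add: abs_mult mult.assoc)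
    also have "\<dots> \<le> h * norm p + 2 * (\<bar>e\<bar> * norm n)"
      using that h by (intro add_mono mult_right_mono) auto
    also have "\<dots> < R / 2 + 2 * (R / 4)"
      using that(1) n0 h(4) by (intro add_le_less_mono) (auto simp: field_simps)
    finally show ?thesis using R by (intro subsetD[OF R(2)]) (simp add: dist_norm norm_minus_commute)
  qed
  have "eventually (\<lambda>e. \<rho> (s *\<^sub>R ?q e) > 0) (at_right 0)" if "1 - h \<le> s" "s \<le> 1 + h" "\<rho> (s *\<^sub>R p) > 0" for s
  proof -
    have "s *\<^sub>R p \<in> U" using seg[of 0 s] that R n0 by simp
    then have "isCont \<rho> (s *\<^sub>R p)"
      using smooth_on_continuous[OF \<rho>] smooth_on_open[OF \<rho>] by (simp add: continuous_on_eq_continuous_at)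
    then have "((\<lambda>e. \<rho> (s *\<^sub>R ?q e)) \<longlongrightarrow> \<rho> (s *\<^sub>R p)) (at_right 0)"
      by (rule isCont_tendsto_compose) (auto intro!: tendsto_eq_intros)
    then show ?thesis using order_tendstoD(1)[OF _ that(3)] by blast
  qed
  from this[of "1 + h"] this[of "1 - h"] d(2)[OF h(1,2)] h
  have ev: "eventually (\<lambda>e. \<rho> ((1 + h) *\<^sub>R ?q e) > 0) (at_right 0)"
    "eventually (\<lambda>e. \<rho> ((1 - h) *\<^sub>R ?q e) > 0) (at_right 0)"
    by (auto simp: algebra_simps)
  have ev3: "eventually (\<lambda>e. \<rho> (?q e) < 0) (at_right 0)"
  proof -
    have "((\<lambda>e. \<rho> (?q e)) has_real_derivative Der \<rho> p n) (at 0)"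
      using line_derivatives(1)[OF \<rho>, of p 0 n] U(1) by simp
    from DERIV_neg_dec_right[OF this n] obtain d' where
      "d' > 0" "\<And>h. 0 < h \<Longrightarrow> h < d' \<Longrightarrow> \<rho> (?q h) < \<rho> p" by auto
    then show ?thesis using \<open>\<rho> p = 0\<close> by (auto simp: eventually_at_right intro!: exI[of _ d'])
  qed
  have ev4: "eventually (\<lambda>e. 0 < e \<and> e < R / (4 * norm n)) (at_right 0)"
    using R n0 by (auto simp: eventually_at_right intro!: exI[of _ "R / (4 * norm n)"])
  have "eventually (\<lambda>e. \<rho> ((1 + h) *\<^sub>R ?q e) > 0 \<and> \<rho> ((1 - h) *\<^sub>R ?q e) > 0 \<and> \<rho> (?q e) < 0
      \<and> (0 < e \<and> e < R / (4 * norm n))) (at_right (0::real))"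
    using ev ev3 ev4 by (simp add: eventually_conj_iff)
  then obtain e where e: "\<rho> ((1 + h) *\<^sub>R ?q e) > 0" "\<rho> ((1 - h) *\<^sub>R ?q e) > 0" "\<rho> (?q e) < 0"
    "0 < e" "e < R / (4 * norm n)"
    using eventually_happens'[OF trivial_limit_at_right_real] by blast
  have cont: "continuous_on {1 - h..1 + h} (\<lambda>s. \<rho> (s *\<^sub>R ?q e))"
    by (rule continuous_on_compose2[OF smooth_on_continuous[OF \<rho>]])
      (use seg e in \<open>auto intro!: continuous_intros\<close>)
  have "\<exists>s. 1 - h \<le> s \<and> s \<le> 1 \<and> \<rho> (s *\<^sub>R ?q e) = 0"
    using e h by (intro IVT2') (auto intro: continuous_on_subset[OF cont])
  moreover have "\<exists>s. 1 \<le> s \<and> s \<le> 1 + h \<and> \<rho> (s *\<^sub>R ?q e) = 0"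
    using e h by (intro IVT') (auto intro: continuous_on_subset[OF cont])
  ultimately obtain s s' where s: "1 - h \<le> s" "s \<le> 1" "\<rho> (s *\<^sub>R ?q e) = 0"
    and s': "1 \<le> s'" "s' \<le> 1 + h" "\<rho> (s' *\<^sub>R ?q e) = 0" by blast
  have "s \<noteq> 1" using s e by auto
  then have ss: "s < s'" using s s' by simp
  have "s *\<^sub>R ?q e \<in> Z \<inter> U" "s' *\<^sub>R ?q e \<in> Z \<inter> U"
    unfolding Z using s s' seg e h by auto
  then have "\<bar>s\<bar> * N (?q e) = 1" "\<bar>s'\<bar> * N (?q e) = 1" by (auto simp: mem_iff gauge_scaleR)
  then have "\<bar>s\<bar> = \<bar>s'\<bar>" by (metis mult_cancel_right zero_neq_one mult_zero_right)
  then show False using ss s s' h by simp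
qed

lemma gauge_inverse_smooth_at:
  assumes v0: "v0 \<noteq> 0"
  shows "\<exists>V. v0 \<in> V \<and> smooth_on V (\<lambda>v. inverse (N v))"
proof -
  define t0 where "t0 = inverse (N v0)"
  define p where "p = t0 *\<^sub>R v0"
  have t0: "t0 > 0" using gauge_pos[OF v0] by (simp add: t0_def)
  have pZ: "p \<in> Z" using radial_projection[OF v0] by (simp add: p_def t0_def)
  obtain U \<rho> where U: "p \<in> U" "defining_function Z U \<rho>"
    and levi: "\<forall>t. t \<noteq> 0 \<and> (\<Sum>j\<in>UNIV. dz j (\<lambda>x. complex_of_real (\<rho> x)) p * (t $ j)) = 0
        \<longrightarrow> levi_form \<rho> p t > 0"
    using bspec[OF spc[unfolded strongly_pseudoconvex_def] pZ] by (elim exE conjE) (rule that)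
  have \<rho>: "smooth_on U \<rho>" and Z: "Z \<inter> U = {x \<in> U. \<rho> x = 0}"
    using U by (auto simp: defining_function_def)
  have g: "Der \<rho> p p \<noteq> 0" by (rule transversal[OF U pZ]) (use levi in simp)
  let ?m = "\<lambda>x::real \<times> (complex^2). fst x *\<^sub>R snd x"
  define W where "W = ({0<..} \<times> UNIV) \<inter> ?m -` U"
  have op: "open (?m -` U)"
    by (rule open_vimage[OF smooth_on_open[OF \<rho>]]) (rule continuous_on_scaleR[OF continuous_on_fst[OF continuous_on_id] continuous_on_snd[OF continuous_on_id]])
  have W: "open W"
    unfolding W_def by (rule open_Int[OF open_Times[OF open_greaterThan open_UNIV] op])
  have m: "smooth_on W ?m"
    by (rule smooth_on_scaleR[OF smooth_on_linear[OF bounded_linear_fst W] smooth_on_linear[OF bounded_linear_snd W]])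
  have F: "smooth_on W (\<lambda>x. \<rho> (?m x))"
    by (rule smooth_on_compose[OF m \<rho>]) (auto simp: W_def)
  have p0: "(t0, v0) \<in> W" using t0 U by (simp add: W_def p_def)
  have m': "(?m has_derivative (\<lambda>b. t0 *\<^sub>R snd b + fst b *\<^sub>R v0)) (at (t0, v0))"
    using has_derivative_scaleR[OF has_derivative_fst[OF has_derivative_ident] has_derivative_snd[OF has_derivative_ident], of "(t0, v0)" UNIV]
    by simp
  have "(\<rho> has_derivative Der \<rho> p) (at (?m (t0, v0)))"
    using smooth_on_has_derivative[OF \<rho> U(1)] by (simp add: p_def)
  from has_derivative_compose[OF m' this]
  have "((\<lambda>x. \<rho> (?m x)) has_derivative (\<lambda>b. Der \<rho> p (t0 *\<^sub>R snd b + fst b *\<^sub>R v0))) (at (t0, v0))" .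
  from Der_eq[OF this] have "Der (\<lambda>x. \<rho> (?m x)) (t0, v0) (1, 0) = Der \<rho> p v0" by simp
  moreover have "Der \<rho> p p = t0 * Der \<rho> p v0"
    using linear_scale[OF smooth_on_linear_Der[OF \<rho> U(1)], of t0 v0] by (simp add: p_def)
  ultimately have nz: "Der (\<lambda>x. \<rho> (?m x)) (t0, v0) (1, 0) \<noteq> 0" using g by auto
  show ?thesis
  proof (rule smooth_implicit_function[OF F])
    show "(inverse (N v0), v0) \<in> W" using p0 by (simp add: t0_def)
    show "\<rho> (?m (inverse (N v0), v0)) = 0" using pZ U Z by (auto simp: p_def t0_def)
    show "Der (\<lambda>x. \<rho> (?m x)) (inverse (N v0), v0) (1, 0) \<noteq> 0" using nz by (simp add: t0_def)
    fix t v assume tv: "(t, v) \<in> W" "\<rho> (?m (t, v)) = 0"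
    then have "t *\<^sub>R v \<in> Z" using Z by (auto simp: W_def)
    then have "\<bar>t\<bar> * N v = 1" by (simp add: mem_iff gauge_scaleR)
    moreover have "t > 0" using tv by (simp add: W_def)
    ultimately have "t * N v = 1" by simp
    then show "t = inverse (N v)" by (auto simp: inverse_eq_divide eq_divide_eq)
  qed
qed

lemma gauge_smooth: "smooth_on (- {0}) N"
proof -
  have "smooth_on (- {0}) (\<lambda>v. inverse (N v))"
    by (rule smooth_on_local) (use gauge_inverse_smooth_at in auto)
  then have "smooth_on (- {0}) (\<lambda>v. inverse (inverse (N v)))"
    by (rule smooth_on_inverse) (use gauge_pos in force)
  then show ?thesis by simp
qed

text \<open>A global defining function. A complex dilation changes it by a constant only, so its derivatives are
  homogeneous.\<close>

definition u :: "complex^2 \<Rightarrow> real" where "u v = ln (N v)"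

lemma u_smooth: "smooth_on (- {0}) u"
  unfolding u_def[abs_def] by (intro smooth_on_ln gauge_smooth) (use gauge_pos in auto)

lemma u_scale: "c \<noteq> 0 \<Longrightarrow> v \<noteq> 0 \<Longrightarrow> u (c *s v) = ln (cmod c) + u v"
  using gauge_pos[of v] by (simp add: u_def gauge_scale ln_mult)

end


section \<open>The Fefferman form of a circular hypersurface\<close>

lemma vector_4:
  "(vector [w,x,y,z] ::('a::zero)^4)$1 = w"
  "(vector [w,x,y,z] ::('a::zero)^4)$2 = x"
  "(vector [w,x,y,z] ::('a::zero)^4)$3 = y"
  "(vector [w,x,y,z] ::('a::zero)^4)$4 = z"
  unfolding vector_def by simp_all

lemma det_4:
  "det (A::'a::comm_ring_1^4^4) =
    A$1$1 * (A$2$2 * (A$3$3 * A$4$4 - A$3$4 * A$4$3) - A$2$3 * (A$3$2 * A$4$4 - A$3$4 * A$4$2) + A$2$4 * (A$3$2 * A$4$3 - A$3$3 * A$4$2))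
  - A$1$2 * (A$2$1 * (A$3$3 * A$4$4 - A$3$4 * A$4$3) - A$2$3 * (A$3$1 * A$4$4 - A$3$4 * A$4$1) + A$2$4 * (A$3$1 * A$4$3 - A$3$3 * A$4$1))
  + A$1$3 * (A$2$1 * (A$3$2 * A$4$4 - A$3$4 * A$4$2) - A$2$2 * (A$3$1 * A$4$4 - A$3$4 * A$4$1) + A$2$4 * (A$3$1 * A$4$2 - A$3$2 * A$4$1))
  - A$1$4 * (A$2$1 * (A$3$2 * A$4$3 - A$3$3 * A$4$2) - A$2$2 * (A$3$1 * A$4$3 - A$3$3 * A$4$1) + A$2$3 * (A$3$1 * A$4$2 - A$3$2 * A$4$1))"
proof -
  have f1: "finite {2::4, 3, 4}" "1 \<notin> {2::4, 3, 4}" by auto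
  have f2: "finite {3::4, 4}" "2 \<notin> {3::4, 4}" by auto
  have f3: "finite {4::4}" "3 \<notin> {4::4}" by auto
  show ?thesis
    unfolding det_def UNIV_4
    unfolding sum_over_permutations_insert[OF f1]
    unfolding sum_over_permutations_insert[OF f2]
    unfolding sum_over_permutations_insert[OF f3]
    unfolding permutes_sing
    by (simp add: sign_swap_id permutation_swap_id permutation_compose sign_compose sign_id swap_id_eq algebra_simps)
qed

lemmas volume_form_simps = volume_form_def real_coords_def det_4 vector_4

lemma linear_volume_form:
  "linear (\<lambda>x. volume_form x a b c)" "linear (\<lambda>x. volume_form a x b c)" "linear (\<lambda>x. volume_form a b x c)"
  "linear (\<lambda>x. volume_form a b c x)"
  by (auto intro!: linearI simp: volume_form_simps algebra_simps)

lemma volume_form_alternating: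
  "volume_form a a b c = 0" "volume_form a b a c = 0" "volume_form b a a c = 0"
  by (auto simp: volume_form_simps algebra_simps)

text \<open>Cramer's rule for the linear dependence of five vectors in a four-dimensional space, evaluated under
  \<open>l\<close>.\<close>

lemma volume_form_cramer:
  fixes l :: "complex^2 \<Rightarrow> real"
  assumes "linear l"
  shows "volume_form v1 v2 v3 p * l v4 - volume_form v1 v2 v4 p * l v3
       + volume_form v1 v3 v4 p * l v2 - volume_form v2 v3 v4 p * l v1 = l p * volume_form v1 v2 v3 v4"
  unfolding linear_vec2[OF assms, of v1] linear_vec2[OF assms, of v2] linear_vec2[OF assms, of v3]
    linear_vec2[OF assms, of v4] linear_vec2[OF assms, of p]
  by (simp add: volume_form_simps) algebra

lemma hess_add_self:
  fixes f :: "'a::euclidean_space \<Rightarrow> real"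
  assumes f: "smooth_on U f" "p \<in> U"
  shows "hess f p (v + w) (v + w) = hess f p v v + 2 * hess f p w v + hess f p w w"
  using hess_bilinear[OF f] hess_symmetric[OF f, of v w]
  by (simp add: bilinear_ladd bilinear_radd)

context circular_surface
begin

lemma Der_u_scale:
  assumes "c \<noteq> 0" "p \<noteq> 0"
  shows "Der u (c *s p) (c *s v) = Der u p v"
proof -
  have cp: "c *s p \<in> - {0}" using assms by simp
  have "((\<lambda>v. c *s v) has_derivative (\<lambda>v. c *s v)) (at p)"
    by (rule bounded_linear_imp_has_derivative[OF bounded_linear_vector_scalar_mult_right])
  from has_derivative_compose[OF this smooth_on_has_derivative[OF u_smooth cp]]
  have 1: "((\<lambda>v. u (c *s v)) has_derivative (\<lambda>v. Der u (c *s p) (c *s v))) (at p)" .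
  have "((\<lambda>v. ln (cmod c) + u v) has_derivative (\<lambda>w. 0 + Der u p w)) (at p)"
    by (intro has_derivative_add has_derivative_const smooth_on_has_derivative[OF u_smooth]) (use assms in simp)
  then have "((\<lambda>v. u (c *s v)) has_derivative (\<lambda>w. 0 + Der u p w)) (at p)"
    by (rule has_derivative_transform_within_open[of _ _ _ _ "- {0}"]) (use assms in \<open>auto simp: u_scale\<close>)
  from has_derivative_unique[OF 1 this] show ?thesis by (metis add_0)
qed

lemma Der_u_self:
  assumes "p \<noteq> 0"
  shows "Der u p (c *s p) = Re c"
proof -
  have c: "((\<lambda>t. exp (c * complex_of_real t) *s p) has_vector_derivative c *s p) (at 0)"
  proof -
    have "((\<lambda>z. exp (c * z)) has_field_derivative c) (at (complex_of_real 0))"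
      by (auto intro!: derivative_eq_intros)
    from has_vector_derivative_real_field[OF this, of UNIV]
    have "((\<lambda>t. exp (c * complex_of_real t)) has_vector_derivative c) (at 0)" .
    from bounded_linear.has_vector_derivative[OF bounded_linear_vector_scalar_mult_left this]
    show ?thesis .
  qed
  have "((\<lambda>t. u (exp (c * complex_of_real t) *s p)) has_vector_derivative Der u p (c *s p)) (at 0)"
    using Der_along_curve[OF u_smooth _ c] assms by simp
  moreover have "u (exp (c * complex_of_real t) *s p) = Re c * t + u p" for t
    using assms by (simp add: u_scale)
  ultimately have "((\<lambda>t. Re c * t + u p) has_real_derivative Der u p (c *s p)) (at 0)"
    by (simp add: has_real_derivative_iff_has_vector_derivative)
  moreover have "((\<lambda>t. Re c * t + u p) has_real_derivative Re c) (at 0)"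
    by (auto intro!: derivative_eq_intros)
  ultimately show ?thesis by (rule DERIV_unique)
qed

lemma hess_u_scale:
  assumes "c \<noteq> 0" "p \<noteq> 0"
  shows "hess u (c *s p) (c *s v) (c *s w) = hess u p v w"
proof -
  have cp: "c *s p \<in> - {0}" using assms by simp
  have "((\<lambda>v. c *s v) has_derivative (\<lambda>v. c *s v)) (at p)"
    by (rule bounded_linear_imp_has_derivative[OF bounded_linear_vector_scalar_mult_right])
  from has_derivative_compose[OF this hess_has_derivative[OF u_smooth cp]]
  have 1: "((\<lambda>x. Der u (c *s x) (c *s v)) has_derivative (\<lambda>w. hess u (c *s p) (c *s v) (c *s w))) (at p)" .
  have "((\<lambda>x. Der u x v) has_derivative hess u p v) (at p)"
    by (rule hess_has_derivative[OF u_smooth]) (use assms in simp)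
  then have "((\<lambda>x. Der u (c *s x) (c *s v)) has_derivative hess u p v) (at p)"
    by (rule has_derivative_transform_within_open[of _ _ _ _ "- {0}"]) (use assms in \<open>auto simp: Der_u_scale\<close>)
  from has_derivative_unique[OF 1 this] show ?thesis by (rule fun_cong)
qed

text \<open>Obtained by differentiating the constant function \<open>Der u q (c *s q) = Re c\<close> of \<open>q\<close> in direction \<open>v\<close>.\<close>

lemma hess_u_self:
  assumes p: "p \<noteq> 0"
  shows "hess u p (c *s p) v = - Der u p (c *s v)"
proof -
  have pU: "p \<in> - {0}" using p by simp
  define q where "q s = p + s *\<^sub>R v" for s
  have q: "(q has_vector_derivative v) (at 0)"
    unfolding has_vector_derivative_def q_def by (auto intro!: derivative_eq_intros)
  have q0: "q 0 = p" by (simp add: q_def)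
  define I where "I = q -` (- {0})"
  have "open I" unfolding I_def q_def by (intro open_vimage continuous_intros)
  have "0 \<in> I" using p by (simp add: I_def q_def)
  have d: "((\<lambda>s. Der u (q s) w) has_real_derivative hess u p w v) (at 0)" for w
    using Der_along_curve[OF smooth_on_Der[OF u_smooth, of w], of q 0 v] q p
    by (simp add: has_real_derivative_iff_has_vector_derivative hess_def q0)
  have "((\<lambda>s. Der u (q s) (c *s p) + s * Der u (q s) (c *s v)) has_real_derivative
     hess u p (c *s p) v + (1 * Der u (q 0) (c *s v) + hess u p (c *s v) v * 0)) (at 0)"
    by (intro DERIV_add DERIV_mult d DERIV_ident)
  then have "((\<lambda>s. Re c) has_real_derivative
     hess u p (c *s p) v + (1 * Der u (q 0) (c *s v) + hess u p (c *s v) v * 0)) (at 0)"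
  proof (rule has_field_derivative_transform_within_open[OF _ \<open>open I\<close> \<open>0 \<in> I\<close>])
    fix s assume "s \<in> I"
    then have qs: "q s \<in> - {0}" by (simp add: I_def)
    have "c *s q s = c *s p + s *\<^sub>R (c *s v)"
      by (simp add: q_def vec_eq_iff algebra_simps scaleR_conv_of_real)
    then have "Der u (q s) (c *s q s) = Der u (q s) (c *s p) + s * Der u (q s) (c *s v)"
      using smooth_on_linear_Der[OF u_smooth qs] by (simp add: linear_add linear_scale)
    then show "Der u (q s) (c *s p) + s * Der u (q s) (c *s v) = Re c"
      using Der_u_self[of "q s" c] qs by simp
  qed
  then show ?thesis
    using DERIV_unique[OF _ DERIV_const[of "Re c" "at 0"]] by (force simp: q0)
qed

text \<open>Along complex lines through the origin \<open>u\<close> is the logarithm of a modulus, hence harmonic, and the mixed terms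
  for \<open>t\<close> and \<open>\<i> t\<close> cancel. So the Levi form of \<open>u\<close> descends to the tangent space of the projective
  line.\<close>

lemma levi_form_u_mod_self:
  assumes p: "p \<noteq> 0"
  shows "levi_form u p (t + a *s p) = levi_form u p t"
proof -
  have pU: "p \<in> - {0}" using p by simp
  have neg: "Der u p (- v) = - Der u p v" for v
    by (rule linear_neg[OF smooth_on_linear_Der[OF u_smooth pU]])
  have e: "\<i> *s (t + a *s p) = \<i> *s t + (\<i> * a) *s p"
    by (simp add: vec_eq_iff algebra_simps)
  have n1: "(\<i> * a) *s (\<i> *s t) = - (a *s t)" and n2: "(\<i> * a) *s ((\<i> * a) *s p) = - (a *s (a *s p))"
    by (simp_all add: vec_eq_iff algebra_simps)
  show ?thesis
    unfolding levi_form_hess[OF u_smooth pU] e hess_add_self[OF u_smooth pU] hess_u_self[OF p] n1 n2 neg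
    by simp
qed

abbreviation uc :: "complex^2 \<Rightarrow> complex" where "uc \<equiv> (\<lambda>x. complex_of_real (u x))"

definition tangent_u :: "complex^2 \<Rightarrow> complex^2" where
  "tangent_u p = vector [dz 2 uc p, - dz 1 uc p]"

lemma dz_u_self: "p \<noteq> 0 \<Longrightarrow> dz 1 uc p * p$1 + dz 2 uc p * p$2 = 1/2"
  using complex_tangent_iff[OF u_smooth, of p p] Der_u_self[of p 1] Der_u_self[of p \<i>]
  by (simp add: sum_2 complex_eq_iff)

text \<open>Modulo the position vector, the tangent vector is a multiple of the second basis vector; Euler's relation
  \<open>dz_u_self\<close> gives the factor \<open>-1 / (2 p\<^sub>1)\<close>.\<close>

lemma M_op_u:
  assumes p: "p \<noteq> 0" and p1: "p$1 \<noteq> 0"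
  shows "M_op u p = levi_form u p (axis 2 1) / (4 * (cmod (p$1))\<^sup>2)"
proof -
  have pU: "p \<in> - {0}" using p by simp
  have "tangent_u p + (- dz 2 uc p / p$1) *s p = (- 1 / (2 * p$1)) *s axis 2 1"
  proof -
    have "- dz 1 uc p - dz 2 uc p / p$1 * p$2 = - 1 / (2 * p$1)"
      using dz_u_self[OF p] p1 by (simp add: field_simps) algebra
    then show ?thesis
      using p1 by (simp add: vec_eq_iff forall_2 tangent_u_def vector_2 axis_def)
  qed
  then have "levi_form u p (tangent_u p) = levi_form u p ((- 1 / (2 * p$1)) *s axis 2 1)"
    using levi_form_u_mod_self[OF p] by metis
  also have "\<dots> = (cmod (1 / (2 * p$1)))\<^sup>2 * levi_form u p (axis 2 1)"
    by (subst levi_form_scale) (simp add: norm_divide norm_mult)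
  finally show ?thesis
    using M_op_levi[OF u_smooth pU] by (simp add: tangent_u_def norm_divide norm_mult power_divide power_mult_distrib)
qed

lemma u_zero_iff: "v \<noteq> 0 \<Longrightarrow> u v = 0 \<longleftrightarrow> v \<in> Z"
  using gauge_pos[of v] by (simp add: u_def mem_iff)

lemma defining_function_u: "defining_function Z (- {0}) u"
proof -
  have "Der u p \<noteq> (\<lambda>v. 0)" if "p \<noteq> 0" for p
  proof
    assume "Der u p = (\<lambda>v. 0)"
    then show False using Der_u_self[OF that, of 1] by simp
  qed
  then show ?thesis
    using u_smooth u_zero_iff zero_notin by (auto simp: defining_function_def)
qed

text \<open>Dividing by the gauge moves the tangent line at \<open>p\<close> into the surface along the ray
  direction, so differentiating twice compares an arbitrary defining function with \<open>u\<close>.\<close>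

lemma defining_function_compare:
  assumes U: "p \<in> U" "defining_function Z U \<rho>" and p: "p \<in> Z" and t: "Der u p t = 0"
  shows "Der \<rho> p t = 0" and "hess \<rho> p t t = Der \<rho> p p * hess u p t t"
proof -
  have \<rho>: "smooth_on U \<rho>" and Z: "Z \<inter> U = {x \<in> U. \<rho> x = 0}"
    using U by (auto simp: defining_function_def)
  have p0: "p \<noteq> 0" using p zero_notin by auto
  have up: "u p = 0" using p p0 u_zero_iff by auto
  define q where "q s = p + s *\<^sub>R t" for s
  define e where "e s = exp (- u (q s))" for s
  have q: "(q has_vector_derivative t) (at s)" for s
    unfolding has_vector_derivative_def q_def by (auto intro!: derivative_eq_intros)
  have qc: "continuous_on UNIV q" unfolding q_def by (intro continuous_intros)
  define I0 where "I0 = q -` (- {0})"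
  have I0: "open I0" unfolding I0_def by (intro open_vimage qc) auto
  have du: "((\<lambda>s. u (q s)) has_real_derivative Der u (q s) t) (at s)" if "s \<in> I0" for s
    using Der_along_curve[OF u_smooth _ q] that
    by (simp add: has_real_derivative_iff_has_vector_derivative I0_def)
  have ddu: "((\<lambda>s. Der u (q s) t) has_real_derivative hess u (q s) t t) (at s)" if "s \<in> I0" for s
    using Der_along_curve[OF smooth_on_Der[OF u_smooth] _ q] that
    by (simp add: has_real_derivative_iff_has_vector_derivative I0_def hess_def)
  have de: "(e has_real_derivative (- Der u (q s) t * e s)) (at s)" if "s \<in> I0" for s
    unfolding e_def using du[OF that] by (auto intro!: derivative_eq_intros)
  (* The tangent line pushed back into Z along rays, together with its velocity. *)
  define c where "c s = e s *\<^sub>R q s" for s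
  define c1 where "c1 s = e s *\<^sub>R t + (- Der u (q s) t * e s) *\<^sub>R q s" for s
  have c: "(c has_vector_derivative c1 s) (at s)" if "s \<in> I0" for s
    unfolding c_def c1_def by (rule has_vector_derivative_scaleR[OF de[OF that] q])
  have "continuous_on I0 c"
    using c by (intro continuous_at_imp_continuous_on ballI has_vector_derivative_continuous) auto
  define I where "I = I0 \<inter> c -` U"
  have I: "open I"
    unfolding I_def using \<open>continuous_on I0 c\<close> I0 smooth_on_open[OF \<rho>]
    by (simp add: continuous_on_open_vimage Int_commute)
  have q0: "q 0 = p" by (simp add: q_def)
  have e0: "e 0 = 1" by (simp add: e_def q0 up)
  have "0 \<in> I0" using p0 by (simp add: I0_def q0)
  then have I_0: "0 \<in> I" using U by (simp add: I_def c_def e0 q0)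
  have "((\<lambda>s. - Der u (q s) t * e s) has_real_derivative
      (- hess u (q 0) t t) * e 0 + (- Der u (q 0) t * e 0) * (- Der u (q 0) t)) (at 0)"
    by (intro DERIV_mult DERIV_minus ddu de \<open>0 \<in> I0\<close>)
  then have d1: "((\<lambda>s. - Der u (q s) t * e s) has_real_derivative - hess u p t t) (at 0)"
    using t by (simp add: q0 e0)
  have "(c1 has_vector_derivative
     ((e 0 *\<^sub>R 0 + (- Der u (q 0) t * e 0) *\<^sub>R t) + ((- Der u (q 0) t * e 0) *\<^sub>R t + (- hess u p t t) *\<^sub>R q 0))) (at 0)"
    unfolding c1_def
    by (rule has_vector_derivative_add[OF has_vector_derivative_scaleR[OF de[OF \<open>0 \<in> I0\<close>] has_vector_derivative_const]
       has_vector_derivative_scaleR[OF d1 q]])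
  then have c1: "(c1 has_vector_derivative (- hess u p t t) *\<^sub>R p) (at 0)"
    using t by (simp add: q0 e0)
  have zero: "\<rho> (c s) = 0" if "s \<in> I" for s
  proof -
    have qs: "q s \<noteq> 0" using that by (auto simp: I_def I0_def)
    have "e s = inverse (N (q s))"
      using gauge_pos[OF qs] by (simp add: e_def u_def exp_minus)
    then have "c s \<in> Z" using radial_projection[OF qs] by (simp add: c_def)
    then show ?thesis using that Z by (auto simp: I_def)
  qed
  have cU: "c s \<in> U" if "s \<in> I" for s using that by (simp add: I_def)
  have cI: "(c has_vector_derivative c1 s) (at s)" if "s \<in> I" for s using that c by (simp add: I_def)
  have c0: "c 0 = p" "c1 0 = t" using t by (simp_all add: c_def c1_def e0 q0)
  note L = level_curve[OF \<rho> I I_0 cU cI c1 zero, unfolded c0]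
  show "Der \<rho> p t = 0" by (rule L(1))
  show "hess \<rho> p t t = Der \<rho> p p * hess u p t t"
    using L(2) linear_scale[OF smooth_on_linear_Der[OF \<rho> U(1)], of "- hess u p t t" p] by simp
qed

lemma Der_defining_function:
  assumes U: "p \<in> U" "defining_function Z U \<rho>" and p: "p \<in> Z"
  shows "Der \<rho> p v = Der \<rho> p p * Der u p v"
proof -
  have \<rho>: "smooth_on U \<rho>" using U by (auto simp: defining_function_def)
  have p0: "p \<in> - {0}" using p zero_notin by auto
  have u1: "Der u p p = 1" using Der_u_self[of p 1] p0 by simp
  note lu = smooth_on_linear_Der[OF u_smooth p0] and l\<rho> = smooth_on_linear_Der[OF \<rho> U(1)]
  have "Der u p (v - Der u p v *\<^sub>R p) = 0"
    using lu u1 by (simp add: linear_diff linear_scale)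
  from defining_function_compare(1)[OF assms this]
  show ?thesis using l\<rho> by (simp add: linear_diff linear_scale)
qed

text \<open>The Levi form of \<open>\<rho>\<close> on complex tangent vectors is that of \<open>u\<close> times the radial derivative, and the gradient of
  \<open>\<rho>\<close> carries the same factor, which enters squared. The resulting cube is what makes the cube root in
  Fefferman's form compatible with a change of defining function.\<close>

lemma M_op_defining_function:
  assumes U: "p \<in> U" "defining_function Z U \<rho>" and p: "p \<in> Z"
  shows "M_op \<rho> p = (Der \<rho> p p) ^ 3 * M_op u p"
    and "levi_form \<rho> p (tangent_u p) = Der \<rho> p p * M_op u p"
    and "(\<Sum>j\<in>UNIV. dz j (\<lambda>x. complex_of_real (\<rho> x)) p * (tangent_u p $ j)) = 0"
proof -
  have \<rho>: "smooth_on U \<rho>" using U by (auto simp: defining_function_def)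
  have p0: "p \<in> - {0}" using p zero_notin by auto
  let ?g = "Der \<rho> p p"
  have dz: "dz j (\<lambda>x. complex_of_real (\<rho> x)) p = of_real ?g * dz j uc p" for j
    unfolding dz_real[OF \<rho> U(1)] dz_real[OF u_smooth p0] Der_defining_function[OF assms, of "axis j _"]
    by (simp add: complex_eq_iff)
  have zero_u: "(\<Sum>j\<in>UNIV. dz j uc p * (tangent_u p $ j)) = 0"
    by (simp add: sum_2 tangent_u_def vector_2)
  then show "(\<Sum>j\<in>UNIV. dz j (\<lambda>x. complex_of_real (\<rho> x)) p * (tangent_u p $ j)) = 0"
    by (simp add: sum_2 dz tangent_u_def vector_2)
  have t: "Der u p (tangent_u p) = 0" "Der u p (\<i> *s tangent_u p) = 0"
    using zero_u unfolding complex_tangent_iff[OF u_smooth p0] by (auto simp: complex_eq_iff)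
  show l: "levi_form \<rho> p (tangent_u p) = ?g * M_op u p"
    unfolding M_op_levi[OF u_smooth p0] levi_form_hess[OF \<rho> U(1)] tangent_u_def[symmetric]
      levi_form_hess[OF u_smooth p0] defining_function_compare(2)[OF assms t(1)]
      defining_function_compare(2)[OF assms t(2)]
    by (simp add: algebra_simps)
  have "vector [dz 2 (\<lambda>x. complex_of_real (\<rho> x)) p, - dz 1 (\<lambda>x. complex_of_real (\<rho> x)) p]
     = of_real ?g *s tangent_u p"
    by (simp add: vec_eq_iff forall_2 dz tangent_u_def vector_2)
  then show "M_op \<rho> p = ?g ^ 3 * M_op u p"
    unfolding M_op_levi[OF \<rho> U(1)] using l
    by (simp add: levi_form_scale power2_eq_square power3_eq_cube)
qed

lemma M_op_u_nonzero:
  assumes p: "p \<in> Z" shows "M_op u p \<noteq> 0"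
proof -
  have p0: "p \<noteq> 0" using p zero_notin by auto
  obtain U \<rho> where U: "p \<in> U" "defining_function Z U \<rho>"
    and levi: "\<forall>t. t \<noteq> 0 \<and> (\<Sum>j\<in>UNIV. dz j (\<lambda>x. complex_of_real (\<rho> x)) p * (t $ j)) = 0
        \<longrightarrow> levi_form \<rho> p t > 0"
    using bspec[OF spc[unfolded strongly_pseudoconvex_def] p] by (elim exE conjE) (rule that)
  have "tangent_u p \<noteq> 0"
  proof
    assume "tangent_u p = 0"
    then have "dz 2 uc p = 0" "dz 1 uc p = 0"
      by (auto simp: vec_eq_iff forall_2 tangent_u_def vector_2)
    then show False using dz_u_self[OF p0] by simp
  qed
  then have "levi_form \<rho> p (tangent_u p) > 0"
    using levi M_op_defining_function(3)[OF U p] by blast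
  then show ?thesis using M_op_defining_function(2)[OF U p] by auto
qed

definition fefferman_density :: "complex^2 \<Rightarrow> real" where
  "fefferman_density p = 2 powr (4/3) * root 3 (M_op u p)"

lemma fefferman_form_exists: "fefferman_form Z (\<lambda>p v1 v2 v3. fefferman_density p * volume_form v1 v2 v3 p)"
  unfolding fefferman_form_def
proof (intro ballI conjI allI impI)
  fix p assume p: "p \<in> Z"
  show "alternating_3form (\<lambda>v1 v2 v3. fefferman_density p * volume_form v1 v2 v3 p)"
    unfolding alternating_3form_def
    using linear_compose_scale_right[OF linear_volume_form(1), of "fefferman_density p"]
      linear_compose_scale_right[OF linear_volume_form(2), of "fefferman_density p"]
      linear_compose_scale_right[OF linear_volume_form(3), of "fefferman_density p"]
    by (simp add: volume_form_alternating)
  fix U \<rho> v1 v2 v3 v4 assume "p \<in> U \<and> defining_function Z U \<rho>"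
  then have U: "p \<in> U" "defining_function Z U \<rho>" by auto
  have \<rho>: "smooth_on U \<rho>" using U by (auto simp: defining_function_def)
  have r: "root 3 (M_op \<rho> p) = Der \<rho> p p * root 3 (M_op u p)"
    by (simp add: M_op_defining_function(1)[OF U p] real_root_mult odd_real_root_power_cancel)
  have "wedge_3_1 (\<lambda>v1 v2 v3. fefferman_density p * volume_form v1 v2 v3 p) (Der \<rho> p) v1 v2 v3 v4 =
      fefferman_density p * (volume_form v1 v2 v3 p * Der \<rho> p v4 - volume_form v1 v2 v4 p * Der \<rho> p v3
       + volume_form v1 v3 v4 p * Der \<rho> p v2 - volume_form v2 v3 v4 p * Der \<rho> p v1)"
    by (simp only: wedge_3_1_def mult.assoc right_diff_distrib distrib_left)
  also have "\<dots> = fefferman_density p * (Der \<rho> p p * volume_form v1 v2 v3 v4)"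
    by (simp only: volume_form_cramer[OF smooth_on_linear_Der[OF \<rho> U(1)]])
  finally show "wedge_3_1 (\<lambda>v1 v2 v3. fefferman_density p * volume_form v1 v2 v3 p) (Der \<rho> p) v1 v2 v3 v4 =
      2 powr (4 / 3) * root 3 (M_op \<rho> p) * volume_form v1 v2 v3 v4"
    unfolding r by (simp add: fefferman_density_def)
qed

text \<open>The position vector is transversal with \<open>Der u p p = 1\<close>, so inserting it as fourth argument isolates the value of
  \<open>\<sigma>\<close> on three tangent vectors.\<close>

lemma fefferman_form_unique:
  assumes \<sigma>: "fefferman_form Z \<sigma>" and p: "p \<in> Z"
    and v: "Der u p v1 = 0" "Der u p v2 = 0" "Der u p v3 = 0"
  shows "\<sigma> p v1 v2 v3 = fefferman_density p * volume_form v1 v2 v3 p"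
proof -
  have p0: "p \<in> - {0}" using p zero_notin by auto
  have u1: "Der u p p = 1" using Der_u_self[of p 1] p0 by simp
  have "wedge_3_1 (\<sigma> p) (Der u p) v1 v2 v3 p = 2 powr (4 / 3) * root 3 (M_op u p) * volume_form v1 v2 v3 p"
    using bspec[OF \<sigma>[unfolded fefferman_form_def] p] defining_function_u p0 by metis
  then show ?thesis using v u1 by (simp add: wedge_3_1_def fefferman_density_def)
qed

end


section \<open>Transport of Lebesgue measure\<close>

lemma lborel_distr_Basis:
  fixes T :: "'a::euclidean_space \<Rightarrow> 'b::euclidean_space"
  assumes T: "linear T" "inj T" "T ` Basis \<subseteq> Basis" and dim: "DIM('a) = DIM('b)"
  shows "distr lborel borel T = lborel"
proof -
  have im: "T ` Basis = Basis"
    using T dim by (intro card_subset_eq) (auto simp: card_image inj_on_subset)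
  have cont: "continuous_on UNIV T"
    using T(1) linear_continuous_on linear_conv_bounded_linear by blast
  then have meas: "T \<in> borel_measurable borel" by (rule borel_measurable_continuous_onI)
  have inner: "T x \<bullet> T b = x \<bullet> b" if b: "b \<in> Basis" for x b
  proof -
    have "T x = (\<Sum>c\<in>Basis. (x \<bullet> c) *\<^sub>R T c)"
      using arg_cong[OF euclidean_representation[of x], of T] T(1) by (simp add: linear_sum linear_scale)
    also have "\<dots> \<bullet> T b = (\<Sum>c\<in>Basis. (x \<bullet> c) * (T c \<bullet> T b))" by (simp add: inner_sum_left)
    also have "\<dots> = (\<Sum>c\<in>Basis. if c = b then x \<bullet> b else 0)"
    proof (rule sum.cong[OF refl])
      fix c :: 'a assume c: "c \<in> Basis"
      have "T c \<in> Basis" "T b \<in> Basis" using T(3) b c by auto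
      then have "T c \<bullet> T b = (if c = b then 1 else 0)"
        using injD[OF T(2), of c b] by (auto simp: inner_Basis)
      then show "(x \<bullet> c) * (T c \<bullet> T b) = (if c = b then x \<bullet> b else 0)" by auto
    qed
    also have "\<dots> = x \<bullet> b" using b by simp
    finally show ?thesis .
  qed
  show ?thesis
  proof (rule lborel_eqI[symmetric])
    fix l r :: 'b assume lr: "\<And>b. b \<in> Basis \<Longrightarrow> l \<bullet> b \<le> r \<bullet> b"
    define l' where "l' = (\<Sum>b\<in>Basis. (l \<bullet> T b) *\<^sub>R b)"
    define r' where "r' = (\<Sum>b\<in>Basis. (r \<bullet> T b) *\<^sub>R b)"
    have l': "l' \<bullet> b = l \<bullet> T b" and r': "r' \<bullet> b = r \<bullet> T b" if "b \<in> Basis" for b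
      using that by (simp_all add: l'_def r'_def)
    have box: "T -` box l r = box l' r'"
    proof -
      have "T x \<in> box l r \<longleftrightarrow> (\<forall>b\<in>Basis. l \<bullet> T b < T x \<bullet> T b \<and> T x \<bullet> T b < r \<bullet> T b)" for x
        unfolding mem_box im[symmetric] by blast
      then show ?thesis by (auto simp: mem_box l' r' inner)
    qed
    have "emeasure (distr lborel borel T) (box l r) = emeasure lborel (box l' r')"
      using meas by (simp add: emeasure_distr box)
    also have "\<dots> = ennreal (\<Prod>b\<in>Basis. (r' - l') \<bullet> b)"
    proof (rule emeasure_lborel_box)
      fix b :: 'a assume "b \<in> Basis"
      then show "l' \<bullet> b \<le> r' \<bullet> b" using lr[of "T b"] T(3) by (auto simp: l' r')
    qed
    also have "(\<Prod>b\<in>Basis. (r' - l') \<bullet> b) = (\<Prod>b\<in>Basis. (r - l) \<bullet> T b)"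
      by (rule prod.cong) (auto simp: l' r' inner_diff_left)
    also have "\<dots> = (\<Prod>b\<in>Basis. (r - l) \<bullet> b)"
      using prod.reindex[of T Basis "\<lambda>b. (r - l) \<bullet> b"] T(2) by (simp add: im inj_on_subset)
    finally show "emeasure (distr lborel borel T) (box l r) = ennreal (\<Prod>b\<in>Basis. (r - l) \<bullet> b)" .
  qed simp
qed

lemma nn_integral_lborel_Basis:
  fixes T :: "'a::euclidean_space \<Rightarrow> 'b::euclidean_space"
  assumes T: "linear T" "inj T" "T ` Basis \<subseteq> Basis" "DIM('a) = DIM('b)"
    and f: "f \<in> borel_measurable borel"
  shows "(\<integral>\<^sup>+x. f (T x) \<partial>lborel) = (\<integral>\<^sup>+y. f y \<partial>lborel)"
proof -
  have "T \<in> borel_measurable borel"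
    using T(1) linear_continuous_on linear_conv_bounded_linear borel_measurable_continuous_onI by blast
  then have "(\<integral>\<^sup>+x. f (T x) \<partial>lborel) = (\<integral>\<^sup>+y. f y \<partial>distr lborel borel T)"
    using f by (simp add: nn_integral_distr)
  then show ?thesis by (simp add: lborel_distr_Basis[OF T(1-4)])
qed

lemma linear_real_coords: "linear real_coords"
  by (auto intro!: linearI simp: real_coords_def vec_eq_iff forall_4 vector_4)

lemma real_coords_eq_iff: "real_coords v = real_coords w \<longleftrightarrow> v = w"
  by (auto simp: real_coords_def vec_eq_iff forall_4 forall_2 vector_4 complex_eq_iff)

lemma Basis_vec_real: "(Basis :: (real^'n) set) = range (\<lambda>i. axis i 1)"
  by (auto simp: Basis_vec_def)

lemma Basis_complex2: "(Basis :: (complex^2) set) = {axis 1 1, axis 1 \<i>, axis 2 1, axis 2 \<i>}"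
  by (auto simp: Basis_vec_def Basis_complex_def UNIV_2)

lemma nn_integral_real_coords:
  assumes "f \<in> borel_measurable borel"
  shows "(\<integral>\<^sup>+x. f (real_coords x) \<partial>lborel) = (\<integral>\<^sup>+y. f y \<partial>lborel)"
proof (rule nn_integral_lborel_Basis[OF linear_real_coords _ _ _ assms])
  show "inj real_coords" by (simp add: inj_def real_coords_eq_iff)
  have "real_coords (axis 1 1) = axis 1 1" "real_coords (axis 1 \<i>) = axis 2 1"
    "real_coords (axis 2 1) = axis 3 1" "real_coords (axis 2 \<i>) = axis 4 1"
    by (auto simp: real_coords_def vec_eq_iff forall_4 vector_4 axis_def)
  then show "real_coords ` Basis \<subseteq> Basis"
    unfolding Basis_complex2 Basis_vec_real by auto
qed simp

definition first_three :: "real^4 \<Rightarrow> real^3" where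
  "first_three y = vector [y$1, y$2, y$3]"

lemma linear_first_three: "linear first_three"
  by (auto intro!: linearI simp: first_three_def vec_eq_iff forall_3 vector_3)

lemma nn_integral_first_three:
  fixes f :: "(real^3) \<times> real \<Rightarrow> ennreal"
  assumes "f \<in> borel_measurable borel"
  shows "(\<integral>\<^sup>+y. f (first_three y, y$4) \<partial>lborel) = (\<integral>\<^sup>+y. f y \<partial>lborel)"
proof (rule nn_integral_lborel_Basis[of "\<lambda>y. (first_three y, y$4)", OF _ _ _ _ assms])
  show "linear (\<lambda>y. (first_three y, y $ 4))"
    using linear_first_three by (auto intro!: linearI simp: linear_add linear_scale)
  show "inj (\<lambda>y. (first_three y, y $ 4))"
    by (auto simp: inj_def first_three_def vec_eq_iff forall_4 forall_3 vector_3)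
  have "first_three (axis 1 1) = axis 1 1" "first_three (axis 2 1) = axis 2 1"
     "first_three (axis 3 1) = axis 3 1" "first_three (axis 4 1) = 0"
    by (auto simp: first_three_def vec_eq_iff forall_3 vector_3 axis_def)
  moreover have "Basis = {axis 1 1, axis 2 1, axis 3 1, axis (4::4) (1::real)}"
    by (auto simp: Basis_vec_real UNIV_4)
  ultimately show "(\<lambda>y. (first_three y, y $ 4)) ` Basis \<subseteq> Basis"
    by (auto simp: Basis_prod_def axis_nth Basis_vec_real axis_def)
qed simp

lemma nn_integral_complex2:
  fixes f :: "complex \<times> complex \<Rightarrow> ennreal"
  assumes "f \<in> borel_measurable borel"
  shows "(\<integral>\<^sup>+(v::complex^2). f (v$1, v$2) \<partial>lborel) = (\<integral>\<^sup>+y. f y \<partial>lborel)"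
proof (rule nn_integral_lborel_Basis[of "\<lambda>v::complex^2. (v$1, v$2)", OF _ _ _ _ assms])
  show "linear (\<lambda>v::complex^2. (v$1, v$2))" by (auto intro!: linearI)
  show "inj (\<lambda>v::complex^2. (v$1, v$2))" by (auto simp: inj_def vec_eq_iff forall_2)
  show "(\<lambda>v::complex^2. (v$1, v$2)) ` Basis \<subseteq> Basis"
    by (auto simp: Basis_prod_def Basis_complex2 Basis_complex_def axis_def)
qed simp

lemma nn_integral_complex_real2:
  fixes f :: "real \<times> real \<Rightarrow> ennreal"
  assumes "f \<in> borel_measurable borel"
  shows "(\<integral>\<^sup>+z. f (Re z, Im z) \<partial>lborel) = (\<integral>\<^sup>+y. f y \<partial>lborel)"
proof (rule nn_integral_lborel_Basis[of "\<lambda>z. (Re z, Im z)", OF _ _ _ _ assms])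
  show "linear (\<lambda>z. (Re z, Im z))" by (auto intro!: linearI)
  show "inj (\<lambda>z. (Re z, Im z))" by (auto simp: inj_def complex_eq_iff)
  show "(\<lambda>z. (Re z, Im z)) ` Basis \<subseteq> Basis"
    by (auto simp: Basis_prod_def Basis_complex_def)
qed simp

text \<open>The change of variables theorem transfers integrability in both directions, so for non-negative functions the
  identity extends to infinite integrals.\<close>

lemma nn_integral_change_of_variables:
  fixes g :: "real^'n::{finite,wellorder} \<Rightarrow> real^'n::_" and f :: "real^'n::_ \<Rightarrow> real"
  assumes S: "S \<in> sets borel" and gS: "g ` S \<in> sets borel"
    and der: "\<And>x. x \<in> S \<Longrightarrow> (g has_derivative g' x) (at x within S)" and inj: "inj_on g S"
    and f: "f \<in> borel_measurable borel" "\<And>y. f y \<ge> 0"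
    and meas: "(\<lambda>x. indicator S x * (\<bar>det (matrix (g' x))\<bar> * f (g x))) \<in> borel_measurable borel"
  shows "(\<integral>\<^sup>+x. ennreal (\<bar>det (matrix (g' x))\<bar> * f (g x)) * indicator S x \<partial>lborel)
     = (\<integral>\<^sup>+y. ennreal (f y) * indicator (g ` S) y \<partial>lborel)"
proof -
  let ?h = "\<lambda>x. \<bar>det (matrix (g' x))\<bar> * f (g x)"
  have iff: "(?h has_integral I) S \<longleftrightarrow> (f has_integral I) (g ` S)" for I
  proof -
    have "?h absolutely_integrable_on S \<and> integral S ?h = I
        \<longleftrightarrow> f absolutely_integrable_on (g ` S) \<and> integral (g ` S) f = I"
      using has_absolute_integral_change_of_variables[OF _ der inj, of "\<lambda>y. vec (f y) :: real^1" "vec I"] S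
      unfolding absolutely_integrable_on_1_iff integral_on_1_eq by simp
    then show ?thesis
      using f(2) by (simp add: absolutely_integrable_on_iff_nonneg has_integral_iff)
  qed
  have fin: "\<exists>I. (k has_integral I) T"
    if T: "T \<in> sets borel" and k: "(\<lambda>x. indicator T x * k x) \<in> borel_measurable borel" "\<And>x. k x \<ge> 0"
      and lt: "(\<integral>\<^sup>+x. ennreal (k x) * indicator T x \<partial>lborel) < \<infinity>" for k :: "real^'n::_ \<Rightarrow> real" and T
  proof -
    obtain I where I: "(\<integral>\<^sup>+x. ennreal (k x) * indicator T x \<partial>lborel) = ennreal I" "I \<ge> 0"
      using lt by (metis ennreal_cases infinity_ennreal_def less_irrefl)
    have "(\<integral>\<^sup>+x. ennreal (indicator T x * k x) \<partial>lborel) = (\<integral>\<^sup>+x. ennreal (k x) * indicator T x \<partial>lborel)"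
      by (rule nn_integral_cong) (simp add: indicator_def)
    then have "((\<lambda>x. indicator T x * k x) has_integral I) UNIV"
      using I k by (intro nn_integral_has_integral) auto
    then have "((\<lambda>x. if x \<in> T then k x else 0) has_integral I) UNIV"
      by (rule has_integral_eq[rotated]) (simp add: indicator_def)
    then have "(k has_integral I) T" by (simp add: has_integral_restrict_UNIV)
    then show ?thesis by blast
  qed
  consider I where "(?h has_integral I) S" "(f has_integral I) (g ` S)"
    | "\<nexists>I. (?h has_integral I) S" "\<nexists>I. (f has_integral I) (g ` S)" using iff by blast
  then show ?thesis
  proof cases
    case 1
    then show ?thesis
      using nn_integral_has_integral_lebesgue'[OF _ 1(1)] nn_integral_has_integral_lebesgue'[OF _ 1(2)] f(2)
      by simp
  next
    case 2
    have "(\<integral>\<^sup>+x. ennreal (?h x) * indicator S x \<partial>lborel) = \<infinity>"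
      using fin[OF S meas] f(2) 2(1) by (metis (no_types, lifting) abs_ge_zero infinity_ennreal_def less_top mult_nonneg_nonneg)
    moreover have "(\<lambda>x. indicator (g ` S) x * f x) \<in> borel_measurable borel"
      using f(1) gS by measurable
    then have "(\<integral>\<^sup>+y. ennreal (f y) * indicator (g ` S) y \<partial>lborel) = \<infinity>"
      using fin[OF gS, of f] f(2) 2(2) by (metis (no_types, lifting) infinity_ennreal_def less_top)
    ultimately show ?thesis by simp
  qed
qed

lemma nn_integral_cube_unit: "(\<integral>\<^sup>+t. ennreal (t ^ 3) * indicator {0<..<1} t \<partial>lborel) = ennreal (1 / 4)"
proof -
  have "((\<lambda>t::real. t ^ 3) has_integral (1 ^ 4 / 4 - 0 ^ 4 / 4)) {0..1}"
    by (rule fundamental_theorem_of_calculus)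
      (auto intro!: derivative_eq_intros simp: has_real_derivative_iff_has_vector_derivative[symmetric])
  then have "((\<lambda>t::real. t ^ 3) has_integral 1 / 4) {0<..<1}"
    by (simp add: has_integral_Icc_iff_Ioo)
  from nn_integral_has_integral_lebesgue'[OF _ this] show ?thesis by simp
qed


section \<open>Fefferman's measure as an integral over the enclosed domain\<close>

definition real_coords_inv :: "real^4 \<Rightarrow> complex^2" where
  "real_coords_inv y = vector [Complex (y$1) (y$2), Complex (y$3) (y$4)]"

lemma real_coords_inv [simp]: "real_coords_inv (real_coords v) = v" "real_coords (real_coords_inv y) = y"
  by (simp_all add: real_coords_def real_coords_inv_def vec_eq_iff forall_2 forall_4 vector_4 vector_2)

lemma linear_real_coords_inv: "linear real_coords_inv"
  by (auto intro!: linearI simp: real_coords_inv_def vec_eq_iff forall_2 vector_2 complex_eq_iff)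

lemma linear_borel_measurable:
  fixes f :: "'a::euclidean_space \<Rightarrow> 'b::euclidean_space"
  shows "linear f \<Longrightarrow> f \<in> borel_measurable borel"
  using linear_continuous_on linear_conv_bounded_linear borel_measurable_continuous_onI by blast

lemma det_cone_derivative:
  fixes D :: "real^3 \<Rightarrow> complex^2"
  assumes D: "linear D"
  shows "det (matrix (\<lambda>w::real^4. real_coords (r *\<^sub>R D (first_three w) + w$4 *\<^sub>R p)))
     = r ^ 3 * volume_form (D (axis 1 1)) (D (axis 2 1)) (D (axis 3 1)) p"
proof -
  have ft: "first_three (axis 1 1) = axis 1 1" "first_three (axis 2 1) = axis 2 1"
     "first_three (axis 3 1) = axis 3 1" "first_three (axis 4 1) = 0"
    by (auto simp: first_three_def vec_eq_iff forall_3 vector_3 axis_def)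
  have ax: "axis 1 (1::real) $ (4::4) = 0" "axis 2 (1::real) $ (4::4) = 0"
    "axis 3 (1::real) $ (4::4) = 0" "axis 4 (1::real) $ (4::4) = 1" by (simp_all add: axis_def)
  let ?f = "\<lambda>w::real^4. real_coords (r *\<^sub>R D (first_three w) + w$4 *\<^sub>R p)"
  have "transpose (matrix ?f) = vector [real_coords (r *\<^sub>R D (axis 1 1)), real_coords (r *\<^sub>R D (axis 2 1)),
      real_coords (r *\<^sub>R D (axis 3 1)), real_coords p]"
    (is "?M = ?R")
  proof -
    have row: "?M $ j = ?f (axis j 1)" for j
      unfolding transpose_def matrix_def by (simp only: vec_lambda_beta vec_lambda_eta)
    have "?M $ 1 = ?R $ 1" "?M $ 2 = ?R $ 2" "?M $ 3 = ?R $ 3" "?M $ 4 = ?R $ 4"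
      unfolding row ft ax vector_4 linear_0[OF D] by simp_all
    then show ?thesis unfolding vec_eq_iff[of ?M ?R] forall_4 by blast
  qed
  then have "det (matrix ?f) = volume_form (r *\<^sub>R D (axis 1 1)) (r *\<^sub>R D (axis 2 1)) (r *\<^sub>R D (axis 3 1)) p"
    unfolding volume_form_def by (simp only: det_transpose[symmetric, of "matrix ?f"])
  also have "\<dots> = r ^ 3 * volume_form (D (axis 1 1)) (D (axis 2 1)) (D (axis 3 1)) p"
    by (simp add: linear_scale[OF linear_volume_form(1)] linear_scale[OF linear_volume_form(2)]
        linear_scale[OF linear_volume_form(3)] power3_eq_cube)
  finally show ?thesis .
qed

lemma borel_measurable_punctured:
  fixes f :: "complex^2 \<Rightarrow> 'b::{second_countable_topology, real_normed_vector}"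
  assumes "continuous_on (- {0}) f" "f 0 = 0"
  shows "f \<in> borel_measurable borel"
proof -
  have "(\<lambda>x. indicator (- {0}) x *\<^sub>R f x) \<in> borel_measurable borel"
    by (rule borel_measurable_continuous_on_indicator[OF _ assms(1)]) simp
  also have "(\<lambda>x. indicator (- {0}) x *\<^sub>R f x) = f" using assms(2) by (auto simp: indicator_def fun_eq_iff)
  finally show ?thesis .
qed

context circular_surface
begin

lemma continuous_dz_u:
  "continuous_on (- {0}) (dz j uc)" "continuous_on (- {0}) (dzbar j uc)"
  "continuous_on (- {0}) (dzbar k (dz j uc))"
proof -
  have D: "continuous_on (- {0}) (\<lambda>p. Der u p v)" and H: "continuous_on (- {0}) (\<lambda>p. hess u p v w)" for v w
    using smooth_on_continuous[OF smooth_on_Der[OF u_smooth]] smooth_on_continuous[OF smooth_on_hess[OF u_smooth]] .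
  have c1: "continuous_on (- {0}) (\<lambda>p. Complex (Der u p (axis j 1) / 2) (- Der u p (axis j \<i>) / 2))"
    and c2: "continuous_on (- {0}) (\<lambda>p. Complex (Der u p (axis j 1) / 2) (Der u p (axis j \<i>) / 2))"
    and c3: "continuous_on (- {0}) (\<lambda>p. Complex ((hess u p (axis j 1) (axis k 1) + hess u p (axis j \<i>) (axis k \<i>)) / 4)
            ((hess u p (axis j 1) (axis k \<i>) - hess u p (axis j \<i>) (axis k 1)) / 4))"
    by (intro continuous_intros D H; simp)+
  show "continuous_on (- {0}) (dz j uc)"
    by (rule continuous_on_eq[OF c1]) (rule dz_real(1)[OF u_smooth, symmetric])
  show "continuous_on (- {0}) (dzbar j uc)"
    by (rule continuous_on_eq[OF c2]) (rule dz_real(2)[OF u_smooth, symmetric])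
  show "continuous_on (- {0}) (dzbar k (dz j uc))"
    by (rule continuous_on_eq[OF c3]) (rule dzbar_dz_real[OF u_smooth, symmetric])
qed

lemma continuous_M_op_u: "continuous_on (- {0}) (M_op u)"
  unfolding M_op_def[abs_def] Let_def det_3 vector_3
  by (intro continuous_intros continuous_dz_u)

lemma continuous_fefferman_density: "continuous_on (- {0}) fefferman_density"
  unfolding fefferman_density_def[abs_def] by (intro continuous_intros continuous_M_op_u)

definition proj :: "complex^2 \<Rightarrow> complex^2" where "proj p = inverse (N p) *\<^sub>R p"

text \<open>The absolute density of Fefferman's form, extended to be constant along rays.\<close>

definition radial_density :: "complex^2 \<Rightarrow> real" where
  "radial_density p = (if p = 0 then 0 else \<bar>fefferman_density (proj p)\<bar>)"

lemma radial_density_nonneg: "radial_density p \<ge> 0"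
  by (simp add: radial_density_def)

lemma continuous_N: "continuous_on (- {0}) N"
  by (rule smooth_on_continuous[OF gauge_smooth])

lemma continuous_proj: "continuous_on (- {0}) proj"
  unfolding proj_def[abs_def] using gauge_pos by (intro continuous_intros continuous_N) force

lemma proj_scale: "r > 0 \<Longrightarrow> proj (r *\<^sub>R p) = proj p"
  by (cases "p = 0") (simp_all add: proj_def gauge_scaleR)

lemma proj_in_Z: "p \<noteq> 0 \<Longrightarrow> proj p \<in> Z"
  using radial_projection by (simp add: proj_def)

lemma proj_Z: "p \<in> Z \<Longrightarrow> proj p = p"
  by (simp add: proj_def mem_iff)

lemma radial_density_scale: "r > 0 \<Longrightarrow> radial_density (r *\<^sub>R p) = radial_density p"
  by (auto simp: radial_density_def proj_scale)

lemma continuous_radial_density: "continuous_on (- {0}) radial_density"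
proof -
  have "continuous_on (- {0}) (\<lambda>p. \<bar>fefferman_density (proj p)\<bar>)"
    by (intro continuous_on_rabs continuous_on_compose2[OF continuous_fefferman_density continuous_proj])
      (use proj_in_Z zero_notin in force)
  then show ?thesis by (rule continuous_on_eq) (simp add: radial_density_def)
qed

lemma measurable_N [measurable]: "N \<in> borel_measurable borel"
  by (rule borel_measurable_punctured[OF continuous_N]) simp

lemma measurable_proj [measurable]: "proj \<in> borel_measurable borel"
  by (rule borel_measurable_punctured[OF continuous_proj]) (simp add: proj_def)

lemma measurable_radial_density [measurable]: "radial_density \<in> borel_measurable borel"
  by (rule borel_measurable_punctured[OF continuous_radial_density]) (simp add: radial_density_def)

lemma Z_borel: "Z \<in> sets borel"
proof -
  have "Z = N -` {1} \<inter> space borel" by (auto simp: mem_iff)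
  then show ?thesis using measurable_sets[OF measurable_N, of "{1}"] by simp
qed

definition cone :: "(complex^2) set \<Rightarrow> (complex^2) set" where
  "cone B = {p. p \<noteq> 0 \<and> N p < 1 \<and> proj p \<in> B}"

lemma cone_borel:
  assumes "B \<in> sets borel" shows "cone B \<in> sets borel"
proof -
  have "cone B = - {0} \<inter> N -` {..<1} \<inter> proj -` B" by (auto simp: cone_def)
  moreover have "N -` {..<1} \<in> sets borel" "proj -` B \<in> sets borel"
    using measurable_sets[OF measurable_N, of "{..<1}"] measurable_sets[OF measurable_proj assms] by simp_all
  ultimately show ?thesis by auto
qed

lemma local_param_image_borel:
  assumes \<phi>: "local_param Z U \<phi>" and A: "A \<in> sets borel" "A \<subseteq> U"
  shows "\<phi> ` A \<in> sets borel"
proof -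
  obtain \<psi> where hom: "homeomorphism U (\<phi> ` U) \<phi> \<psi>" using \<phi> by (auto simp: local_param_def)
  obtain T where "open T" "\<phi> ` U = Z \<inter> T"
    using \<phi> unfolding local_param_def openin_open by auto
  then have B: "\<phi> ` U \<in> sets borel" using Z_borel by auto
  have "\<psi> \<in> borel_measurable (restrict_space borel (\<phi> ` U))"
    using hom by (intro borel_measurable_continuous_on_restrict) (simp add: homeomorphism_def)
  from measurable_sets[OF this A(1)] have "\<psi> -` A \<inter> \<phi> ` U \<in> sets borel"
    using B by (simp add: sets_restrict_space_iff space_restrict_space)
  also have "\<psi> -` A \<inter> \<phi> ` U = \<phi> ` A"
    using hom A(2) unfolding homeomorphism_def by (auto 0 3)
  finally show ?thesis .
qed

lemma local_param_tangent:
  assumes \<phi>: "local_param Z U \<phi>" and x: "x \<in> U"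
  shows "Der u (\<phi> x) (Der \<phi> x v) = 0"
proof -
  have sm: "smooth_on U \<phi>" and sub: "\<phi> ` U \<subseteq> Z"
    using \<phi> unfolding local_param_def by (auto dest: openin_imp_subset)
  then have "\<phi> x \<in> - {0}" using x zero_notin by auto
  from has_derivative_compose[OF smooth_on_has_derivative[OF sm x] smooth_on_has_derivative[OF u_smooth this]]
  have "((\<lambda>x. u (\<phi> x)) has_derivative (\<lambda>v. Der u (\<phi> x) (Der \<phi> x v))) (at x)" .
  then have "((\<lambda>x. 0) has_derivative (\<lambda>v. Der u (\<phi> x) (Der \<phi> x v))) (at x)"
  proof (rule has_derivative_transform_within_open[OF _ smooth_on_open[OF sm] x])
    fix y assume "y \<in> U"
    then have "\<phi> y \<in> Z" using sub by auto
    then show "u (\<phi> y) = 0" using u_zero_iff zero_notin by metis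
  qed
  from has_derivative_unique[OF this has_derivative_const] show ?thesis by (rule fun_cong)
qed

text \<open>Polar coordinates \<open>(x, t) \<mapsto> t \<phi>(x)\<close> have Jacobian \<open>t\<^sup>3 vol(\<partial>\<phi>, \<phi>)\<close>, so the integral over a
  piece of the surface is four times an integral over the cone below it. The latter no longer
  depends on the parametrization.\<close>

lemma cone_integral:
  assumes \<phi>: "local_param Z U \<phi>" and A: "A \<in> sets borel" "A \<subseteq> U"
  shows "(\<integral>\<^sup>+x. ennreal (\<bar>volume_form (Der \<phi> x (axis 1 1)) (Der \<phi> x (axis 2 1)) (Der \<phi> x (axis 3 1)) (\<phi> x)\<bar>
            * radial_density (\<phi> x)) * indicator A x \<partial>lborel)
    = 4 * (\<integral>\<^sup>+p. ennreal (radial_density p) * indicator (cone (\<phi> ` A)) p \<partial>lborel)"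
proof -
  have sm: "smooth_on U \<phi>" and sub: "\<phi> ` U \<subseteq> Z"
    using \<phi> unfolding local_param_def by (auto dest: openin_imp_subset)
  obtain \<psi> where hom: "homeomorphism U (\<phi> ` U) \<phi> \<psi>" using \<phi> by (auto simp: local_param_def)
  have injA: "inj_on \<phi> A"
    using hom A(2) unfolding homeomorphism_def by (metis inj_on_def subset_iff)
  have N1: "N (\<phi> x) = 1" if "x \<in> A" for x using that A(2) sub mem_iff by blast
  define vol where "vol x = volume_form (Der \<phi> x (axis 1 1)) (Der \<phi> x (axis 2 1)) (Der \<phi> x (axis 3 1)) (\<phi> x)" for x
  define g where "g y = real_coords (y$4 *\<^sub>R \<phi> (first_three y))" for y
  define g' where "g' y w = real_coords (y$4 *\<^sub>R Der \<phi> (first_three y) (first_three w) + w$4 *\<^sub>R \<phi> (first_three y))" for y w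
  define S where "S = {y. first_three y \<in> A \<and> y$4 \<in> {0<..<1}}"
  define f where "f y = radial_density (real_coords_inv y)" for y
  have [measurable]: "first_three \<in> borel_measurable borel" "real_coords_inv \<in> borel_measurable borel"
    by (auto intro: linear_borel_measurable linear_first_three linear_real_coords_inv)
  have [measurable]: "(\<lambda>y::real^4. y$4) \<in> borel_measurable borel"
    by (intro borel_measurable_continuous_onI continuous_intros)
  have [measurable]: "A \<in> sets borel" by fact
  have S: "S \<in> sets borel"
  proof -
    have "S = first_three -` A \<inter> (\<lambda>y. y$4) -` {0<..<1}" by (auto simp: S_def)
    moreover have "first_three -` A \<in> sets borel" "(\<lambda>y::real^4. y$4) -` {0<..<1} \<in> sets borel"
      using measurable_sets[of first_three borel borel A] measurable_sets[of "\<lambda>y::real^4. y$4" borel borel "{0<..<1}"]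
      by simp_all
    ultimately show ?thesis by auto
  qed
  have der: "(g has_derivative g' y) (at y within S)" if y: "y \<in> S" for y
  proof -
    have U: "first_three y \<in> U" using y A by (auto simp: S_def)
    have 1: "((\<lambda>y. \<phi> (first_three y)) has_derivative (\<lambda>w. Der \<phi> (first_three y) (first_three w))) (at y within S)"
    proof -
      have "(first_three has_derivative first_three) (at y within S)"
        by (rule bounded_linear_imp_has_derivative) (use linear_first_three linear_conv_bounded_linear in blast)
      from has_derivative_compose[OF this smooth_on_has_derivative[OF sm U]] show ?thesis .
    qed
    have 2: "((\<lambda>y::real^4. y$4) has_derivative (\<lambda>w. w$4)) (at y within S)"
      by (rule bounded_linear_imp_has_derivative) (rule bounded_linear_vec_nth)
    have "bounded_linear real_coords" using linear_real_coords linear_conv_bounded_linear by blast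
    from bounded_linear.has_derivative[OF this has_derivative_scaleR[OF 2 1]]
    show ?thesis by (simp add: g_def[abs_def] g'_def[abs_def])
  qed
  have det: "det (matrix (g' y)) = (y$4) ^ 3 * vol (first_three y)" if "y \<in> S" for y
    unfolding g'_def[abs_def] vol_def
    by (rule det_cone_derivative) (rule smooth_on_linear_Der[OF sm], use that A in \<open>auto simp: S_def\<close>)
  have fg: "f (g y) = radial_density (\<phi> (first_three y))" if "y \<in> S" for y
    using that by (simp add: f_def g_def S_def radial_density_scale)
  have inj: "inj_on g S"
  proof (rule inj_onI)
    fix y z assume y: "y \<in> S" and z: "z \<in> S" and eq: "g y = g z"
    have e: "y$4 *\<^sub>R \<phi> (first_three y) = z$4 *\<^sub>R \<phi> (first_three z)"
      using eq by (simp add: g_def real_coords_eq_iff)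
    have pos: "y$4 > 0" "z$4 > 0" and Ay: "first_three y \<in> A" "first_three z \<in> A" using y z by (auto simp: S_def)
    have "y$4 = z$4" using arg_cong[OF e, of N] pos Ay by (simp add: gauge_scaleR N1)
    moreover from this e pos have "\<phi> (first_three y) = \<phi> (first_three z)" by simp
    then have "first_three y = first_three z" using injA Ay by (simp add: inj_on_def)
    ultimately show "y = z"
      by (simp add: first_three_def vec_eq_iff forall_3 forall_4 vector_3)
  qed
  have first_three_surj: "\<exists>y. first_three y = x \<and> y$4 = t" for x t
    by (rule exI[of _ "vector [x$1, x$2, x$3, t]"]) (simp add: first_three_def vec_eq_iff forall_3 vector_3 vector_4)
  have gS: "g ` S = {y. real_coords_inv y \<in> cone (\<phi> ` A)}"
  proof (intro equalityI subsetI)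
    fix q assume "q \<in> g ` S"
    then obtain y where y: "y \<in> S" "q = g y" by auto
    then have pos: "0 < y$4" "y$4 < 1" and Ay: "first_three y \<in> A" by (auto simp: S_def)
    have "\<phi> (first_three y) \<in> Z" using Ay A sub by auto
    then have "y$4 *\<^sub>R \<phi> (first_three y) \<in> cone (\<phi> ` A)"
      using pos Ay N1 zero_notin by (auto simp: cone_def gauge_scaleR proj_scale proj_Z)
    then show "q \<in> {y. real_coords_inv y \<in> cone (\<phi> ` A)}" by (simp add: y g_def)
  next
    fix q assume "q \<in> {y. real_coords_inv y \<in> cone (\<phi> ` A)}"
    define p where "p = real_coords_inv q"
    then have p: "p \<noteq> 0" "N p < 1" "proj p \<in> \<phi> ` A"
      using \<open>q \<in> _\<close> by (auto simp: cone_def)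
    then obtain x where x: "x \<in> A" "proj p = \<phi> x" by auto
    obtain y where y: "first_three y = x" "y$4 = N p" using first_three_surj by blast
    have "y \<in> S" using x y p gauge_pos by (simp add: S_def)
    moreover have "N p *\<^sub>R \<phi> x = p" unfolding x(2)[symmetric] using p(1) gauge_pos[of p] by (simp add: proj_def)
    then have "g y = q" by (simp add: g_def y p_def)
    ultimately show "q \<in> g ` S" by auto
  qed
  have B: "cone (\<phi> ` A) \<in> sets borel" by (rule cone_borel[OF local_param_image_borel[OF \<phi> A]])
  then have gS_borel: "g ` S \<in> sets borel"
    using measurable_sets[of real_coords_inv borel borel "cone (\<phi> ` A)"] by (simp add: gS vimage_def)
  define H where "H x = indicator A x * (\<bar>vol x\<bar> * radial_density (\<phi> x))" for x
  have Hm [measurable]: "H \<in> borel_measurable borel"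
  proof -
    have cA: "continuous_on A \<phi>" "continuous_on A (\<lambda>x. Der \<phi> x b)" for b
      using smooth_on_continuous[OF sm] smooth_on_continuous[OF smooth_on_Der[OF sm]] A(2) continuous_on_subset by blast+
    have m1 [measurable]: "(\<lambda>x. indicator A x *\<^sub>R \<phi> x) \<in> borel_measurable borel"
      by (rule borel_measurable_continuous_on_indicator[OF A(1) cA(1)])
    have m2: "(\<lambda>x. indicator A x *\<^sub>R vol x) \<in> borel_measurable borel"
    proof (rule borel_measurable_continuous_on_indicator[OF A(1)])
      show "continuous_on A vol"
        unfolding vol_def volume_form_simps by (intro continuous_intros cA)
    qed
    have "(\<lambda>x. \<bar>indicator A x *\<^sub>R vol x\<bar> * radial_density (indicator A x *\<^sub>R \<phi> x)) \<in> borel_measurable borel"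
      using m2 by measurable
    also have "(\<lambda>x. \<bar>indicator A x *\<^sub>R vol x\<bar> * radial_density (indicator A x *\<^sub>R \<phi> x)) = H"
      by (auto simp: H_def indicator_def fun_eq_iff)
    finally show ?thesis .
  qed
  have split: "indicator S y * (\<bar>det (matrix (g' y))\<bar> * f (g y)) = H (first_three y) * ((y$4) ^ 3 * indicator {0<..<1} (y$4))" for y
    by (cases "y \<in> S") (auto simp: det fg H_def S_def abs_mult indicator_def)
  have "(\<integral>\<^sup>+x. ennreal (\<bar>det (matrix (g' x))\<bar> * f (g x)) * indicator S x \<partial>lborel)
     = (\<integral>\<^sup>+y. ennreal (f y) * indicator (g ` S) y \<partial>lborel)"
  proof (rule nn_integral_change_of_variables[OF S gS_borel der inj])
    show "f \<in> borel_measurable borel" unfolding f_def by measurable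
    show "f y \<ge> 0" for y by (simp add: f_def radial_density_nonneg)
    show "(\<lambda>x. indicator S x * (\<bar>det (matrix (g' x))\<bar> * f (g x))) \<in> borel_measurable borel"
      unfolding split by measurable
  qed
  also have "\<dots> = (\<integral>\<^sup>+y. (\<lambda>p. ennreal (radial_density p) * indicator (cone (\<phi> ` A)) p) (real_coords_inv y) \<partial>lborel)"
    by (rule nn_integral_cong) (simp add: f_def gS indicator_def)
  also have "\<dots> = (\<integral>\<^sup>+p. ennreal (radial_density p) * indicator (cone (\<phi> ` A)) p \<partial>lborel)"
    using nn_integral_real_coords[of "\<lambda>y. ennreal (radial_density (real_coords_inv y)) * indicator (cone (\<phi> ` A)) (real_coords_inv y)"] B
    by simp
  finally have 1: "(\<integral>\<^sup>+x. ennreal (\<bar>det (matrix (g' x))\<bar> * f (g x)) * indicator S x \<partial>lborel)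
    = (\<integral>\<^sup>+p. ennreal (radial_density p) * indicator (cone (\<phi> ` A)) p \<partial>lborel)" .
  have "(\<integral>\<^sup>+x. ennreal (\<bar>det (matrix (g' x))\<bar> * f (g x)) * indicator S x \<partial>lborel)
      = (\<integral>\<^sup>+y. (\<lambda>z. ennreal (H (fst z)) * (ennreal (snd z ^ 3) * indicator {0<..<1} (snd z))) (first_three y, y$4) \<partial>lborel)"
  proof (rule nn_integral_cong)
    fix y :: "real^4"
    have "ennreal (\<bar>det (matrix (g' y))\<bar> * f (g y)) * indicator S y
        = ennreal (indicator S y * (\<bar>det (matrix (g' y))\<bar> * f (g y)))"
      by (simp add: indicator_def)
    also have "\<dots> = ennreal (H (first_three y)) * (ennreal (y$4 ^ 3) * indicator {0<..<1} (y$4))"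
      unfolding split by (auto simp: indicator_def H_def radial_density_nonneg ennreal_mult')
    finally show "ennreal (\<bar>det (matrix (g' y))\<bar> * f (g y)) * indicator S y =
       (\<lambda>z. ennreal (H (fst z)) * (ennreal (snd z ^ 3) * indicator {0<..<1} (snd z))) (first_three y, y$4)" by simp
  qed
  also have "\<dots> = (\<integral>\<^sup>+z. ennreal (H (fst z)) * (ennreal (snd z ^ 3) * indicator {0<..<1} (snd z)) \<partial>lborel)"
    by (rule nn_integral_first_three) (unfold borel_prod[symmetric], measurable)
  also have "\<dots> = (\<integral>\<^sup>+z. ennreal (H (fst z)) * (ennreal (snd z ^ 3) * indicator {0<..<1} (snd z)) \<partial>(lborel \<Otimes>\<^sub>M lborel))"
    by (simp add: lborel_prod)
  also have "\<dots> = (\<integral>\<^sup>+x. (\<integral>\<^sup>+t. ennreal (H x) * (ennreal (t ^ 3) * indicator {0<..<1} t) \<partial>lborel) \<partial>lborel)"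
    by (subst lborel.nn_integral_fst[symmetric]) (simp_all, measurable)
  also have "\<dots> = (\<integral>\<^sup>+x. ennreal (H x) * ennreal (1/4) \<partial>lborel)"
    by (simp add: nn_integral_cmult nn_integral_cube_unit)
  also have "\<dots> = (\<integral>\<^sup>+x. ennreal (H x) \<partial>lborel) * ennreal (1/4)"
    by (simp add: nn_integral_multc)
  finally have 2: "(\<integral>\<^sup>+x. ennreal (H x) \<partial>lborel) * ennreal (1/4)
     = (\<integral>\<^sup>+p. ennreal (radial_density p) * indicator (cone (\<phi> ` A)) p \<partial>lborel)"
    using 1 by simp
  have "(\<integral>\<^sup>+x. ennreal (H x) \<partial>lborel) = 4 * ((\<integral>\<^sup>+x. ennreal (H x) \<partial>lborel) * ennreal (1/4))"
  proof -
    have "4 * ennreal (1/4) = ennreal (4 * (1/4))"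
      by (subst ennreal_mult') simp_all
    then have q: "4 * ennreal (1/4) = 1" by simp
    have "4 * ((\<integral>\<^sup>+x. ennreal (H x) \<partial>lborel) * ennreal (1/4)) = (\<integral>\<^sup>+x. ennreal (H x) \<partial>lborel) * (4 * ennreal (1/4))"
      by (simp only: mult_ac)
    then show ?thesis unfolding q by simp
  qed
  then have "(\<integral>\<^sup>+x. ennreal (H x) \<partial>lborel) = 4 * (\<integral>\<^sup>+p. ennreal (radial_density p) * indicator (cone (\<phi> ` A)) p \<partial>lborel)"
    by (simp only: 2)
  moreover have "(\<integral>\<^sup>+x. ennreal (\<bar>vol x\<bar> * radial_density (\<phi> x)) * indicator A x \<partial>lborel) = (\<integral>\<^sup>+x. ennreal (H x) \<partial>lborel)"
    by (rule nn_integral_cong) (simp add: H_def indicator_def)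
  ultimately show ?thesis by (simp add: vol_def)
qed

end


text \<open>Inverse stereographic projection from the two poles \<open>(0, \<plusminus>\<i>)\<close>, without the normalising
  denominator: radial projection to the surface removes positive factors anyway.\<close>

definition stereo :: "real \<Rightarrow> real^3 \<Rightarrow> complex^2" where
  "stereo s x = vector [Complex (2 * x$1) (2 * x$2), Complex (2 * x$3) (s * ((norm x)\<^sup>2 - 1))]"

definition stereo_inv :: "real \<Rightarrow> complex^2 \<Rightarrow> real^3" where
  "stereo_inv s p = inverse (norm p - s * Im (p$2)) *\<^sub>R vector [Re (p$1), Im (p$1), Re (p$2)]"

lemma norm_complex2: "(norm p)\<^sup>2 = (Re (p$1))\<^sup>2 + (Im (p$1))\<^sup>2 + (Re (p$2))\<^sup>2 + (Im (p$2))\<^sup>2" for p :: "complex^2"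
  by (simp add: norm_vec_def L2_set_def sum_2 cmod_power2)

lemma norm_real3: "(norm x)\<^sup>2 = (x$1)\<^sup>2 + (x$2)\<^sup>2 + (x$3)\<^sup>2" for x :: "real^3"
  by (simp add: norm_vec_def L2_set_def sum_3)

lemma norm_stereo:
  assumes "\<bar>s\<bar> = 1" shows "norm (stereo s x) = (norm x)\<^sup>2 + 1"
proof -
  have "s * s = 1" using assms by (auto simp: abs_if split: if_splits)
  then have "(norm (stereo s x))\<^sup>2 = ((norm x)\<^sup>2 + 1)\<^sup>2"
    unfolding norm_complex2 norm_real3 stereo_def vector_2
    by (simp add: power2_eq_square) algebra
  then show ?thesis by (simp add: power2_eq_iff_nonneg)
qed

lemma stereo_nonzero: "\<bar>s\<bar> = 1 \<Longrightarrow> stereo s x \<noteq> 0"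
  using norm_stereo[of s x] by (metis add_nonneg_pos norm_zero less_irrefl zero_le_power2 zero_less_one)

lemma stereo_inv_scale: "r > 0 \<Longrightarrow> stereo_inv s (r *\<^sub>R p) = stereo_inv s p"
proof -
  assume r: "r > 0"
  have "norm (r *\<^sub>R p) - s * Im ((r *\<^sub>R p)$2) = r * (norm p - s * Im (p$2))"
    using r by (simp add: algebra_simps)
  then show ?thesis
    using r by (simp add: stereo_inv_def vec_eq_iff forall_3 vector_3)
qed

lemma stereo_pole_distance: "\<bar>s\<bar> = 1 \<Longrightarrow> norm (stereo s x) - s * Im (stereo s x $ 2) = 2"
proof -
  assume s: "\<bar>s\<bar> = 1"
  then have "s * s = 1" by (auto simp: abs_if split: if_splits)
  then have m: "s * (s * ((norm x)\<^sup>2 - 1)) = (norm x)\<^sup>2 - 1" by (metis mult.assoc mult_1)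
  have "Im (stereo s x $ 2) = s * ((norm x)\<^sup>2 - 1)" by (simp add: stereo_def vector_2)
  then show ?thesis by (simp add: norm_stereo[OF s] m del: right_diff_distrib)
qed

lemma stereo_inv_stereo: "\<bar>s\<bar> = 1 \<Longrightarrow> stereo_inv s (stereo s x) = x"
  unfolding stereo_inv_def by (simp add: stereo_pole_distance) (simp add: stereo_def vec_eq_iff forall_3 vector_3 vector_2)

lemma stereo_stereo_inv:
  assumes s: "\<bar>s\<bar> = 1" and d: "norm p - s * Im (p$2) > 0"
  shows "stereo s (stereo_inv s p) = (2 / (norm p - s * Im (p$2))) *\<^sub>R p"
proof -
  define d where "d = norm p - s * Im (p$2)"
  have d0: "d > 0" using d by (simp add: d_def)
  have ss: "s * s = 1" using s by (auto simp: abs_if split: if_splits)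
  have T: "(Re (p$1))\<^sup>2 + (Im (p$1))\<^sup>2 + (Re (p$2))\<^sup>2 = d * (d + 2 * s * Im (p$2))"
  proof -
    have "d * (d + 2 * s * Im (p$2)) = (norm p)\<^sup>2 - (s * s) * (Im (p$2))\<^sup>2"
      by (simp add: d_def algebra_simps power2_eq_square)
    then show ?thesis using norm_complex2[of p] ss by simp
  qed
  have "(norm (stereo_inv s p))\<^sup>2 = (inverse d)\<^sup>2 * (d * (d + 2 * s * Im (p$2)))"
    unfolding T[symmetric] norm_real3 stereo_inv_def d_def[symmetric]
    by (simp add: vector_3 power_mult_distrib distrib_left)
  also have "\<dots> = 1 + 2 * s * Im (p$2) / d"
    using d0 by (simp add: power2_eq_square field_simps)
  finally have n: "(norm (stereo_inv s p))\<^sup>2 - 1 = 2 * s * Im (p$2) / d" by simp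
  have "s * (2 * s * Im (p$2) / d) = (s * s) * (2 * Im (p$2) / d)" by simp
  then have m: "s * (2 * s * Im (p$2) / d) = 2 * Im (p$2) / d" using ss by simp
  show ?thesis
    unfolding stereo_def n m d_def[symmetric]
    by (simp add: stereo_inv_def d_def[symmetric] vec_eq_iff forall_2 vector_2 vector_3 complex_eq_iff divide_inverse)
qed

lemma smooth_stereo: "smooth_on UNIV (stereo s)"
proof -
  have lin: "bounded_linear (\<lambda>x::real^3. vector [Complex (2 * x$1) (2 * x$2), Complex (2 * x$3) 0] :: complex^2)"
    unfolding linear_conv_bounded_linear[symmetric]
    by (auto intro!: linearI simp: vec_eq_iff forall_2 vector_2 complex_eq_iff algebra_simps)
  have "smooth_on UNIV (\<lambda>x::real^3. (vector [Complex (2 * x$1) (2 * x$2), Complex (2 * x$3) 0] :: complex^2)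
      + (s * (x \<bullet> x) + (- s)) *\<^sub>R axis 2 \<i>)"
    by (intro smooth_on_add smooth_on_scaleR smooth_on_mult smooth_on_inner smooth_on_const
        smooth_on_linear[OF lin] smooth_on_linear[OF bounded_linear_ident] open_UNIV)
  then show ?thesis
    by (rule smooth_on_cong)
      (simp add: stereo_def vec_eq_iff forall_2 vector_2 complex_eq_iff axis_def power2_norm_eq_inner algebra_simps)
qed

lemma stereo_inv_differentiable:
  assumes "p \<noteq> 0" "norm p - s * Im (p$2) \<noteq> 0"
  shows "stereo_inv s differentiable (at p)"
proof -
  have "bounded_linear (\<lambda>p::complex^2. vector [Re (p$1), Im (p$1), Re (p$2)] :: real^3)"
    unfolding linear_conv_bounded_linear[symmetric]
    by (auto intro!: linearI simp: vec_eq_iff forall_3 vector_3)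
  then have 1: "(\<lambda>p::complex^2. vector [Re (p$1), Im (p$1), Re (p$2)] :: real^3) differentiable (at p)"
    by (rule bounded_linear_imp_differentiable)
  have "bounded_linear (\<lambda>p::complex^2. s * Im (p$2))"
    unfolding linear_conv_bounded_linear[symmetric] by (auto intro!: linearI simp: algebra_simps)
  then have 2: "(\<lambda>p::complex^2. s * Im (p$2)) differentiable (at p)"
    by (rule bounded_linear_imp_differentiable)
  have 3: "norm differentiable (at p)"
    using assms(1) by (rule differentiable_norm_at)
  show ?thesis
    unfolding stereo_inv_def[abs_def]
    by (intro differentiable_scaleR 1 differentiable_inverse differentiable_diff 2 3 assms(2))
qed

context circular_surface
begin

definition enclosed :: "(complex^2) set" where "enclosed = {p. N p < 1}"

lemma enclosed_borel: "enclosed \<in> sets borel"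
proof -
  have "enclosed = N -` {..<1} \<inter> space borel" by (auto simp: enclosed_def)
  then show ?thesis using measurable_sets[OF measurable_N, of "{..<1}"] by simp
qed

text \<open>The cones below the disjoint pieces of the surface partition the punctured domain, whatever the
  charts.\<close>

lemma form_integral_value:
  assumes \<sigma>: "fefferman_form Z \<sigma>" and I: "has_positive_form_integral \<sigma> I Z"
  shows "I = 4 * (\<integral>\<^sup>+p. ennreal (radial_density p) * indicator enclosed p \<partial>lborel)"
proof -
  obtain U \<phi> A where all: "\<forall>n::nat. local_param Z (U n) (\<phi> n) \<and> A n \<in> sets borel \<and> A n \<subseteq> U n"
    and disj: "disjoint_family (\<lambda>n. \<phi> n ` A n)" and Z: "Z = (\<Union>n. \<phi> n ` A n)"
    and Ieq: "I = (\<Sum>n. \<integral>\<^sup>+x\<in>A n. ennreal \<bar>pullback_coeff \<sigma> (\<phi> n) x\<bar> \<partial>lborel)"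
    using I unfolding has_positive_form_integral_def by (elim exE conjE) (rule that)
  have loc: "local_param Z (U n) (\<phi> n)" "A n \<in> sets borel" "A n \<subseteq> U n" for n
    using all by auto
  have piece: "(\<integral>\<^sup>+x\<in>A n. ennreal \<bar>pullback_coeff \<sigma> (\<phi> n) x\<bar> \<partial>lborel)
      = 4 * (\<integral>\<^sup>+p. ennreal (radial_density p) * indicator (cone (\<phi> n ` A n)) p \<partial>lborel)" for n
  proof -
    have "\<bar>pullback_coeff \<sigma> (\<phi> n) x\<bar> =
       \<bar>volume_form (Der (\<phi> n) x (axis 1 1)) (Der (\<phi> n) x (axis 2 1)) (Der (\<phi> n) x (axis 3 1)) (\<phi> n x)\<bar>
            * radial_density (\<phi> n x)" if x: "x \<in> A n" for x
    proof -
      have xU: "x \<in> U n" using loc(3) x by auto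
      have "\<phi> n ` U n \<subseteq> Z" using loc(1)[of n] unfolding local_param_def by (auto dest: openin_imp_subset)
      then have p: "\<phi> n x \<in> Z" using xU by auto
      then have p0: "\<phi> n x \<noteq> 0" using zero_notin by metis
      have "pullback_coeff \<sigma> (\<phi> n) x = fefferman_density (\<phi> n x) *
         volume_form (Der (\<phi> n) x (axis 1 1)) (Der (\<phi> n) x (axis 2 1)) (Der (\<phi> n) x (axis 3 1)) (\<phi> n x)"
        unfolding pullback_coeff_def Let_def
        by (rule fefferman_form_unique[OF \<sigma> p]) (rule local_param_tangent[OF loc(1) xU])+
      then show ?thesis using p0 by (simp add: radial_density_def proj_Z[OF p] abs_mult)
    qed
    then have "(\<integral>\<^sup>+x\<in>A n. ennreal \<bar>pullback_coeff \<sigma> (\<phi> n) x\<bar> \<partial>lborel) =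
      (\<integral>\<^sup>+x. ennreal (\<bar>volume_form (Der (\<phi> n) x (axis 1 1)) (Der (\<phi> n) x (axis 2 1)) (Der (\<phi> n) x (axis 3 1)) (\<phi> n x)\<bar>
            * radial_density (\<phi> n x)) * indicator (A n) x \<partial>lborel)"
      by (intro nn_integral_cong) (simp split: split_indicator)
    then show ?thesis unfolding cone_integral[OF loc(1-3)] .
  qed
  have cone_m: "cone (\<phi> n ` A n) \<in> sets borel" for n
    by (intro cone_borel local_param_image_borel[OF loc(1-3)])
  have "I = (\<Sum>n. 4 * (\<integral>\<^sup>+p. ennreal (radial_density p) * indicator (cone (\<phi> n ` A n)) p \<partial>lborel))"
    unfolding Ieq piece ..
  also have "\<dots> = 4 * (\<Sum>n. (\<integral>\<^sup>+p. ennreal (radial_density p) * indicator (cone (\<phi> n ` A n)) p \<partial>lborel))"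
    by simp
  also have "(\<Sum>n. (\<integral>\<^sup>+p. ennreal (radial_density p) * indicator (cone (\<phi> n ` A n)) p \<partial>lborel))
      = (\<integral>\<^sup>+p. (\<Sum>n. ennreal (radial_density p) * indicator (cone (\<phi> n ` A n)) p) \<partial>lborel)"
    using cone_m by (intro nn_integral_suminf[symmetric]) simp
  also have "\<dots> = (\<integral>\<^sup>+p. ennreal (radial_density p) * indicator enclosed p \<partial>lborel)"
  proof (rule nn_integral_cong)
    fix p
    have dc: "disjoint_family (\<lambda>n. cone (\<phi> n ` A n))"
      using disj by (fastforce simp: disjoint_family_on_def cone_def)
    show "(\<Sum>n. ennreal (radial_density p) * indicator (cone (\<phi> n ` A n)) p) = ennreal (radial_density p) * indicator enclosed p"
    proof (cases "p \<noteq> 0 \<and> N p < 1")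
      case True
      then have "proj p \<in> Z" using proj_in_Z by blast
      then obtain n where "proj p \<in> \<phi> n ` A n" unfolding Z by blast
      then have "p \<in> cone (\<phi> n ` A n)" using True by (simp add: cone_def)
      from suminf_cmult_indicator[OF dc this, of "\<lambda>_. ennreal (radial_density p)"]
      show ?thesis using True by (simp add: enclosed_def)
    next
      case False
      then have "ennreal (radial_density p) * indicator enclosed p = 0"
        by (auto simp: radial_density_def enclosed_def)
      moreover have "indicator (cone (\<phi> n ` A n)) p = (0::ennreal)" for n
        using False by (auto simp: cone_def)
      ultimately show ?thesis by simp
    qed
  qed
  finally show ?thesis .
qed

definition chart :: "real \<Rightarrow> real^3 \<Rightarrow> complex^2" where "chart s x = proj (stereo s x)"

lemma smooth_chart:
  assumes s: "\<bar>s\<bar> = 1" shows "smooth_on UNIV (chart s)"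
proof -
  have "smooth_on UNIV (\<lambda>x. N (stereo s x))"
    by (rule smooth_on_compose[OF smooth_stereo gauge_smooth]) (use stereo_nonzero[OF s] in auto)
  then have "smooth_on UNIV (\<lambda>x. inverse (N (stereo s x)))"
    by (rule smooth_on_inverse) (metis gauge_pos stereo_nonzero[OF s] less_irrefl)
  from smooth_on_scaleR[OF this smooth_stereo]
  show ?thesis by (simp add: chart_def[abs_def] proj_def)
qed

lemma proj_pos_multiple: "p \<noteq> 0 \<Longrightarrow> \<exists>r>0. proj p = r *\<^sub>R p"
  using gauge_pos[of p] by (auto simp: proj_def intro!: exI[of _ "inverse (N p)"])

lemma stereo_inv_chart: "\<bar>s\<bar> = 1 \<Longrightarrow> stereo_inv s (chart s x) = x"
  using proj_pos_multiple[OF stereo_nonzero[of s x]] stereo_inv_scale stereo_inv_stereo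
  by (auto simp: chart_def)

lemma chart_image:
  assumes s: "\<bar>s\<bar> = 1"
  shows "range (chart s) = Z \<inter> {p. s * Im (p$2) < norm p}"
proof (intro equalityI subsetI)
  fix p assume "p \<in> range (chart s)"
  then obtain x where x: "p = chart s x" by auto
  obtain r where r: "r > 0" "p = r *\<^sub>R stereo s x"
    using proj_pos_multiple[OF stereo_nonzero[OF s, of x]] x by (auto simp: chart_def)
  have "norm p - s * Im (p$2) = r * (norm (stereo s x) - s * Im (stereo s x $ 2))"
    using r by (simp add: algebra_simps)
  then have "norm p - s * Im (p$2) > 0" using r(1) by (simp add: stereo_pole_distance[OF s])
  moreover have "p \<in> Z" using proj_in_Z[OF stereo_nonzero[OF s, of x]] x by (simp add: chart_def)
  ultimately show "p \<in> Z \<inter> {p. s * Im (p$2) < norm p}" by simp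
next
  fix p assume p: "p \<in> Z \<inter> {p. s * Im (p$2) < norm p}"
  then have "norm p - s * Im (p$2) > 0" by simp
  from stereo_stereo_inv[OF s this] this have "chart s (stereo_inv s p) = proj p"
    by (simp add: chart_def proj_scale)
  then show "p \<in> range (chart s)" using p proj_Z by (metis IntD1 rangeI)
qed

text \<open>The stereographic inverse is differentiable and inverts the chart. This gives both the continuity of the inverse
  and the injectivity of the derivative.\<close>

lemma local_param_chart:
  assumes s: "\<bar>s\<bar> = 1" shows "local_param Z UNIV (chart s)"
  unfolding local_param_def
proof (intro conjI ballI)
  show sm: "smooth_on UNIV (chart s)" by (rule smooth_chart[OF s])
  have "open {p::complex^2. s * Im (p$2) < norm p}" by (intro open_Collect_less continuous_intros)
  then show "openin (top_of_set Z) (range (chart s))"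
    unfolding chart_image[OF s] by auto
  have diff: "stereo_inv s differentiable (at p)" if "p \<in> range (chart s)" for p
  proof (rule stereo_inv_differentiable)
    show "p \<noteq> 0" "norm p - s * Im (p $ 2) \<noteq> 0"
      using that zero_notin unfolding chart_image[OF s] by auto
  qed
  have "homeomorphism UNIV (range (chart s)) (chart s) (stereo_inv s)"
    unfolding homeomorphism_def
  proof (intro conjI ballI)
    show "continuous_on UNIV (chart s)" by (rule smooth_on_continuous[OF sm])
    show "continuous_on (range (chart s)) (stereo_inv s)"
      using diff by (intro continuous_at_imp_continuous_on ballI differentiable_imp_continuous_within)
  qed (auto simp: stereo_inv_chart[OF s] image_iff)
  then show "\<exists>\<psi>. homeomorphism UNIV (range (chart s)) (chart s) \<psi>" by blast
  fix x :: "real^3"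
  have "(stereo_inv s has_derivative Der (stereo_inv s) (chart s x)) (at (chart s x))"
    by (rule Der_works[OF diff]) simp
  from has_derivative_compose[OF smooth_on_has_derivative[OF sm UNIV_I] this]
  have "((\<lambda>x. x) has_derivative (\<lambda>v. Der (stereo_inv s) (chart s x) (Der (chart s) x v))) (at x)"
    by (simp add: stereo_inv_chart[OF s])
  from has_derivative_unique[OF this has_derivative_ident]
  have "Der (stereo_inv s) (chart s x) (Der (chart s) x v) = v" for v by (rule fun_cong)
  then show "inj (Der (chart s) x)" by (metis injI)
qed

lemma chart_pole:
  assumes p: "p \<in> Z" "Im (p$2) = norm p" shows "p = chart (-1) 0"
proof -
  have "(Re (p$1))\<^sup>2 + (Im (p$1))\<^sup>2 + (Re (p$2))\<^sup>2 = 0"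
    using norm_complex2[of p] p(2) by simp
  then have "Re (p$1) = 0" "Im (p$1) = 0" "Re (p$2) = 0"
    by (simp_all add: sum_power2_eq_zero_iff add_nonneg_eq_0_iff)
  then have "p = norm p *\<^sub>R stereo (-1) 0"
    using p(2) by (simp add: stereo_def vec_eq_iff forall_2 vector_2 complex_eq_iff)
  moreover have "norm p > 0" using p(1) zero_notin by auto
  ultimately have "proj p = chart (-1) 0" by (metis chart_def proj_scale)
  then show ?thesis using proj_Z[OF p(1)] by simp
qed

text \<open>One stereographic chart covers everything except a pole, and the opposite chart contributes that single
  point.\<close>

lemma form_integral_exists: "\<exists>I. has_positive_form_integral \<sigma> I Z"
proof -
  define \<phi> :: "nat \<Rightarrow> real^3 \<Rightarrow> complex^2" where "\<phi> n = (if n = 0 then chart 1 else chart (-1))" for n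
  define A :: "nat \<Rightarrow> (real^3) set" where "A n = (if n = 0 then UNIV else if n = 1 then {0} else {})" for n
  have loc: "local_param Z UNIV (\<phi> n) \<and> A n \<in> sets borel \<and> A n \<subseteq> UNIV" for n
    using local_param_chart[of 1] local_param_chart[of "-1"] by (simp add: \<phi>_def A_def)
  have im: "\<phi> n ` A n = (if n = 0 then Z \<inter> {p. Im (p$2) < norm p} else if n = 1 then {chart (-1) 0} else {})" for n
    using chart_image[of 1] by (simp add: \<phi>_def A_def)
  have pole: "chart (-1) 0 \<in> Z"
    using proj_in_Z[OF stereo_nonzero[of "-1" 0]] by (simp add: chart_def)
  have pole2: "\<not> Im (chart (-1) 0 $ 2) < norm (chart (-1) 0)"
  proof -
    obtain r where r: "r > 0" "chart (-1) 0 = r *\<^sub>R stereo (-1) 0"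
      using proj_pos_multiple[OF stereo_nonzero[of "-1" 0]] by (auto simp: chart_def)
    have "norm (stereo (-1) 0) = 1" "Im (stereo (-1) 0 $ 2) = 1"
      using norm_stereo[of "-1" 0] by (simp_all add: stereo_def vector_2)
    then show ?thesis using r by simp
  qed
  have le: "Im (p$2) \<le> norm p" for p :: "complex^2"
    using abs_Im_le_cmod[of "p$2"] Finite_Cartesian_Product.norm_nth_le[of p 2] by linarith
  have "disjoint_family (\<lambda>n. \<phi> n ` A n)"
    unfolding disjoint_family_on_def im using pole2 by auto
  moreover have "Z = (\<Union>n. \<phi> n ` A n)"
  proof (intro equalityI subsetI)
    fix p assume p: "p \<in> Z"
    show "p \<in> (\<Union>n. \<phi> n ` A n)"
    proof (cases "Im (p$2) < norm p")
      case True
      then have "p \<in> \<phi> 0 ` A 0" using p unfolding im by simp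
      then show ?thesis by blast
    next
      case False
      then have "p = chart (-1) 0" using chart_pole[OF p] le[of p] by simp
      then have "p \<in> \<phi> 1 ` A 1" unfolding im by simp
      then show ?thesis by blast
    qed
  next
    fix p assume "p \<in> (\<Union>n. \<phi> n ` A n)"
    then show "p \<in> Z" unfolding im using pole by (auto split: if_splits)
  qed
  ultimately have "has_positive_form_integral \<sigma>
      (\<Sum>n. \<integral>\<^sup>+x\<in>A n. ennreal \<bar>pullback_coeff \<sigma> (\<phi> n) x\<bar> \<partial>lborel) Z"
    unfolding has_positive_form_integral_def using loc
    by (intro exI[of _ "\<lambda>_. UNIV"] exI[of _ \<phi>] exI[of _ A] conjI allI) auto
  then show ?thesis by blast
qed

lemma fefferman_measure_polar:
  "fefferman_measure Z = enn2real (4 * (\<integral>\<^sup>+p. ennreal (radial_density p) * indicator enclosed p \<partial>lborel))"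
proof -
  obtain I where I: "has_positive_form_integral (\<lambda>p v1 v2 v3. fefferman_density p * volume_form v1 v2 v3 p) I Z"
    using form_integral_exists by blast
  have "(THE I. \<exists>\<sigma>. fefferman_form Z \<sigma> \<and> has_positive_form_integral \<sigma> I Z)
    = 4 * (\<integral>\<^sup>+p. ennreal (radial_density p) * indicator enclosed p \<partial>lborel)"
  proof (rule the_equality)
    show "\<exists>\<sigma>. fefferman_form Z \<sigma> \<and> has_positive_form_integral \<sigma>
       (4 * (\<integral>\<^sup>+p. ennreal (radial_density p) * indicator enclosed p \<partial>lborel)) Z"
      using I fefferman_form_exists form_integral_value[OF fefferman_form_exists I] by blast
  qed (use form_integral_value in blast)
  then show ?thesis by (simp add: fefferman_measure_def)
qed

end


section \<open>The enclosed domain\<close>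

context circular_surface
begin

lemma gauge_bounds: "\<exists>c C. c > 0 \<and> C > 0 \<and> (\<forall>v. c * norm v \<le> N v \<and> N v \<le> C * norm v)"
proof -
  let ?S = "sphere (0::complex^2) 1"
  have ne: "?S \<noteq> {}" by simp
  have cont: "continuous_on ?S N" by (rule continuous_on_subset[OF continuous_N]) auto
  obtain a where a: "a \<in> ?S" "\<forall>x\<in>?S. N a \<le> N x"
    using continuous_attains_inf[OF compact_sphere ne cont] by blast
  obtain b where b: "b \<in> ?S" "\<forall>x\<in>?S. N x \<le> N b"
    using continuous_attains_sup[OF compact_sphere ne cont] by blast
  have pos: "N a > 0" "N b > 0" using a b by (auto intro!: gauge_pos)
  have "N a * norm v \<le> N v \<and> N v \<le> N b * norm v" for v
  proof (cases "v = 0")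
    case False
    have e: "N v = norm v * N (inverse (norm v) *\<^sub>R v)" using False by (simp add: gauge_scaleR)
    have "inverse (norm v) *\<^sub>R v \<in> ?S" using False by simp
    then have "N a \<le> N (inverse (norm v) *\<^sub>R v)" "N (inverse (norm v) *\<^sub>R v) \<le> N b" using a b by auto
    then show ?thesis using False unfolding e by (simp add: mult.commute mult_left_mono)
  qed simp
  then show ?thesis using pos by blast
qed

lemma continuous_gauge: "continuous_on UNIV N"
proof -
  obtain C where C: "C > 0" "\<And>v. N v \<le> C * norm v" using gauge_bounds by blast
  have nonneg: "N v \<ge> 0" for v using gauge_pos[of v] by (cases "v = 0") auto
  have "isCont N v" for v
  proof (cases "v = 0")
    case False
    then show ?thesis using continuous_N by (simp add: continuous_on_eq_continuous_at open_Compl)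
  next
    case True
    have L: "((\<lambda>v::complex^2. C * norm v) \<longlongrightarrow> 0) (at 0)"
      by (rule tendsto_eq_rhs[OF tendsto_mult[OF tendsto_const tendsto_norm[OF tendsto_ident_at]]]) simp
    have "(N \<longlongrightarrow> 0) (at 0)"
      by (rule tendsto_sandwich[OF _ _ tendsto_const L]) (simp_all add: nonneg C(2))
    then show ?thesis using True by (simp add: isCont_def)
  qed
  then show ?thesis by (simp add: continuous_at_imp_continuous_on)
qed

lemma Z_nonempty: "Z \<noteq> {}"
  using radial_projection[of "axis 1 1"] by (auto simp: axis_eq_0_iff)

lemma enclosed_props: "open enclosed" "connected enclosed" "bounded enclosed" "frontier enclosed = Z"
proof -
  show op: "open enclosed" unfolding enclosed_def
    by (intro open_Collect_less continuous_gauge continuous_intros)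
  have "starlike enclosed"
    unfolding starlike_def
  proof (intro bexI ballI subsetI)
    fix x y assume x: "x \<in> enclosed" and "y \<in> closed_segment 0 x"
    then obtain t where t: "0 \<le> t" "t \<le> 1" "y = t *\<^sub>R x" by (auto simp: in_segment)
    have "t * N x \<le> 1 * N x"
      using t gauge_pos[of x] by (intro mult_right_mono) (cases "x = 0"; auto)+
    then show "y \<in> enclosed" using x t by (simp add: enclosed_def gauge_scaleR)
  qed (simp add: enclosed_def)
  then show "connected enclosed" by (rule starlike_imp_connected)
  obtain c where c: "c > 0" "\<And>v. c * norm v \<le> N v" using gauge_bounds by blast
  have "norm v \<le> 1 / c" if "v \<in> enclosed" for v
    using c(2)[of v] that c(1) by (simp add: enclosed_def field_simps)
  then show "bounded enclosed" unfolding bounded_iff by blast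
  have "closure enclosed \<subseteq> {p. N p \<le> 1}"
    by (rule closure_minimal) (auto simp: enclosed_def intro!: closed_Collect_le continuous_gauge continuous_intros)
  moreover have "p \<in> closure enclosed" if p: "p \<in> Z" for p
    unfolding closure_approachable
  proof (intro allI impI)
    fix e :: real assume e: "e > 0"
    have np: "norm p > 0" using p zero_notin by auto
    define d where "d = min 1 (e / (2 * norm p))"
    have d: "0 < d" "d \<le> 1" "d * norm p \<le> e / 2"
    proof -
      have "d \<le> e / (2 * norm p)" by (simp add: d_def)
      then show "d * norm p \<le> e / 2" using np by (simp add: field_simps)
    qed (use e np in \<open>auto simp: d_def\<close>)
    have "N ((1 - d) *\<^sub>R p) < 1" using d p by (simp add: gauge_scaleR mem_iff)
    moreover have "dist ((1 - d) *\<^sub>R p) p < e"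
    proof -
      have "(1 - d) *\<^sub>R p - p = (- d) *\<^sub>R p" by (simp add: algebra_simps)
      then show ?thesis using d e by (simp add: dist_norm)
    qed
    ultimately show "\<exists>y\<in>enclosed. dist y p < e" by (auto simp: enclosed_def)
  qed
  ultimately have c: "closure enclosed \<subseteq> {p. N p \<le> 1}" "Z \<subseteq> closure enclosed" by auto
  show "frontier enclosed = Z"
    unfolding frontier_def interior_open[OF op]
  proof (intro equalityI subsetI)
    fix p assume "p \<in> closure enclosed - enclosed"
    then have "N p \<le> 1" "\<not> N p < 1" using c by (auto simp: enclosed_def)
    then show "p \<in> Z" by (simp add: mem_iff)
  next
    fix p assume p: "p \<in> Z"
    then have "p \<notin> enclosed" by (simp add: enclosed_def mem_iff)
    then show "p \<in> closure enclosed - enclosed" using p c by blast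
  qed
qed

lemma connected_outside: "connected {p. N p > 1}"
proof -
  have "connected (- {0::complex^2})"
    by (rule connected_punctured_universe) simp
  then have c: "connected ((- {0::complex^2}) \<times> {1::real<..})" by (intro connected_Times) auto
  have "continuous_on ((- {0::complex^2}) \<times> {1::real<..}) (\<lambda>x. snd x *\<^sub>R proj (fst x))"
    by (intro continuous_on_scaleR continuous_on_snd continuous_on_id
        continuous_on_compose2[OF continuous_proj continuous_on_fst]) auto
  from connected_continuous_image[OF this c]
  have "connected ((\<lambda>x. snd x *\<^sub>R proj (fst x)) ` ((- {0::complex^2}) \<times> {1::real<..}))" .
  also have "(\<lambda>x. snd x *\<^sub>R proj (fst x)) ` ((- {0::complex^2}) \<times> {1::real<..}) = {p. N p > 1}"
  proof (intro equalityI subsetI)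
    fix p assume "p \<in> (\<lambda>x. snd x *\<^sub>R proj (fst x)) ` ((- {0::complex^2}) \<times> {1::real<..})"
    then obtain q t where "q \<noteq> 0" "t > 1" "p = t *\<^sub>R proj q" by force
    then show "p \<in> {p. N p > 1}" using proj_in_Z[of q] by (simp add: gauge_scaleR mem_iff)
  next
    fix p assume p: "p \<in> {p. N p > 1}"
    then have "p \<noteq> 0" by auto
    then have "p = N p *\<^sub>R proj p" using gauge_pos[of p] by (simp add: proj_def)
    then show "p \<in> (\<lambda>x. snd x *\<^sub>R proj (fst x)) ` ((- {0::complex^2}) \<times> {1::real<..})"
      using p \<open>p \<noteq> 0\<close> by (intro image_eqI[of _ _ "(p, N p)"]) auto
  qed
  finally show ?thesis .
qed

text \<open>A connected open set whose frontier is the surface cannot meet a connected set that avoids the surface without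
  containing it. It is therefore one of the two complementary components, and only the inner one is bounded.\<close>

lemma enclosed_domain_eq: "enclosed_domain Z = enclosed"
  unfolding enclosed_domain_def
proof (rule the_equality)
  show "open enclosed \<and> connected enclosed \<and> bounded enclosed \<and> frontier enclosed = Z"
    using enclosed_props by blast
  fix D assume D: "open D \<and> connected D \<and> bounded D \<and> frontier D = Z"
  let ?E = "{p. N p > 1}"
  have DZ: "D \<inter> Z = {}" using D by (auto simp: frontier_def interior_open)
  have ne: "D \<noteq> {}" using D Z_nonempty by auto
  have opE: "open ?E" by (intro open_Collect_less continuous_gauge continuous_intros)
  have fill: "S \<subseteq> D" if "connected S" "S \<inter> D \<noteq> {}" "S \<inter> Z = {}" for S
    using connected_Int_frontier[OF that(1,2)] that(3) D by blast
  have "D \<inter> enclosed \<inter> ?E = {}" by (auto simp: enclosed_def)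
  moreover have "D \<subseteq> enclosed \<union> ?E"
    using DZ by (auto simp: enclosed_def mem_iff not_less)
  ultimately have "enclosed \<inter> D = {} \<or> ?E \<inter> D = {}"
    using connectedD[of D enclosed ?E] D enclosed_props(1) opE by blast
  then show "D = enclosed"
  proof
    assume 0: "enclosed \<inter> D = {}"
    then have "?E \<inter> D \<noteq> {}" using \<open>D \<subseteq> _\<close> ne by blast
    then have "?E \<subseteq> D" by (rule fill[OF connected_outside]) (auto simp: mem_iff)
    then have "bounded ?E" using D bounded_subset by blast
    then obtain B where B: "\<And>p. N p > 1 \<Longrightarrow> norm p \<le> B" unfolding bounded_iff by blast
    obtain p where p: "p \<in> Z" using Z_nonempty by blast
    have np: "norm p > 0" using p zero_notin by auto
    define t where "t = \<bar>B\<bar> / norm p + 2"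
    have "0 \<le> \<bar>B\<bar> / norm p" by simp
    then have t: "t > 1" unfolding t_def by linarith
    then have "norm (t *\<^sub>R p) \<le> B" using p by (intro B) (simp add: gauge_scaleR mem_iff)
    moreover have "norm (t *\<^sub>R p) = \<bar>B\<bar> + 2 * norm p" using t np by (simp add: t_def field_simps)
    ultimately show ?thesis using np by linarith
  next
    assume 0: "?E \<inter> D = {}"
    then have sub: "D \<subseteq> enclosed" using \<open>D \<subseteq> _\<close> by blast
    then have "enclosed \<inter> D \<noteq> {}" using ne by blast
    then have "enclosed \<subseteq> D" by (rule fill[OF enclosed_props(2)]) (auto simp: enclosed_def mem_iff)
    then show ?thesis using sub by blast
  qed
qed

end

section \<open>Integration in projective coordinates\<close>

text \<open>Multiplication by \<open>c\<close> is a real linear map of determinant \<open>\<bar>c\<bar>\<^sup>2\<close>.\<close>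

lemma nn_integral_complex_scale:
  fixes f :: "complex \<Rightarrow> real"
  assumes f [measurable]: "f \<in> borel_measurable borel" "\<And>z. f z \<ge> 0"
    and c: "c \<noteq> 0"
  shows "(\<integral>\<^sup>+w. ennreal (f w) \<partial>lborel) = (\<integral>\<^sup>+z. ennreal ((cmod c)\<^sup>2 * f (c * z)) \<partial>lborel)"
proof -
  define T :: "complex \<Rightarrow> real^2" where "T z = vector [Re z, Im z]" for z
  define S :: "real^2 \<Rightarrow> complex" where "S y = Complex (y$1) (y$2)" for y
  have TS: "T (S y) = y" "S (T z) = z" for y z by (simp_all add: T_def S_def vec_eq_iff forall_2 vector_2)
  have lT: "linear T" by (auto intro!: linearI simp: T_def vec_eq_iff forall_2 vector_2)
  have lS: "linear S" by (auto intro!: linearI simp: S_def complex_eq_iff)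
  have [measurable]: "S \<in> borel_measurable borel" by (rule linear_borel_measurable[OF lS])
  have injT: "inj T" by (metis TS(2) injI)
  have BT: "T ` Basis \<subseteq> Basis"
  proof -
    have "T 1 = axis 1 1" "T \<i> = axis 2 1" by (auto simp: T_def vec_eq_iff forall_2 vector_2 axis_def)
    then show ?thesis by (auto simp: Basis_complex_def Basis_vec_real)
  qed
  have tr: "(\<integral>\<^sup>+y. ennreal (h (S y)) \<partial>lborel) = (\<integral>\<^sup>+z. ennreal (h z) \<partial>lborel)"
    if [measurable]: "h \<in> borel_measurable borel" for h :: "complex \<Rightarrow> real"
    using nn_integral_lborel_Basis[OF lT injT BT, of "\<lambda>y. ennreal (h (S y))"] by (simp add: TS)
  define g where "g y = T (c * S y)" for y
  have Sg: "S (g y) = c * S y" for y by (simp add: g_def TS)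
  have lg: "linear g"
    using linear_compose[OF linear_compose[OF lS, of "\<lambda>z. c * z"] lT]
    by (simp add: g_def[abs_def] o_def linearI algebra_simps)
  have det: "\<bar>det (matrix g)\<bar> = (cmod c)\<^sup>2"
  proof -
    have "det (matrix g) = (Re c)\<^sup>2 + (Im c)\<^sup>2"
      unfolding det_2 matrix_def by (simp add: g_def T_def S_def axis_def vector_2 power2_eq_square)
    then show ?thesis by (simp add: cmod_power2)
  qed
  have gS: "g ` UNIV = UNIV"
  proof -
    have "y \<in> range g" for y
      by (rule range_eqI[of _ _ "T (S y / c)"]) (use c in \<open>simp add: g_def TS\<close>)
    then show ?thesis by auto
  qed
  have injg: "inj_on g UNIV"
    by (rule injI) (metis TS c g_def mult_left_cancel)
  have "(\<integral>\<^sup>+x. ennreal (\<bar>det (matrix g)\<bar> * f (S (g x))) * indicator UNIV x \<partial>lborel)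
     = (\<integral>\<^sup>+y. ennreal (f (S y)) * indicator (g ` UNIV) y \<partial>lborel)"
  proof (rule nn_integral_change_of_variables[OF _ _ _ injg])
    show "(g has_derivative g) (at x within UNIV)" for x
      by (rule bounded_linear_imp_has_derivative) (use lg linear_conv_bounded_linear in blast)
    have [measurable]: "g \<in> borel_measurable borel" by (rule linear_borel_measurable[OF lg])
    show "(\<lambda>x. indicator UNIV x * (\<bar>det (matrix g)\<bar> * f (S (g x)))) \<in> borel_measurable borel" by measurable
    show "(\<lambda>y. f (S y)) \<in> borel_measurable borel" by measurable
  qed (use gS f(2) in auto)
  then have "(\<integral>\<^sup>+x. ennreal ((cmod c)\<^sup>2 * f (c * S x)) \<partial>lborel) = (\<integral>\<^sup>+y. ennreal (f (S y)) \<partial>lborel)"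
    by (simp add: det gS Sg)
  then show ?thesis
    using tr[of f] tr[of "\<lambda>z. (cmod c)\<^sup>2 * f (c * z)"] by simp
qed

text \<open>Layer cake: \<open>\<bar>z\<bar>\<^sup>2\<close> is the length of \<open>{0<..<\<bar>z\<bar>\<^sup>2}\<close>, and the inner integrals become areas of
  annuli.\<close>

lemma nn_integral_disc_norm_square:
  assumes R: "R > 0"
  shows "(\<integral>\<^sup>+z. ennreal ((cmod z)\<^sup>2) * indicator (ball 0 R) z \<partial>lborel) = ennreal (pi / 2 * R ^ 4)"
proof -
  let ?h = "\<lambda>(z::complex) t. indicator {0<..<(cmod z)\<^sup>2} t * indicator (ball 0 R) z :: ennreal"
  have hm: "(\<lambda>x. ?h (fst x) (snd x)) \<in> borel_measurable (borel \<Otimes>\<^sub>M borel)"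
  proof -
    have "{x::complex \<times> real. 0 < snd x \<and> snd x < (cmod (fst x))\<^sup>2 \<and> cmod (fst x) < R} \<in> sets (borel \<Otimes>\<^sub>M borel)"
      unfolding borel_prod by (intro borel_open open_Collect_conj open_Collect_less continuous_intros)
    then have "(indicator {x::complex \<times> real. 0 < snd x \<and> snd x < (cmod (fst x))\<^sup>2 \<and> cmod (fst x) < R} :: _ \<Rightarrow> ennreal)
       \<in> borel_measurable (borel \<Otimes>\<^sub>M borel)" by (rule borel_measurable_indicator)
    moreover have "(indicator {x::complex \<times> real. 0 < snd x \<and> snd x < (cmod (fst x))\<^sup>2 \<and> cmod (fst x) < R} :: _ \<Rightarrow> ennreal)
       = (\<lambda>x. ?h (fst x) (snd x))" by (auto simp: indicator_def fun_eq_iff)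
    ultimately show ?thesis by simp
  qed
  have "(\<integral>\<^sup>+z. ennreal ((cmod z)\<^sup>2) * indicator (ball 0 R) z \<partial>lborel) = (\<integral>\<^sup>+z. (\<integral>\<^sup>+t. ?h z t \<partial>lborel) \<partial>lborel)"
    by (intro nn_integral_cong) (simp add: nn_integral_multc)
  also have "\<dots> = (\<integral>\<^sup>+t. (\<integral>\<^sup>+z. ?h z t \<partial>lborel) \<partial>lborel)"
    using hm by (intro lborel_pair.Fubini'[symmetric]) (simp add: case_prod_beta cong: measurable_cong_sets)
  also have "\<dots> = (\<integral>\<^sup>+t. ennreal (pi * (R\<^sup>2 - t)) * indicator {0<..<R\<^sup>2} t \<partial>lborel)"
  proof (rule nn_integral_cong)
    fix t :: real
    show "(\<integral>\<^sup>+z. ?h z t \<partial>lborel) = ennreal (pi * (R\<^sup>2 - t)) * indicator {0<..<R\<^sup>2} t"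
    proof (cases "0 < t \<and> t < R\<^sup>2")
      case True
      have "sqrt t < R" using True R by (simp add: real_less_lsqrt)
      have eq: "?h z t = indicator (ball 0 R - cball 0 (sqrt t)) z" for z
      proof -
        have "t < (cmod z)\<^sup>2 \<longleftrightarrow> sqrt t < cmod z"
          using True by (metis norm_ge_zero real_sqrt_abs real_sqrt_less_iff abs_norm_cancel)
        then show ?thesis using True by (auto simp: indicator_def)
      qed
      have "(\<integral>\<^sup>+z. ?h z t \<partial>lborel) = emeasure lborel (ball (0::complex) R - cball 0 (sqrt t))"
        unfolding eq by simp
      also have "\<dots> = emeasure lborel (ball (0::complex) R) - emeasure lborel (cball (0::complex) (sqrt t))"
        using \<open>sqrt t < R\<close> True by (intro emeasure_Diff) (auto simp: emeasure_cball)
      also have "\<dots> = ennreal (pi * (R\<^sup>2 - t))"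
        using True R by (simp add: emeasure_ball emeasure_cball unit_ball_vol_2 ennreal_minus right_diff_distrib)
      finally show ?thesis using True by simp
    next
      case False
      have Z: "?h z t = 0" for z
      proof (cases "0 < t \<and> t < (cmod z)\<^sup>2 \<and> cmod z < R")
        case True
        then have "(cmod z)\<^sup>2 < R\<^sup>2" by (simp add: power_strict_mono)
        then show ?thesis using False True by auto
      qed (auto simp: indicator_def)
      have "(\<integral>\<^sup>+z. ?h z t \<partial>lborel) = (\<integral>\<^sup>+(z::complex). 0 \<partial>lborel)"
        by (rule nn_integral_cong) (rule Z)
      then show ?thesis using False by simp
    qed
  qed
  also have "\<dots> = ennreal (pi / 2 * R ^ 4)"
  proof -
    have "((\<lambda>t. pi * (R\<^sup>2 - t)) has_integral (pi * (R\<^sup>2 * R\<^sup>2 - (R\<^sup>2)\<^sup>2 / 2) - pi * (R\<^sup>2 * 0 - 0\<^sup>2 / 2))) {0..R\<^sup>2}"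
      by (rule fundamental_theorem_of_calculus)
        (auto intro!: derivative_eq_intros simp: has_real_derivative_iff_has_vector_derivative[symmetric])
    then have "((\<lambda>t. pi * (R\<^sup>2 - t)) has_integral (pi * (R\<^sup>2 * R\<^sup>2 - (R\<^sup>2)\<^sup>2 / 2) - pi * (R\<^sup>2 * 0 - 0\<^sup>2 / 2))) {0<..<R\<^sup>2}"
      by (simp add: has_integral_Icc_iff_Ioo)
    from nn_integral_has_integral_lebesgue'[OF _ this]
    show ?thesis by (simp add: power2_eq_square power4_eq_xxxx mult.assoc)
  qed
  finally show ?thesis .
qed

definition affine_pt :: "complex \<Rightarrow> complex^2" where "affine_pt \<zeta> = vector [1, \<zeta>]"

lemma affine_pt_nonzero: "affine_pt \<zeta> \<noteq> 0"
  by (simp add: affine_pt_def vec_eq_iff forall_2 vector_2)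

lemma affine_pt_expand: "affine_pt \<zeta> = axis 1 1 + axis 2 \<zeta>"
  by (simp add: affine_pt_def vec_eq_iff forall_2 vector_2 axis_def)

lemma bounded_linear_axis: "bounded_linear (axis (j::2) :: complex \<Rightarrow> complex^2)"
  unfolding linear_conv_bounded_linear[symmetric]
  by (rule linearI) (auto simp: vec_eq_iff axis_def)

lemma continuous_affine_pt: "continuous_on UNIV affine_pt"
  unfolding affine_pt_expand[abs_def]
  by (intro continuous_intros linear_continuous_on bounded_linear_axis)

text \<open>Substituting \<open>w = z \<zeta>\<close> makes the integrand depend on \<open>\<zeta>\<close> alone, and the remaining integral of the
  Jacobian \<open>\<bar>z\<bar>\<^sup>2\<close> runs over the disc of radius \<open>1 / N (1, \<zeta>)\<close>.\<close>

lemma (in circular_surface) nn_integral_enclosed: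
  fixes k :: "complex^2 \<Rightarrow> real"
  assumes k [measurable]: "k \<in> borel_measurable borel" and nonneg: "\<And>p. k p \<ge> 0"
    and hom: "\<And>c p. c \<noteq> 0 \<Longrightarrow> p$1 \<noteq> 0 \<Longrightarrow> k (c *s p) = k p"
  shows "(\<integral>\<^sup>+p. ennreal (k p) * indicator enclosed p \<partial>lborel)
    = ennreal (pi / 2) * (\<integral>\<^sup>+\<zeta>. ennreal (k (affine_pt \<zeta>) * inverse (N (affine_pt \<zeta>)) ^ 4) \<partial>lborel)"
proof -
  define pt :: "complex \<times> complex \<Rightarrow> complex^2" where "pt x = axis 1 (fst x) + axis 2 (snd x)" for x
  have "continuous_on UNIV pt"
    unfolding pt_def[abs_def]
    by (intro continuous_intros continuous_on_compose2[OF linear_continuous_on[OF bounded_linear_axis, of UNIV]]) auto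
  then have [measurable]: "pt \<in> borel_measurable borel" by (rule borel_measurable_continuous_onI)
  have pt_v: "pt (v$1, v$2) = v" for v by (simp add: pt_def vec_eq_iff forall_2 axis_def)
  define K where "K p = k p * indicator enclosed p" for p
  have [measurable]: "K \<in> borel_measurable borel"
    unfolding K_def using enclosed_borel by measurable
  have Kn: "K p \<ge> 0" for p by (simp add: K_def nonneg)
  have [measurable]: "affine_pt \<in> borel_measurable borel"
    by (rule borel_measurable_continuous_onI[OF continuous_affine_pt])
  define r where "r \<zeta> = inverse (N (affine_pt \<zeta>))" for \<zeta>
  have r: "r \<zeta> > 0" for \<zeta> using gauge_pos[OF affine_pt_nonzero] by (simp add: r_def)
  have [measurable]: "r \<in> borel_measurable borel" unfolding r_def by measurable
  have [measurable]: "(\<lambda>z. pt (z, w)) \<in> borel_measurable borel" "(\<lambda>w. pt (z, w)) \<in> borel_measurable borel" for z w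
  proof -
    have "continuous_on UNIV (\<lambda>z. pt (z, w))" "continuous_on UNIV (\<lambda>w. pt (z, w))"
      using \<open>continuous_on UNIV pt\<close> by (auto intro!: continuous_on_compose2[OF \<open>continuous_on UNIV pt\<close>] continuous_intros)
    then show "(\<lambda>z. pt (z, w)) \<in> borel_measurable borel" "(\<lambda>w. pt (z, w)) \<in> borel_measurable borel"
      by (auto intro: borel_measurable_continuous_onI)
  qed
  have inner: "(\<integral>\<^sup>+w. ennreal (K (pt (z, w))) \<partial>lborel)
     = (\<integral>\<^sup>+\<zeta>. ennreal (k (affine_pt \<zeta>)) * (ennreal ((cmod z)\<^sup>2) * indicator (ball 0 (r \<zeta>)) z) \<partial>lborel)"
    if z: "z \<noteq> 0" for z
  proof -
    have "(\<integral>\<^sup>+w. ennreal (K (pt (z, w))) \<partial>lborel) = (\<integral>\<^sup>+\<zeta>. ennreal ((cmod z)\<^sup>2 * K (pt (z, z * \<zeta>))) \<partial>lborel)"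
      by (rule nn_integral_complex_scale[OF _ _ z]) (auto simp: Kn)
    also have "\<dots> = (\<integral>\<^sup>+\<zeta>. ennreal (k (affine_pt \<zeta>)) * (ennreal ((cmod z)\<^sup>2) * indicator (ball 0 (r \<zeta>)) z) \<partial>lborel)"
    proof (rule nn_integral_cong)
      fix \<zeta>
      have e: "pt (z, z * \<zeta>) = z *s affine_pt \<zeta>"
        by (simp add: pt_def affine_pt_def vec_eq_iff forall_2 vector_2 axis_def)
      have "z *s affine_pt \<zeta> \<in> enclosed \<longleftrightarrow> z \<in> ball 0 (r \<zeta>)"
        using gauge_pos[OF affine_pt_nonzero[of \<zeta>]] by (simp add: enclosed_def gauge_scale r_def field_simps)
      moreover have "k (z *s affine_pt \<zeta>) = k (affine_pt \<zeta>)"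
        by (rule hom[OF z]) (simp add: affine_pt_def vector_2)
      ultimately show "ennreal ((cmod z)\<^sup>2 * K (pt (z, z * \<zeta>))) =
          ennreal (k (affine_pt \<zeta>)) * (ennreal ((cmod z)\<^sup>2) * indicator (ball 0 (r \<zeta>)) z)"
        unfolding K_def e by (auto simp: indicator_def ennreal_mult nonneg intro: mult.commute)
    qed
    finally show ?thesis .
  qed
  have "(\<integral>\<^sup>+p. ennreal (k p) * indicator enclosed p \<partial>lborel) = (\<integral>\<^sup>+(v::complex^2). (\<lambda>x. ennreal (K (pt x))) (v$1, v$2) \<partial>lborel)"
    by (intro nn_integral_cong) (simp add: pt_v K_def indicator_def)
  also have "\<dots> = (\<integral>\<^sup>+x. ennreal (K (pt x)) \<partial>lborel)"
    by (rule nn_integral_complex2) measurable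
  also have "\<dots> = (\<integral>\<^sup>+x. ennreal (K (pt x)) \<partial>(lborel \<Otimes>\<^sub>M lborel))"
    by (simp add: lborel_prod)
  also have "\<dots> = (\<integral>\<^sup>+z. (\<integral>\<^sup>+w. ennreal (K (pt (z, w))) \<partial>lborel) \<partial>lborel)"
  proof (rule lborel.nn_integral_fst[symmetric])
    have "(\<lambda>x. ennreal (K (pt x))) \<in> borel_measurable borel" by measurable
    then show "(\<lambda>x. ennreal (K (pt x))) \<in> borel_measurable (lborel \<Otimes>\<^sub>M lborel)"
      by (simp add: lborel_prod)
  qed
  also have "\<dots> = (\<integral>\<^sup>+z. (\<integral>\<^sup>+\<zeta>. ennreal (k (affine_pt \<zeta>)) * (ennreal ((cmod z)\<^sup>2) * indicator (ball 0 (r \<zeta>)) z) \<partial>lborel) \<partial>lborel)"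
  proof (rule nn_integral_cong_AE)
    have "AE z in lborel. z \<noteq> (0::complex)" by (rule AE_lborel_singleton)
    then show "AE z in lborel. (\<integral>\<^sup>+w. ennreal (K (pt (z, w))) \<partial>lborel)
     = (\<integral>\<^sup>+\<zeta>. ennreal (k (affine_pt \<zeta>)) * (ennreal ((cmod z)\<^sup>2) * indicator (ball 0 (r \<zeta>)) z) \<partial>lborel)"
      by eventually_elim (rule inner)
  qed
  also have "\<dots> = (\<integral>\<^sup>+\<zeta>. (\<integral>\<^sup>+z. ennreal (k (affine_pt \<zeta>)) * (ennreal ((cmod z)\<^sup>2) * indicator (ball 0 (r \<zeta>)) z) \<partial>lborel) \<partial>lborel)"
  proof (rule lborel_pair.Fubini'[symmetric])
    have "continuous_on UNIV r"
      unfolding r_def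
    proof (intro continuous_on_inverse continuous_on_compose2[OF continuous_gauge continuous_affine_pt])
      show "\<forall>\<zeta>\<in>UNIV. N (affine_pt \<zeta>) \<noteq> 0"
        using gauge_pos[OF affine_pt_nonzero] less_irrefl by metis
    qed simp
    then have "{x. cmod (fst x) < r (snd x)} \<in> sets (borel \<Otimes>\<^sub>M borel)"
      unfolding borel_prod
      by (intro borel_open open_Collect_less continuous_on_compose2[OF _ continuous_on_snd] continuous_intros) auto
    then have "(indicator {x. cmod (fst x) < r (snd x)} :: complex \<times> complex \<Rightarrow> ennreal) \<in> borel_measurable (borel \<Otimes>\<^sub>M borel)"
      by (rule borel_measurable_indicator)
    moreover have "(indicator {x. cmod (fst x) < r (snd x)} :: complex \<times> complex \<Rightarrow> ennreal)
      = (\<lambda>x. indicator (ball 0 (r (snd x))) (fst x))" by (auto simp: indicator_def fun_eq_iff)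
    ultimately have [measurable]: "(\<lambda>x::complex \<times> complex. indicator (ball 0 (r (snd x))) (fst x) :: ennreal) \<in> borel_measurable (borel \<Otimes>\<^sub>M borel)"
      by simp
    have "(\<lambda>x. ennreal (k (affine_pt (snd x))) * (ennreal ((cmod (fst x))\<^sup>2) * indicator (ball 0 (r (snd x))) (fst x)))
       \<in> borel_measurable (borel \<Otimes>\<^sub>M borel)" by measurable
    then show "(\<lambda>(z, \<zeta>). ennreal (k (affine_pt \<zeta>)) * (ennreal ((cmod z)\<^sup>2) * indicator (ball 0 (r \<zeta>)) z))
       \<in> borel_measurable (lborel \<Otimes>\<^sub>M lborel)"
      by (simp add: case_prod_beta cong: measurable_cong_sets)
  qed
  also have "\<dots> = (\<integral>\<^sup>+\<zeta>. ennreal (pi / 2) * ennreal (k (affine_pt \<zeta>) * r \<zeta> ^ 4) \<partial>lborel)"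
  proof (rule nn_integral_cong)
    fix \<zeta>
    have "(\<integral>\<^sup>+z. ennreal (k (affine_pt \<zeta>)) * (ennreal ((cmod z)\<^sup>2) * indicator (ball 0 (r \<zeta>)) z) \<partial>lborel)
      = ennreal (k (affine_pt \<zeta>)) * ennreal (pi / 2 * r \<zeta> ^ 4)"
    proof -
      have [measurable]: "ball 0 (r \<zeta>) \<in> sets borel" by (rule borel_open[OF open_ball])
      have "(\<lambda>z. ennreal ((cmod z)\<^sup>2) * indicator (ball 0 (r \<zeta>)) z) \<in> borel_measurable lborel" by measurable
      then show ?thesis by (simp add: nn_integral_cmult nn_integral_disc_norm_square[OF r])
    qed
    also have "\<dots> = ennreal (pi / 2) * ennreal (k (affine_pt \<zeta>) * r \<zeta> ^ 4)"
      using r[of \<zeta>] nonneg by (simp flip: ennreal_mult add: mult_ac)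
    finally show "(\<integral>\<^sup>+z. ennreal (k (affine_pt \<zeta>)) * (ennreal ((cmod z)\<^sup>2) * indicator (ball 0 (r \<zeta>)) z) \<partial>lborel)
      = ennreal (pi / 2) * ennreal (k (affine_pt \<zeta>) * r \<zeta> ^ 4)" .
  qed
  also have "\<dots> = ennreal (pi / 2) * (\<integral>\<^sup>+\<zeta>. ennreal (k (affine_pt \<zeta>) * r \<zeta> ^ 4) \<partial>lborel)"
    by (rule nn_integral_cmult) measurable
  finally show ?thesis by (simp add: r_def)
qed


section \<open>Volume and Fefferman measure in an affine chart\<close>

lemma Complex_expand: "Complex x y = of_real x + \<i> * of_real y"
  by (simp add: complex_eq_iff)

lemma smooth_affine_pt: "smooth_on UNIV affine_pt"
  unfolding affine_pt_expand[abs_def]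
  by (intro smooth_on_add smooth_on_const smooth_on_linear bounded_linear_axis open_UNIV)

lemma affine_pt_has_derivative: "(affine_pt has_derivative axis 2) (at \<zeta>)"
  using has_derivative_add[OF has_derivative_const[of "axis 1 1"] bounded_linear_imp_has_derivative[OF bounded_linear_axis[of 2]]]
  unfolding affine_pt_expand[abs_def] by simp

lemma integral_poisson_kernel:
  assumes R: "R > (0::real)"
  shows "((\<lambda>t. 4 * R / (R\<^sup>2 + t\<^sup>2)) has_integral 2 * pi) {-R..R}"
proof -
  have "((\<lambda>t. 4 * R / (R\<^sup>2 + t\<^sup>2)) has_integral (4 * arctan (R / R) - 4 * arctan ((-R) / R))) {-R..R}"
  proof (rule fundamental_theorem_of_calculus)
    fix t
    have "((\<lambda>t. 4 * arctan (t / R)) has_real_derivative 4 * (inverse (1 + (t / R)\<^sup>2) * (1 / R))) (at t within {-R..R})"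
      using R by (auto intro!: derivative_eq_intros)
    moreover have "4 * (inverse (1 + (t / R)\<^sup>2) * (1 / R)) = 4 * R / (R\<^sup>2 + t\<^sup>2)"
    proof -
      have "1 + (t / R)\<^sup>2 = (R\<^sup>2 + t\<^sup>2) / R\<^sup>2" using R by (simp add: power_divide field_simps)
      moreover have "R\<^sup>2 + t\<^sup>2 > 0" using R by (intro add_pos_nonneg) auto
      ultimately show ?thesis using R by (simp add: power2_eq_square field_simps)
    qed
    ultimately show "((\<lambda>t. 4 * arctan (t / R)) has_vector_derivative 4 * R / (R\<^sup>2 + t\<^sup>2)) (at t within {-R..R})"
      by (simp add: has_real_derivative_iff_has_vector_derivative)
  qed (use R in simp)
  then show ?thesis using R by (simp add: arctan_minus arctan_one)
qed

context circular_surface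
begin

definition \<psi> :: "complex \<Rightarrow> real" where "\<psi> \<zeta> = u (affine_pt \<zeta>)"

definition lap :: "complex \<Rightarrow> real" where "lap \<zeta> = hess \<psi> \<zeta> 1 1 + hess \<psi> \<zeta> \<i> \<i>"

lemma smooth_psi: "smooth_on UNIV \<psi>"
  unfolding \<psi>_def[abs_def]
  by (rule smooth_on_compose[OF smooth_affine_pt u_smooth]) (use affine_pt_nonzero in auto)

lemma Der_psi: "Der \<psi> \<zeta> v = Der u (affine_pt \<zeta>) (axis 2 v)"
proof -
  have "affine_pt \<zeta> \<in> - {0}" using affine_pt_nonzero by simp
  from Der_eq[OF has_derivative_compose[OF affine_pt_has_derivative smooth_on_has_derivative[OF u_smooth this]]]
  show ?thesis by (simp add: \<psi>_def[abs_def])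
qed

lemma hess_psi: "hess \<psi> \<zeta> v w = hess u (affine_pt \<zeta>) (axis 2 v) (axis 2 w)"
proof -
  have "affine_pt \<zeta> \<in> - {0}" using affine_pt_nonzero by simp
  from Der_eq[OF has_derivative_compose[OF affine_pt_has_derivative hess_has_derivative[OF u_smooth this]]]
  show ?thesis by (simp add: hess_def[of \<psi>] Der_psi)
qed

lemma N_affine: "N (affine_pt \<zeta>) = exp (\<psi> \<zeta>)"
  using gauge_pos[OF affine_pt_nonzero] by (simp add: \<psi>_def u_def)

lemma M_op_affine: "M_op u (affine_pt \<zeta>) = lap \<zeta> / 16"
proof -
  have p: "affine_pt \<zeta> \<in> - {0}" using affine_pt_nonzero by simp
  have "\<i> *s axis 2 1 = axis (2::2) \<i>" by (simp add: vec_eq_iff axis_def)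
  then have "levi_form u (affine_pt \<zeta>) (axis 2 1) = lap \<zeta> / 4"
    unfolding levi_form_hess[OF u_smooth p] lap_def hess_psi by simp
  then show ?thesis
    using M_op_u[OF affine_pt_nonzero, of \<zeta>] by (simp add: affine_pt_def vector_2)
qed

lemma M_op_u_scale:
  assumes c: "c \<noteq> 0" and p: "p$1 \<noteq> 0"
  shows "M_op u (c *s p) = M_op u p / cmod c ^ 4"
proof -
  have p0: "p \<noteq> 0" using p by auto
  have cp0: "c *s p \<noteq> 0" and cp1: "(c *s p)$1 \<noteq> 0" using c p p0 by auto
  let ?e = "axis 2 1 :: complex^2"
  have i: "\<i> *s (c *s ?e) = c *s (\<i> *s ?e)" by (simp add: vec_eq_iff)
  have "levi_form u (c *s p) (c *s ?e) = levi_form u p ?e"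
  proof -
    have U: "p \<in> - {0}" "c *s p \<in> - {0}" using p0 cp0 by auto
    show ?thesis
      unfolding levi_form_hess[OF u_smooth U(1)] levi_form_hess[OF u_smooth U(2)] i hess_u_scale[OF c p0] ..
  qed
  then have "(cmod c)\<^sup>2 * levi_form u (c *s p) ?e = levi_form u p ?e"
    by (simp add: levi_form_scale)
  then have l: "levi_form u (c *s p) ?e = levi_form u p ?e / (cmod c)\<^sup>2"
    using c by (simp add: field_simps)
  show ?thesis
    unfolding M_op_u[OF cp0 cp1] M_op_u[OF p0 p] l
    using c by (simp add: norm_mult power_mult_distrib power2_eq_square power4_eq_xxxx)
qed

lemma proj_eq: "proj p = complex_of_real (inverse (N p)) *s p"
  by (simp add: proj_def scaleR_eq_vector_scalar_mult)

lemma radial_density_eq: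
  assumes p: "p$1 \<noteq> 0"
  shows "radial_density p = 2 powr (4/3) * root 3 (\<bar>M_op u p\<bar> * N p ^ 4)"
proof -
  have p0: "p \<noteq> 0" using p by auto
  have Np: "N p > 0" by (rule gauge_pos[OF p0])
  have "M_op u (proj p) = M_op u p * N p ^ 4"
  proof -
    have "cmod (complex_of_real (inverse (N p))) = inverse (N p)"
      unfolding norm_of_real using Np by simp
    then show ?thesis
      unfolding proj_eq using Np by (subst M_op_u_scale[OF _ p]) (auto simp: power_inverse divide_inverse)
  qed
  then show ?thesis
    using p0 real_root_abs[of 3 "M_op u p * N p ^ 4"] by (simp add: radial_density_def fefferman_density_def abs_mult)
qed

lemma radial_density_complex_scale: "c \<noteq> 0 \<Longrightarrow> p$1 \<noteq> 0 \<Longrightarrow> radial_density (c *s p) = radial_density p"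
  by (subst (1 2) radial_density_eq) (auto simp: M_op_u_scale gauge_scale power_mult_distrib abs_divide)

lemma lap_nonzero: "lap \<zeta> \<noteq> 0"
proof -
  have "proj (affine_pt \<zeta>) \<in> Z" by (rule proj_in_Z[OF affine_pt_nonzero])
  then have "M_op u (proj (affine_pt \<zeta>)) \<noteq> 0" by (rule M_op_u_nonzero)
  then have "M_op u (affine_pt \<zeta>) \<noteq> 0"
    unfolding proj_eq using gauge_pos[OF affine_pt_nonzero, of \<zeta>]
    by (subst (asm) M_op_u_scale) (auto simp: affine_pt_def vector_2)
  then show ?thesis by (simp add: M_op_affine)
qed

text \<open>The normalisation \<open>2\<^bsup>4/3\<^esup>\<close> cancels the \<open>16\<close> that comes from \<open>M_op_affine\<close>.\<close>

lemma radial_density_affine: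
  "radial_density (affine_pt \<zeta>) * inverse (N (affine_pt \<zeta>)) ^ 4 = root 3 \<bar>lap \<zeta>\<bar> * (exp (- (4/3) * \<psi> \<zeta>))\<^sup>2"
proof -
  have r16: "2 powr (4/3) = root 3 (16::real)"
  proof -
    have "(2::real) powr 4 = 16" using powr_realpow[of 2 4] by simp
    then show ?thesis using powr_powr[of 2 4 "1/3 :: real"] by (simp add: root_powr_inverse)
  qed
  have re: "root 3 (exp (4 * x)) = exp (4/3 * x)" for x
  proof -
    have "exp (4 * x) = exp (4/3 * x) ^ 3" by (simp flip: exp_of_nat_mult)
    then show ?thesis by (simp add: real_root_power_cancel)
  qed
  have "affine_pt \<zeta> $ 1 \<noteq> 0" by (simp add: affine_pt_def vector_2)
  from radial_density_eq[OF this] have "radial_density (affine_pt \<zeta>) = root 3 (16 * (\<bar>lap \<zeta> / 16\<bar> * exp (4 * \<psi> \<zeta>)))"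
    unfolding M_op_affine N_affine r16 real_root_mult by (simp add: exp_of_nat_mult[symmetric])
  also have "\<dots> = root 3 \<bar>lap \<zeta>\<bar> * exp (4/3 * \<psi> \<zeta>)" by (simp add: real_root_mult re)
  also have "\<dots> * inverse (N (affine_pt \<zeta>)) ^ 4 = root 3 \<bar>lap \<zeta>\<bar> * (exp (4/3 * \<psi> \<zeta>) * exp (- 4 * \<psi> \<zeta>))"
    by (simp add: N_affine exp_minus[symmetric] exp_of_nat_mult[symmetric])
  also have "exp (4/3 * \<psi> \<zeta>) * exp (- 4 * \<psi> \<zeta>) = (exp (- (4/3) * \<psi> \<zeta>))\<^sup>2"
    by (simp flip: exp_add exp_of_nat_mult)
  finally show ?thesis .
qed

lemma emeasure_enclosed:
  "emeasure lborel enclosed = ennreal (pi / 2) * (\<integral>\<^sup>+\<zeta>. ennreal (exp (- 4 * \<psi> \<zeta>)) \<partial>lborel)"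
proof -
  have "emeasure lborel enclosed = (\<integral>\<^sup>+p. ennreal 1 * indicator enclosed p \<partial>lborel)"
    using enclosed_borel by simp
  also have "\<dots> = ennreal (pi / 2) * (\<integral>\<^sup>+\<zeta>. ennreal (1 * inverse (N (affine_pt \<zeta>)) ^ 4) \<partial>lborel)"
    by (rule nn_integral_enclosed) auto
  also have "(\<lambda>\<zeta>. ennreal (1 * inverse (N (affine_pt \<zeta>)) ^ 4)) = (\<lambda>\<zeta>. ennreal (exp (- 4 * \<psi> \<zeta>)))"
    by (simp add: N_affine exp_minus[symmetric] exp_of_nat_mult[symmetric])
  finally show ?thesis .
qed

lemma fefferman_measure_psi:
  "fefferman_measure Z = enn2real (4 * (ennreal (pi / 2) *
     (\<integral>\<^sup>+\<zeta>. ennreal (root 3 \<bar>lap \<zeta>\<bar> * (exp (- (4/3) * \<psi> \<zeta>))\<^sup>2) \<partial>lborel)))"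
  unfolding fefferman_measure_polar
  using nn_integral_enclosed[OF measurable_radial_density radial_density_nonneg radial_density_complex_scale]
  by (simp add: radial_density_affine)

lemma smooth_lap: "smooth_on UNIV lap"
  unfolding lap_def[abs_def] by (intro smooth_on_add smooth_on_hess smooth_psi)

text \<open>By homogeneity the derivative at \<open>(1, \<zeta>)\<close> is a derivative at \<open>(1 / \<zeta>, 1)\<close>, where \<open>u\<close> is smooth up to
  \<open>\<zeta> = \<infinity>\<close>. Its value at \<open>(0, 1)\<close> gives the gradient of \<open>ln \<bar>\<zeta>\<bar>\<close> as leading term.\<close>

lemma gradient_psi_at_infinity:
  "\<exists>C R0. C > 0 \<and> R0 > 0 \<and> (\<forall>\<zeta> v. cmod \<zeta> \<ge> R0 \<longrightarrow> cmod v = 1 \<longrightarrow> \<bar>Der \<psi> \<zeta> v - Re (v / \<zeta>)\<bar> \<le> C / (cmod \<zeta>)\<^sup>2)"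
proof -
  define q where "q \<xi> = axis 1 \<xi> + (axis 2 1 :: complex^2)" for \<xi>
  have q0: "q \<xi> \<noteq> 0" for \<xi> by (simp add: q_def vec_eq_iff forall_2 axis_def)
  define G where "G b \<xi> = Der u (q \<xi>) (axis 2 b)" for b \<xi>
  have "\<exists>d C. d > 0 \<and> C > 0 \<and> (\<forall>\<xi>. cmod \<xi> < d \<longrightarrow> \<bar>G b \<xi> - G b 0\<bar> \<le> C * cmod \<xi>)" for b
  proof -
    have "(q has_derivative axis 1) (at 0)"
      using has_derivative_add[OF bounded_linear_imp_has_derivative[OF bounded_linear_axis[of 1]] has_derivative_const[of "axis 2 1"]]
      unfolding q_def[abs_def] by simp
    from has_derivative_compose[OF this hess_has_derivative[OF u_smooth, of "q 0" "axis 2 b"]] q0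
    have D: "(G b has_derivative (\<lambda>x. hess u (q 0) (axis 2 b) (axis 1 x))) (at 0)" by (simp add: G_def[abs_def])
    let ?L = "\<lambda>x. hess u (q 0) (axis 2 b) (axis 1 x)"
    obtain K where K: "K > 0" "\<And>x. norm (?L x) \<le> norm x * K"
      using bounded_linear.pos_bounded[OF has_derivative_bounded_linear[OF D]] by blast
    obtain d where d: "d > 0" "\<And>y. norm (y - 0) < d \<Longrightarrow> norm (G b y - G b 0 - ?L (y - 0)) \<le> 1 * norm (y - 0)"
      using D unfolding has_derivative_at_alt by (metis zero_less_one)
    have "\<bar>G b \<xi> - G b 0\<bar> \<le> (K + 1) * cmod \<xi>" if "cmod \<xi> < d" for \<xi>
      using d(2)[of \<xi>] K(2)[of \<xi>] that by (simp add: algebra_simps abs_le_iff)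
    then show ?thesis using d(1) K(1) by (intro exI[of _ d] exI[of _ "K + 1"]) auto
  qed
  then obtain d C where dC: "\<And>b. d b > 0" "\<And>b. C b > 0"
      "\<And>b \<xi>. cmod \<xi> < d b \<Longrightarrow> \<bar>G b \<xi> - G b 0\<bar> \<le> C b * cmod \<xi>"
    by metis
  have G0: "G b 0 = Re b" for b
  proof -
    have "axis 2 b = b *s q 0" by (simp add: q_def vec_eq_iff forall_2 axis_def)
    then show ?thesis unfolding G_def using Der_u_self[OF q0, of 0 b] by simp
  qed
  define R0 where "R0 = 1 + 1 / d 1 + 1 / d \<i>"
  have dpos: "d 1 > 0" "d \<i> > 0" using dC by auto
  have R0: "R0 \<ge> 1" using dpos by (simp add: R0_def)
  have "\<bar>Der \<psi> \<zeta> v - Re (v / \<zeta>)\<bar> \<le> (C 1 + C \<i>) / (cmod \<zeta>)\<^sup>2" if \<zeta>: "cmod \<zeta> \<ge> R0" and v: "cmod v = 1" for \<zeta> v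
  proof -
    have z: "cmod \<zeta> > 0" "\<zeta> \<noteq> 0" using \<zeta> R0 by auto
    define \<xi> where "\<xi> = 1 / \<zeta>"
    define w where "w = v / \<zeta>"
    have small: "cmod \<xi> < d 1" "cmod \<xi> < d \<i>"
    proof -
      have "cmod \<zeta> > 1 / d 1" "cmod \<zeta> > 1 / d \<i>"
        using \<zeta> dpos unfolding R0_def by (smt (verit) zero_less_divide_1_iff)+
      then show "cmod \<xi> < d 1" "cmod \<xi> < d \<i>" using z dpos by (simp_all add: \<xi>_def norm_divide field_simps)
    qed
    have e: "affine_pt \<zeta> = \<zeta> *s q \<xi>" "axis 2 v = \<zeta> *s axis 2 w"
      using z by (simp_all add: affine_pt_expand q_def \<xi>_def w_def vec_eq_iff forall_2 axis_def)
    have "Der \<psi> \<zeta> v = Der u (q \<xi>) (axis 2 w)"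
      unfolding Der_psi e by (rule Der_u_scale[OF z(2) q0])
    also have "axis 2 w = Re w *\<^sub>R (axis 2 1 :: complex^2) + Im w *\<^sub>R axis 2 \<i>"
      by (simp add: vec_eq_iff forall_2 axis_def complex_eq_iff)
    also have "Der u (q \<xi>) \<dots> = Re w * G 1 \<xi> + Im w * G \<i> \<xi>"
      using smooth_on_linear_Der[OF u_smooth, of "q \<xi>"] q0 by (simp add: linear_add linear_scale G_def)
    finally have "Der \<psi> \<zeta> v - Re w = Re w * (G 1 \<xi> - G 1 0) + Im w * (G \<i> \<xi> - G \<i> 0)"
      by (simp add: G0 algebra_simps)
    then have "\<bar>Der \<psi> \<zeta> v - Re w\<bar> \<le> \<bar>Re w\<bar> * \<bar>G 1 \<xi> - G 1 0\<bar> + \<bar>Im w\<bar> * \<bar>G \<i> \<xi> - G \<i> 0\<bar>"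
      by (metis abs_mult abs_triangle_ineq)
    also have "\<dots> \<le> cmod w * (C 1 * cmod \<xi>) + cmod w * (C \<i> * cmod \<xi>)"
      by (intro add_mono mult_mono abs_Re_le_cmod abs_Im_le_cmod dC(3) small) auto
    also have "\<dots> = (C 1 + C \<i>) / (cmod \<zeta>)\<^sup>2"
      using z v by (simp add: \<xi>_def w_def norm_divide power2_eq_square field_simps)
    finally show ?thesis by (simp add: w_def)
  qed
  then show ?thesis
    using R0 dC(2)[of 1] dC(2)[of \<i>] by (intro exI[of _ "C 1 + C \<i>"] exI[of _ R0]) auto
qed

text \<open>The divergence theorem on a square: each second derivative is integrated first in its own
  variable.\<close>

lemma integral_lap_square:
  assumes R: "R > 0"
  shows "integral (cbox (-R, -R) (R, R)) (\<lambda>(x, y). lap (Complex x y)) =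
    integral {-R..R} (\<lambda>t. Der \<psi> (Complex R t) 1 - Der \<psi> (Complex (-R) t) 1
       + (Der \<psi> (Complex t R) \<i> - Der \<psi> (Complex t (-R)) \<i>))"
proof -
  have cC: "continuous_on UNIV (\<lambda>x::real \<times> real. Complex (fst x) (snd x))"
    by (intro continuous_intros)
  have cH: "continuous_on S (\<lambda>x. hess \<psi> (Complex (fst x) (snd x)) v w)" for v w S
    by (rule continuous_on_subset[OF continuous_on_compose2[OF smooth_on_continuous[OF smooth_on_hess[OF smooth_psi]] cC]]) auto
  have cD: "continuous_on S (\<lambda>t. Der \<psi> (Complex (f t) (g t)) v)" if "continuous_on S f" "continuous_on S g" for v S and f g :: "real \<Rightarrow> real"
    by (rule continuous_on_compose2[OF smooth_on_continuous[OF smooth_on_Der[OF smooth_psi]] continuous_on_Complex[OF that]]) auto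
  have dx: "((\<lambda>x. Der \<psi> (Complex x y) 1) has_vector_derivative hess \<psi> (Complex x y) 1 1) (at x within S)" for x y S
  proof -
    have "((\<lambda>x. Complex x y) has_vector_derivative 1) (at x)"
      unfolding has_vector_derivative_def Complex_expand by (auto intro!: derivative_eq_intros simp: scaleR_conv_of_real)
    from Der_along_curve[OF smooth_on_Der[OF smooth_psi] _ this, of 1]
    show ?thesis by (auto simp: hess_def intro: has_vector_derivative_at_within)
  qed
  have dy: "((\<lambda>y. Der \<psi> (Complex x y) \<i>) has_vector_derivative hess \<psi> (Complex x y) \<i> \<i>) (at y within S)" for x y S
  proof -
    have "((\<lambda>y. Complex x y) has_vector_derivative \<i>) (at y)"
      unfolding has_vector_derivative_def Complex_expand by (auto intro!: derivative_eq_intros simp: scaleR_conv_of_real)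
    from Der_along_curve[OF smooth_on_Der[OF smooth_psi] _ this, of \<i>]
    show ?thesis by (auto simp: hess_def intro: has_vector_derivative_at_within)
  qed
  let ?Q = "cbox (-R, -R) (R, R)"
  have "integral ?Q (\<lambda>(x, y). lap (Complex x y)) = integral ?Q (\<lambda>x. hess \<psi> (Complex (fst x) (snd x)) 1 1)
      + integral ?Q (\<lambda>x. hess \<psi> (Complex (fst x) (snd x)) \<i> \<i>)"
    unfolding lap_def case_prod_beta
    by (rule Henstock_Kurzweil_Integration.integral_add) (rule integrable_continuous[OF cH])+
  also have "integral ?Q (\<lambda>x. hess \<psi> (Complex (fst x) (snd x)) 1 1)
     = integral (cbox (-R) R) (\<lambda>x. integral (cbox (-R) R) (\<lambda>y. hess \<psi> (Complex x y) 1 1))"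
    by (subst integral_prod_continuous[OF cH]) simp
  also have "\<dots> = integral (cbox (-R) R) (\<lambda>y. integral (cbox (-R) R) (\<lambda>x. hess \<psi> (Complex x y) 1 1))"
    by (rule integral_swap_continuous) (use cH[of ?Q 1 1] in \<open>simp add: case_prod_beta\<close>)
  also have "\<dots> = integral {-R..R} (\<lambda>t. Der \<psi> (Complex R t) 1 - Der \<psi> (Complex (-R) t) 1)"
    unfolding cbox_interval
    by (intro integral_cong integral_unique fundamental_theorem_of_calculus dx) (use R in auto)
  also have "integral ?Q (\<lambda>x. hess \<psi> (Complex (fst x) (snd x)) \<i> \<i>)
     = integral (cbox (-R) R) (\<lambda>x. integral (cbox (-R) R) (\<lambda>y. hess \<psi> (Complex x y) \<i> \<i>))"
    by (subst integral_prod_continuous[OF cH]) simp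
  also have "\<dots> = integral {-R..R} (\<lambda>t. Der \<psi> (Complex t R) \<i> - Der \<psi> (Complex t (-R)) \<i>)"
    unfolding cbox_interval
    by (intro integral_cong integral_unique fundamental_theorem_of_calculus dy) (use R in auto)
  also have "integral {-R..R} (\<lambda>t. Der \<psi> (Complex R t) 1 - Der \<psi> (Complex (-R) t) 1)
     + integral {-R..R} (\<lambda>t. Der \<psi> (Complex t R) \<i> - Der \<psi> (Complex t (-R)) \<i>)
    = integral {-R..R} (\<lambda>t. Der \<psi> (Complex R t) 1 - Der \<psi> (Complex (-R) t) 1
       + (Der \<psi> (Complex t R) \<i> - Der \<psi> (Complex t (-R)) \<i>))"
    by (intro Henstock_Kurzweil_Integration.integral_add[symmetric] integrable_continuous_real continuous_intros cD)
  finally show ?thesis .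
qed

text \<open>On the four sides of the square the leading terms of the flux add up to \<open>4 R / (R\<^sup>2 + t\<^sup>2)\<close>, and the
  remainder is \<open>O(1 / R\<^sup>2)\<close> on sides of length \<open>2 R\<close>.\<close>

lemma integral_lap_tendsto:
  "(\<lambda>n. integral (cbox (- real n, - real n) (real n, real n)) (\<lambda>(x, y). lap (Complex x y))) \<longlonglongrightarrow> 2 * pi"
proof -
  obtain C R0 where C: "C > 0" "R0 > 0"
    "\<And>\<zeta> v. cmod \<zeta> \<ge> R0 \<Longrightarrow> cmod v = 1 \<Longrightarrow> \<bar>Der \<psi> \<zeta> v - Re (v / \<zeta>)\<bar> \<le> C / (cmod \<zeta>)\<^sup>2"
    using gradient_psi_at_infinity by blast
  have bound: "\<bar>integral (cbox (-R, -R) (R, R)) (\<lambda>(x, y). lap (Complex x y)) - 2 * pi\<bar> \<le> 8 * C / R"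
    if RR: "R \<ge> R0" for R
  proof -
    have R: "R > 0" using RR C by simp
    let ?f = "\<lambda>t. Der \<psi> (Complex R t) 1 - Der \<psi> (Complex (-R) t) 1
       + (Der \<psi> (Complex t R) \<i> - Der \<psi> (Complex t (-R)) \<i>)"
    have cD: "continuous_on S (\<lambda>t. Der \<psi> (Complex (f t) (g t)) v)" if "continuous_on S f" "continuous_on S g" for v S and f g :: "real \<Rightarrow> real"
      by (rule continuous_on_compose2[OF smooth_on_continuous[OF smooth_on_Der[OF smooth_psi]] continuous_on_Complex[OF that]]) auto
    have int: "?f integrable_on {-R..R}"
      by (intro integrable_continuous_real continuous_intros cD)
    have k: "(\<lambda>t. 4 * R / (R\<^sup>2 + t\<^sup>2)) integrable_on {-R..R}" "integral {-R..R} (\<lambda>t. 4 * R / (R\<^sup>2 + t\<^sup>2)) = 2 * pi"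
      using integral_poisson_kernel[OF R] by (auto simp: has_integral_iff)
    have est: "norm (?f t - 4 * R / (R\<^sup>2 + t\<^sup>2)) \<le> 4 * C / R\<^sup>2" for t
    proof -
      have m: "(cmod (Complex R t))\<^sup>2 = R\<^sup>2 + t\<^sup>2" "(cmod (Complex (-R) t))\<^sup>2 = R\<^sup>2 + t\<^sup>2"
        "(cmod (Complex t R))\<^sup>2 = R\<^sup>2 + t\<^sup>2" "(cmod (Complex t (-R)))\<^sup>2 = R\<^sup>2 + t\<^sup>2"
        by (simp_all add: cmod_power2)
      have big: "cmod z \<ge> R0" if "(cmod z)\<^sup>2 = R\<^sup>2 + t\<^sup>2" for z
      proof (rule power2_le_imp_le)
        show "R0\<^sup>2 \<le> (cmod z)\<^sup>2" unfolding that using RR C by (smt (verit) power_mono zero_le_power2)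
      qed simp
      have le: "C / (R\<^sup>2 + t\<^sup>2) \<le> C / R\<^sup>2" using C R by (intro divide_left_mono) (auto simp: add_pos_nonneg)
      have re: "Re (1 / Complex R t) = R / (R\<^sup>2 + t\<^sup>2)" "Re (1 / Complex (-R) t) = - R / (R\<^sup>2 + t\<^sup>2)"
        "Re (\<i> / Complex t R) = R / (R\<^sup>2 + t\<^sup>2)" "Re (\<i> / Complex t (-R)) = - R / (R\<^sup>2 + t\<^sup>2)"
        by (simp_all add: Re_divide add.commute)
      have "\<bar>Der \<psi> (Complex R t) 1 - R / (R\<^sup>2 + t\<^sup>2)\<bar> \<le> C / R\<^sup>2"
        "\<bar>Der \<psi> (Complex (-R) t) 1 - (- R / (R\<^sup>2 + t\<^sup>2))\<bar> \<le> C / R\<^sup>2"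
        "\<bar>Der \<psi> (Complex t R) \<i> - R / (R\<^sup>2 + t\<^sup>2)\<bar> \<le> C / R\<^sup>2"
        "\<bar>Der \<psi> (Complex t (-R)) \<i> - (- R / (R\<^sup>2 + t\<^sup>2))\<bar> \<le> C / R\<^sup>2"
        using C(3)[OF big[OF m(1)], of 1] C(3)[OF big[OF m(2)], of 1] C(3)[OF big[OF m(3)], of \<i>]
          C(3)[OF big[OF m(4)], of \<i>] le unfolding re m by simp_all
      then show ?thesis by (simp add: abs_le_iff)
    qed
    have "norm (integral {-R..R} (\<lambda>t. ?f t - 4 * R / (R\<^sup>2 + t\<^sup>2))) \<le> integral {-R..R} (\<lambda>t. 4 * C / R\<^sup>2)"
      by (rule integral_norm_bound_integral) (use int k est in \<open>auto intro: integrable_diff\<close>)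
    also have "integral {-R..R} (\<lambda>t. 4 * C / R\<^sup>2) = 8 * C / R"
      using R by (simp add: power2_eq_square field_simps)
    finally show ?thesis
      unfolding integral_lap_square[OF R] by (simp add: integral_diff[OF int k(1)] k(2))
  qed
  show ?thesis
  proof (rule Lim_null_comparison[where g = "\<lambda>n. 8 * C / real n", THEN LIM_zero_cancel])
    show "eventually (\<lambda>n. norm (integral (cbox (- real n, - real n) (real n, real n)) (\<lambda>(x, y). lap (Complex x y)) - 2 * pi)
        \<le> 8 * C / real n) sequentially"
      using eventually_ge_at_top[of "nat \<lceil>R0\<rceil>"]
      by eventually_elim (use bound in \<open>auto simp: nat_le_iff ceiling_le_iff\<close>)
    show "(\<lambda>n. 8 * C / real n) \<longlonglongrightarrow> 0"
      by (rule lim_const_over_n)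
  qed
qed

end


section \<open>The isoperimetric inequality\<close>

lemma continuous_AE_zero:
  fixes f :: "'a::euclidean_space \<Rightarrow> real"
  assumes "continuous_on UNIV f" "AE x in lborel. f x = 0"
  shows "f x = 0"
proof -
  have "open {x. f x \<noteq> 0}" by (intro open_Collect_neq assms(1) continuous_intros)
  moreover have "emeasure lborel {x. f x \<noteq> 0} = 0"
    using assms(2) \<open>open _\<close> by (subst (asm) AE_iff_measurable[OF _ refl]) auto
  then have "negligible {x. f x \<noteq> 0}"
    using \<open>open _\<close> by (simp add: negligible_iff_emeasure0 borel_open)
  ultimately have "{x. f x \<noteq> 0} = {}" using open_not_negligible by blast
  then show ?thesis by blast
qed

lemma amgm_defect: "x ^ 3 + 2 * y ^ 3 - 3 * (x * y\<^sup>2) = (x - y)\<^sup>2 * (x + 2 * y)" for x y :: real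
  by (simp add: power2_eq_square power3_eq_cube algebra_simps)

lemma square_powr_three_halves:
  assumes "q > (0::real)" shows "(q\<^sup>2) powr (3/2) = q ^ 3"
proof -
  have "(q\<^sup>2) powr (3/2) = q powr 3"
    using powr_powr[of q 2 "3/2"] powr_realpow[of q 2] assms by simp
  then show ?thesis using powr_realpow[of q 3] assms by simp
qed

context circular_surface
begin

lemma continuous_lap: "continuous_on UNIV lap"
  by (rule smooth_on_continuous[OF smooth_lap])

lemma continuous_psi: "continuous_on UNIV \<psi>"
  by (rule smooth_on_continuous[OF smooth_psi])

lemma continuous_lap_Complex: "continuous_on S (\<lambda>(x, y). lap (Complex x y))"
  unfolding case_prod_beta
  by (rule continuous_on_compose2[OF continuous_lap continuous_on_Complex]) (auto intro: continuous_intros)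

text \<open>Strong pseudoconvexity does not prescribe the side of the surface, so pointwise it only makes \<open>lap\<close> non-zero.
  By connectedness the sign is constant, and the positive total integral decides it.\<close>

lemma lap_pos: "lap \<zeta> > 0"
proof (rule ccontr)
  assume "\<not> lap \<zeta> > 0"
  have neg: "lap z < 0" for z
  proof (rule ccontr)
    assume "\<not> lap z < 0"
    have "connected (range lap)" by (rule connected_continuous_image[OF continuous_lap connected_UNIV])
    then have "0 \<in> range lap"
      using \<open>\<not> lap \<zeta> > 0\<close> \<open>\<not> lap z < 0\<close> connectedD_interval[of "range lap" "lap \<zeta>" "lap z" 0] by auto
    then show False using lap_nonzero by (metis imageE)
  qed
  have "integral (cbox (- real n, - real n) (real n, real n)) (\<lambda>(x, y). lap (Complex x y)) \<le> 0" for n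
  proof -
    have "integral (cbox (- real n, - real n) (real n, real n)) (\<lambda>(x, y). lap (Complex x y))
       \<le> integral (cbox (- real n, - real n) (real n, real n)) (\<lambda>x. 0)"
      by (rule integral_le) (auto intro: integrable_continuous[OF continuous_lap_Complex] less_imp_le[OF neg])
    then show ?thesis by simp
  qed
  then have "2 * pi \<le> 0" by (intro LIMSEQ_le_const2[OF integral_lap_tendsto]) auto
  then show False using pi_gt_zero by simp
qed

lemma nn_integral_lap: "(\<integral>\<^sup>+\<zeta>. ennreal (lap \<zeta>) \<partial>lborel) = ennreal (2 * pi)"
proof -
  let ?L = "\<lambda>x::real \<times> real. lap (Complex (fst x) (snd x))"
  let ?Q = "\<lambda>n. cbox (- real n, - real n) (real n, real n)"
  have cL: "continuous_on S ?L" for S using continuous_lap_Complex[of S] by (simp add: case_prod_beta)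
  have [measurable]: "?L \<in> borel_measurable borel" by (rule borel_measurable_continuous_onI[OF cL])
  have [measurable]: "?Q n \<in> sets borel" for n by simp
  have 1: "(\<integral>\<^sup>+x. ennreal (?L x) * indicator (?Q n) x \<partial>lborel) = ennreal (integral (?Q n) ?L)" for n
    by (rule nn_integral_has_integral_lebesgue'[OF _ integrable_integral[OF integrable_continuous[OF cL]]])
      (simp add: less_imp_le lap_pos)
  have "(\<lambda>n. \<integral>\<^sup>+x. ennreal (?L x) * indicator (?Q n) x \<partial>lborel) \<longlonglongrightarrow> (\<integral>\<^sup>+x. ennreal (?L x) \<partial>lborel)"
  proof (rule nn_integral_LIMSEQ)
    show "incseq (\<lambda>n x. ennreal (?L x) * indicator (?Q n) x)"
    proof (rule incseq_SucI, rule le_funI)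
      fix n x
      have "?Q n \<subseteq> ?Q (Suc n)" unfolding cbox_Pair_eq by (auto simp: cbox_interval)
      then show "ennreal (?L x) * indicator (?Q n) x \<le> ennreal (?L x) * indicator (?Q (Suc n)) x"
        by (intro mult_left_mono) (auto simp: indicator_def)
    qed
    show "(\<lambda>n. ennreal (?L x) * indicator (?Q n) x) \<longlonglongrightarrow> ennreal (?L x)" for x
    proof (rule tendsto_eventually)
      obtain m where m: "\<bar>fst x\<bar> + \<bar>snd x\<bar> < real m" using reals_Archimedean2 by blast
      show "\<forall>\<^sub>F n in sequentially. ennreal (?L x) * indicator (?Q n) x = ennreal (?L x)"
        using eventually_ge_at_top[of m]
      proof eventually_elim
        case (elim n)
        then have "real m \<le> real n" by simp
        then have "x \<in> ?Q n" using m unfolding cbox_Pair_eq by (cases x) (auto simp: cbox_interval)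
        then show ?case by simp
      qed
    qed
  qed measurable
  moreover have "(\<lambda>n. ennreal (integral (?Q n) ?L)) \<longlonglongrightarrow> ennreal (2 * pi)"
    by (rule tendsto_ennrealI[OF integral_lap_tendsto[unfolded case_prod_unfold]])
  ultimately have "(\<integral>\<^sup>+x. ennreal (?L x) \<partial>lborel) = ennreal (2 * pi)"
    unfolding 1 by (rule LIMSEQ_unique)
  moreover have "(\<integral>\<^sup>+\<zeta>. ennreal (lap \<zeta>) \<partial>lborel) = (\<integral>\<^sup>+x. ennreal (?L x) \<partial>lborel)"
    using nn_integral_complex_real2[of "\<lambda>x. ennreal (?L x)"] by simp
  ultimately show ?thesis by simp
qed

definition weight_mass :: real where
  "weight_mass = enn2real (\<integral>\<^sup>+\<zeta>. ennreal (exp (- 4 * \<psi> \<zeta>)) \<partial>lborel)"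

lemma weight_mass:
  "(\<integral>\<^sup>+\<zeta>. ennreal (exp (- 4 * \<psi> \<zeta>)) \<partial>lborel) = ennreal weight_mass" "weight_mass > 0"
  "enclosed_volume Z = pi / 2 * weight_mass"
proof -
  let ?I = "\<integral>\<^sup>+\<zeta>. ennreal (exp (- 4 * \<psi> \<zeta>)) \<partial>lborel"
  have fin: "emeasure lborel enclosed < \<infinity>"
    using enclosed_props(3) emeasure_bounded_finite by blast
  have "?I \<noteq> \<infinity>"
  proof
    assume "?I = \<infinity>"
    then have "emeasure lborel enclosed = \<infinity>" unfolding emeasure_enclosed
      by (simp add: ennreal_mult_top)
    then show False using fin by simp
  qed
  then show eq: "?I = ennreal weight_mass" by (simp add: weight_mass_def less_top)
  have nn: "weight_mass \<ge> 0" by (simp add: weight_mass_def)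
  have "emeasure lborel enclosed = ennreal (pi / 2 * weight_mass)"
    unfolding emeasure_enclosed eq by (rule ennreal_mult''[OF nn, symmetric])
  then show "enclosed_volume Z = pi / 2 * weight_mass"
    using nn by (simp add: enclosed_volume_def enclosed_domain_eq measure_def)
  have "weight_mass \<noteq> 0"
  proof
    assume "weight_mass = 0"
    then have "?I = 0" using eq by simp
    moreover have [measurable]: "\<psi> \<in> borel_measurable borel"
      by (rule borel_measurable_continuous_onI[OF continuous_psi])
    ultimately have "AE \<zeta> in lborel. exp (- 4 * \<psi> \<zeta>) = 0"
      by (subst (asm) nn_integral_0_iff_AE) auto
    then have "exp (- 4 * \<psi> 0) = 0"
      by (rule continuous_AE_zero[rotated]) (intro continuous_intros continuous_psi)
    then show False by simp
  qed
  then show "weight_mass > 0" using nn by simp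
qed

text \<open>With the densities of \<open>lap\<close> and \<open>exp (-4 \<psi>)\<close> normalised to total mass one and written as
  cubes, Hoelder's inequality becomes an integrated arithmetic-geometric mean inequality, whose
  defect is a continuous non-negative function.\<close>

lemma isoperimetric_quotient_eq:
  obtains J where "0 \<le> J" "J \<le> 1" "isoperimetric_quotient Z = 8 * pi * J powr (3/2)"
    "J = 1 \<longleftrightarrow> (\<forall>\<zeta>. lap \<zeta> * weight_mass = 2 * pi * exp (- 4 * \<psi> \<zeta>))"
proof -
  let ?B = weight_mass
  (* s ^ 3 and t ^ 3 are the total masses of the two densities, so the cubes of x and y have integral one. *)
  define s where "s = root 3 (2 * pi)"
  define t where "t = root 3 ?B"
  have s: "s > 0" "s ^ 3 = 2 * pi" by (simp_all add: s_def)
  have t: "t > 0" "t ^ 3 = ?B" using weight_mass(2) by (simp_all add: t_def)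
  define x where "x \<zeta> = root 3 (lap \<zeta>) / s" for \<zeta>
  define y where "y \<zeta> = exp (- (4/3) * \<psi> \<zeta>) / t" for \<zeta>
  have x: "x \<zeta> > 0" "x \<zeta> ^ 3 = lap \<zeta> / (2 * pi)" for \<zeta>
    using lap_pos[of \<zeta>] s by (simp_all add: x_def power_divide)
  have y: "y \<zeta> > 0" "y \<zeta> ^ 3 = exp (- 4 * \<psi> \<zeta>) / ?B" for \<zeta>
    using t by (simp_all add: y_def power_divide exp_of_nat_mult[symmetric])
  have cx: "continuous_on UNIV x" and cy: "continuous_on UNIV y"
    unfolding x_def y_def using s t by (intro continuous_intros continuous_lap continuous_psi; simp)+
  have [measurable]: "x \<in> borel_measurable borel" "y \<in> borel_measurable borel"
    by (rule borel_measurable_continuous_onI[OF cx], rule borel_measurable_continuous_onI[OF cy])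
  have [measurable]: "lap \<in> borel_measurable borel" "\<psi> \<in> borel_measurable borel"
    by (rule borel_measurable_continuous_onI[OF continuous_lap], rule borel_measurable_continuous_onI[OF continuous_psi])
  have ix: "(\<integral>\<^sup>+\<zeta>. ennreal (x \<zeta> ^ 3) \<partial>lborel) = 1"
  proof -
    have "(\<integral>\<^sup>+\<zeta>. ennreal (x \<zeta> ^ 3) \<partial>lborel) = (\<integral>\<^sup>+\<zeta>. ennreal (1 / (2 * pi)) * ennreal (lap \<zeta>) \<partial>lborel)"
      using lap_pos by (intro nn_integral_cong) (simp add: x(2) ennreal_mult'[symmetric] less_imp_le)
    also have "\<dots> = ennreal (1 / (2 * pi) * (2 * pi))"
      by (subst nn_integral_cmult) (simp_all add: nn_integral_lap ennreal_mult''[symmetric])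
    finally show ?thesis by simp
  qed
  have iy: "(\<integral>\<^sup>+\<zeta>. ennreal (y \<zeta> ^ 3) \<partial>lborel) = 1"
  proof -
    have "(\<integral>\<^sup>+\<zeta>. ennreal (y \<zeta> ^ 3) \<partial>lborel) = (\<integral>\<^sup>+\<zeta>. ennreal (1 / ?B) * ennreal (exp (- 4 * \<psi> \<zeta>)) \<partial>lborel)"
      using weight_mass(2) by (intro nn_integral_cong) (simp add: y(2) ennreal_mult'[symmetric])
    also have "\<dots> = ennreal (1 / ?B * ?B)"
      using weight_mass by (subst nn_integral_cmult) (simp_all add: ennreal_mult''[symmetric])
    finally show ?thesis using weight_mass(2) by simp
  qed
  define d where "d \<zeta> = (x \<zeta> - y \<zeta>)\<^sup>2 * (x \<zeta> + 2 * y \<zeta>)" for \<zeta>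
  have d: "d \<zeta> \<ge> 0" for \<zeta> using x(1)[of \<zeta>] y(1)[of \<zeta>] by (simp add: d_def)
  have cd: "continuous_on UNIV d" unfolding d_def by (intro continuous_intros cx cy)
  have [measurable]: "d \<in> borel_measurable borel" by (rule borel_measurable_continuous_onI[OF cd])
  define I where "I = (\<integral>\<^sup>+\<zeta>. ennreal (x \<zeta> * (y \<zeta>)\<^sup>2) \<partial>lborel)"
  have sum: "3 * I + (\<integral>\<^sup>+\<zeta>. ennreal (d \<zeta>) \<partial>lborel) = 3"
  proof -
    have "3 * I + (\<integral>\<^sup>+\<zeta>. ennreal (d \<zeta>) \<partial>lborel) = (\<integral>\<^sup>+\<zeta>. 3 * ennreal (x \<zeta> * (y \<zeta>)\<^sup>2) + ennreal (d \<zeta>) \<partial>lborel)"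
      unfolding I_def by (simp add: nn_integral_add nn_integral_cmult)
    also have "\<dots> = (\<integral>\<^sup>+\<zeta>. ennreal (x \<zeta> ^ 3) + 2 * ennreal (y \<zeta> ^ 3) \<partial>lborel)"
    proof (rule nn_integral_cong)
      fix \<zeta>
      have "3 * (x \<zeta> * (y \<zeta>)\<^sup>2) + d \<zeta> = x \<zeta> ^ 3 + 2 * y \<zeta> ^ 3"
        unfolding d_def amgm_defect[symmetric] by simp
      moreover have "3 * ennreal (x \<zeta> * (y \<zeta>)\<^sup>2) + ennreal (d \<zeta>) = ennreal (3 * (x \<zeta> * (y \<zeta>)\<^sup>2) + d \<zeta>)"
        using x(1)[of \<zeta>] d[of \<zeta>] by (simp add: ennreal_mult')
      moreover have "ennreal (x \<zeta> ^ 3) + 2 * ennreal (y \<zeta> ^ 3) = ennreal (x \<zeta> ^ 3 + 2 * y \<zeta> ^ 3)"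
        using less_imp_le[OF x(1)[of \<zeta>]] less_imp_le[OF y(1)[of \<zeta>]] by (simp add: ennreal_mult')
      ultimately show "3 * ennreal (x \<zeta> * (y \<zeta>)\<^sup>2) + ennreal (d \<zeta>) = ennreal (x \<zeta> ^ 3) + 2 * ennreal (y \<zeta> ^ 3)"
        by simp
    qed
    also have "\<dots> = 3" by (simp add: nn_integral_add nn_integral_cmult ix iy)
    finally show ?thesis .
  qed
  have I3: "3 * I \<le> 3" using sum by (metis le_iff_add)
  then have "I \<noteq> \<infinity>" by (auto simp: ennreal_mult_eq_top_iff top_unique)
  then obtain J where J: "I = ennreal J" "J \<ge> 0" by (cases I) auto
  have "ennreal (3 * J) \<le> ennreal 3" using I3 J by (simp add: ennreal_mult')
  then have J1: "J \<le> 1" by (subst (asm) ennreal_le_iff) simp_all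
  have iff: "J = 1 \<longleftrightarrow> (\<forall>\<zeta>. lap \<zeta> * ?B = 2 * pi * exp (- 4 * \<psi> \<zeta>))"
  proof -
    have pt: "x \<zeta> = y \<zeta> \<longleftrightarrow> lap \<zeta> * ?B = 2 * pi * exp (- 4 * \<psi> \<zeta>)" for \<zeta>
    proof -
      have "x \<zeta> = y \<zeta> \<longleftrightarrow> x \<zeta> ^ 3 = y \<zeta> ^ 3"
        using x(1)[of \<zeta>] y(1)[of \<zeta>] by (auto dest: power_eq_imp_eq_base[of _ 3] simp: less_imp_le)
      then show ?thesis using weight_mass(2) by (simp add: x(2) y(2) field_simps)
    qed
    have "J = 1 \<longleftrightarrow> (\<integral>\<^sup>+\<zeta>. ennreal (d \<zeta>) \<partial>lborel) = 0"
    proof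
      assume "J = 1"
      then have "3 + (\<integral>\<^sup>+\<zeta>. ennreal (d \<zeta>) \<partial>lborel) = 3 + 0" using sum J by simp
      then show "(\<integral>\<^sup>+\<zeta>. ennreal (d \<zeta>) \<partial>lborel) = 0"
        by (subst (asm) ennreal_add_left_cancel) simp
    next
      assume "(\<integral>\<^sup>+\<zeta>. ennreal (d \<zeta>) \<partial>lborel) = 0"
      then have "ennreal (3 * J) = ennreal 3" using sum J by (simp add: ennreal_mult')
      then show "J = 1" using J(2) by (subst (asm) ennreal_inj) auto
    qed
    also have "\<dots> \<longleftrightarrow> (\<forall>\<zeta>. d \<zeta> = 0)"
    proof
      assume "(\<integral>\<^sup>+\<zeta>. ennreal (d \<zeta>) \<partial>lborel) = 0"
      then have "AE \<zeta> in lborel. d \<zeta> = 0"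
      proof -
        have "ennreal (d \<zeta>) = 0 \<longleftrightarrow> d \<zeta> = 0" for \<zeta>
          using d[of \<zeta>] by (auto simp: ennreal_eq_0_iff)
        then show ?thesis
          using \<open>(\<integral>\<^sup>+\<zeta>. ennreal (d \<zeta>) \<partial>lborel) = 0\<close> by (subst (asm) nn_integral_0_iff_AE) (simp_all del: ennreal_eq_0_iff)
      qed
      then show "\<forall>\<zeta>. d \<zeta> = 0" using continuous_AE_zero[OF cd] by blast
    qed simp
    also have "\<dots> \<longleftrightarrow> (\<forall>\<zeta>. x \<zeta> = y \<zeta>)"
    proof -
      have "d \<zeta> = 0 \<longleftrightarrow> x \<zeta> = y \<zeta>" for \<zeta>
        using x(1)[of \<zeta>] y(1)[of \<zeta>] by (auto simp: d_def)
      then show ?thesis by simp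
    qed
    finally show ?thesis by (simp only: pt)
  qed
  have F: "fefferman_measure Z = (s\<^sup>2 * t)\<^sup>2 * J"
  proof -
    have "(\<integral>\<^sup>+\<zeta>. ennreal (root 3 \<bar>lap \<zeta>\<bar> * (exp (- (4/3) * \<psi> \<zeta>))\<^sup>2) \<partial>lborel)
       = (\<integral>\<^sup>+\<zeta>. ennreal (s * t\<^sup>2) * ennreal (x \<zeta> * (y \<zeta>)\<^sup>2) \<partial>lborel)"
    proof (rule nn_integral_cong)
      fix \<zeta>
      have e: "root 3 \<bar>lap \<zeta>\<bar> * (exp (- (4/3) * \<psi> \<zeta>))\<^sup>2 = (s * t\<^sup>2) * (x \<zeta> * (y \<zeta>)\<^sup>2)"
        using lap_pos[of \<zeta>] s(1) t(1) by (simp add: x_def y_def power_divide)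
      show "ennreal (root 3 \<bar>lap \<zeta>\<bar> * (exp (- (4/3) * \<psi> \<zeta>))\<^sup>2) = ennreal (s * t\<^sup>2) * ennreal (x \<zeta> * (y \<zeta>)\<^sup>2)"
        unfolding e by (rule ennreal_mult') (use s(1) t(1) in simp)
    qed
    also have "\<dots> = ennreal (s * t\<^sup>2) * I"
      unfolding I_def by (rule nn_integral_cmult) measurable
    also have "\<dots> = ennreal (s * t\<^sup>2 * J)" using J s t by (simp add: ennreal_mult'')
    finally have "fefferman_measure Z = enn2real (4 * (ennreal (pi / 2) * ennreal (s * t\<^sup>2 * J)))"
      unfolding fefferman_measure_psi by simp
    also have "4 * (ennreal (pi / 2) * ennreal (s * t\<^sup>2 * J)) = ennreal (4 * (pi / 2 * (s * t\<^sup>2 * J)))"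
      by (subst ennreal_mult', simp, subst ennreal_mult', simp_all)
    also have "4 * (pi / 2 * (s * t\<^sup>2 * J)) = (s\<^sup>2 * t)\<^sup>2 * J"
    proof -
      have "4 * (pi / 2 * (s * t\<^sup>2 * J)) = s ^ 3 * (s * t\<^sup>2 * J)" using s by simp
      then show ?thesis by (simp add: power2_eq_square power3_eq_cube)
    qed
    finally show ?thesis using J(2) by simp
  qed
  have "isoperimetric_quotient Z = 8 * pi * J powr (3/2)"
  proof -
    have "((s\<^sup>2 * t)\<^sup>2) powr (3/2) = (s\<^sup>2 * t) ^ 3"
      using s t by (intro square_powr_three_halves) simp
    also have "\<dots> = (2 * pi)\<^sup>2 * ?B"
      unfolding s(2)[symmetric] t(2)[symmetric] by (simp add: power2_eq_square power3_eq_cube)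
    finally have "fefferman_measure Z powr (3/2) = (2 * pi)\<^sup>2 * ?B * J powr (3/2)"
      unfolding F using s t J by (simp add: powr_mult)
    then show ?thesis
      unfolding isoperimetric_quotient_def weight_mass(3) using weight_mass(2)
      by (simp add: power2_eq_square field_simps)
  qed
  from that[OF J(2) J1 this iff] show thesis .
qed

lemma isoperimetric_inequality: "isoperimetric_quotient Z \<le> 8 * pi"
proof -
  obtain J where "0 \<le> J" "J \<le> 1" "isoperimetric_quotient Z = 8 * pi * J powr (3/2)"
    using isoperimetric_quotient_eq by blast
  then show ?thesis using powr_mono2[of "3/2" J 1] by simp
qed

lemma equality_iff_liouville:
  "isoperimetric_quotient Z = 8 * pi \<longleftrightarrow> (\<exists>c. \<forall>\<zeta>. lap \<zeta> = c * exp (- 4 * \<psi> \<zeta>))"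
proof -
  obtain J where J: "0 \<le> J" "J \<le> 1" "isoperimetric_quotient Z = 8 * pi * J powr (3/2)"
    "J = 1 \<longleftrightarrow> (\<forall>\<zeta>. lap \<zeta> * weight_mass = 2 * pi * exp (- 4 * \<psi> \<zeta>))"
    using isoperimetric_quotient_eq by blast
  have "isoperimetric_quotient Z = 8 * pi \<longleftrightarrow> J powr (3/2) = 1" by (simp add: J(3))
  also have "\<dots> \<longleftrightarrow> J = 1"
    using J(1,2) powr_less_one[of J "3/2"] by (cases "J = 0"; cases "J = 1") auto
  also have "\<dots> \<longleftrightarrow> (\<exists>c. \<forall>\<zeta>. lap \<zeta> = c * exp (- 4 * \<psi> \<zeta>))"
    unfolding J(4)
  proof
    assume "\<forall>\<zeta>. lap \<zeta> * weight_mass = 2 * pi * exp (- 4 * \<psi> \<zeta>)"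
    then have "\<forall>\<zeta>. lap \<zeta> = 2 * pi / weight_mass * exp (- 4 * \<psi> \<zeta>)"
      using weight_mass(2) by (simp add: field_simps)
    then show "\<exists>c. \<forall>\<zeta>. lap \<zeta> = c * exp (- 4 * \<psi> \<zeta>)" by blast
  next
    assume "\<exists>c. \<forall>\<zeta>. lap \<zeta> = c * exp (- 4 * \<psi> \<zeta>)"
    then obtain c where c: "\<And>\<zeta>. lap \<zeta> = c * exp (- 4 * \<psi> \<zeta>)" by blast
    have c0: "c > 0" using lap_pos[of 0] c[of 0] by (simp add: zero_less_mult_iff)
    have [measurable]: "\<psi> \<in> borel_measurable borel"
      by (rule borel_measurable_continuous_onI[OF continuous_psi])
    have "ennreal (2 * pi) = (\<integral>\<^sup>+\<zeta>. ennreal c * ennreal (exp (- 4 * \<psi> \<zeta>)) \<partial>lborel)"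
      unfolding nn_integral_lap[symmetric] using c0 by (intro nn_integral_cong) (simp add: c ennreal_mult')
    also have "\<dots> = ennreal c * (\<integral>\<^sup>+\<zeta>. ennreal (exp (- 4 * \<psi> \<zeta>)) \<partial>lborel)"
      by (rule nn_integral_cmult) measurable
    also have "\<dots> = ennreal (c * weight_mass)"
      unfolding weight_mass(1) using weight_mass(2) by (intro ennreal_mult''[symmetric]) simp
    finally have "2 * pi = c * weight_mass"
      using c0 weight_mass(2) by (subst (asm) ennreal_inj) auto
    then show "\<forall>\<zeta>. lap \<zeta> * weight_mass = 2 * pi * exp (- 4 * \<psi> \<zeta>)" by (simp add: c)
  qed
  finally show ?thesis .
qed

end


section \<open>The case of equality\<close>

lemma Der_zero_imp_const:
  fixes f :: "complex \<Rightarrow> real"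
  assumes f: "smooth_on UNIV f" and "\<And>\<zeta>. Der f \<zeta> 1 = 0" "\<And>\<zeta>. Der f \<zeta> \<i> = 0"
  shows "\<exists>c. \<forall>\<zeta>. f \<zeta> = c"
proof -
  have "Der f \<zeta> v = 0" for \<zeta> v
    using Der_basis_expand[OF smooth_on_linear_Der[OF f UNIV_I], of \<zeta> v] assms(2,3)
    by (simp add: Basis_complex_def)
  then have "(f has_derivative (\<lambda>v. 0)) (at \<zeta>)" for \<zeta>
    using smooth_on_has_derivative[OF f UNIV_I, of \<zeta>] by (metis (no_types, lifting) ext)
  then show ?thesis
    using has_derivative_zero_constant[of UNIV f] by auto
qed

lemma bilinear_complex_bound:
  fixes b :: "complex \<Rightarrow> complex \<Rightarrow> real"
  assumes b: "bilinear b" and M: "\<And>e e'. e \<in> {1, \<i>} \<Longrightarrow> e' \<in> {1, \<i>} \<Longrightarrow> \<bar>b e e'\<bar> \<le> M"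
  shows "\<bar>b v w\<bar> \<le> 4 * M * (cmod v * cmod w)"
proof -
  have M0: "M \<ge> 0" using M[of 1 1] by auto
  have "b v w = b (Re v *\<^sub>R 1 + Im v *\<^sub>R \<i>) (Re w *\<^sub>R 1 + Im w *\<^sub>R \<i>)"
    by (rule arg_cong2[of _ _ _ _ b]) (simp_all add: complex_eq_iff)
  also have "\<dots> = Re v * Re w * b 1 1 + Re v * Im w * b 1 \<i> + Im v * Re w * b \<i> 1 + Im v * Im w * b \<i> \<i>"
    using b by (simp add: bilinear_ladd bilinear_radd bilinear_lmul bilinear_rmul algebra_simps)
  finally have e: "b v w = Re v * Re w * b 1 1 + Re v * Im w * b 1 \<i> + Im v * Re w * b \<i> 1 + Im v * Im w * b \<i> \<i>" .
  have t: "\<bar>p * q * r\<bar> \<le> cmod v * cmod w * M" if "\<bar>p\<bar> \<le> cmod v" "\<bar>q\<bar> \<le> cmod w" "\<bar>r\<bar> \<le> M" for p q r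
    unfolding abs_mult by (intro mult_mono that) auto
  have "\<bar>Re v * Re w * b 1 1\<bar> \<le> cmod v * cmod w * M" "\<bar>Re v * Im w * b 1 \<i>\<bar> \<le> cmod v * cmod w * M"
    "\<bar>Im v * Re w * b \<i> 1\<bar> \<le> cmod v * cmod w * M" "\<bar>Im v * Im w * b \<i> \<i>\<bar> \<le> cmod v * cmod w * M"
    by (intro t abs_Re_le_cmod abs_Im_le_cmod M; simp)+
  then show ?thesis unfolding e by (simp add: algebra_simps)
qed

context circular_surface
begin

definition E :: "complex \<Rightarrow> real" where "E \<zeta> = (N (affine_pt \<zeta>))\<^sup>2"

lemma E_exp: "E \<zeta> = exp (2 * \<psi> \<zeta>)"
  by (simp add: E_def N_affine exp_of_nat_mult[symmetric])

lemma E_pos: "E \<zeta> > 0"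
  by (simp add: E_exp)

lemma smooth_N2: "smooth_on (- {0}) (\<lambda>p. (N p)\<^sup>2)"
  by (intro smooth_on_power gauge_smooth)

lemma smooth_E: "smooth_on UNIV E"
  unfolding E_def[abs_def]
  by (rule smooth_on_compose[OF smooth_affine_pt smooth_N2]) (use affine_pt_nonzero in auto)

lemma Der_E: "Der E \<zeta> v = 2 * E \<zeta> * Der \<psi> \<zeta> v"
proof -
  have "((\<lambda>z. exp (2 * \<psi> z)) has_derivative (\<lambda>v. (2 * Der \<psi> \<zeta> v) * exp (2 * \<psi> \<zeta>))) (at \<zeta>)"
    using smooth_on_has_derivative[OF smooth_psi UNIV_I, of \<zeta>] by (auto intro!: derivative_eq_intros)
  then have "(E has_derivative (\<lambda>v. (2 * Der \<psi> \<zeta> v) * E \<zeta>)) (at \<zeta>)"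
    by (simp add: E_exp[abs_def])
  from Der_eq[OF this] show ?thesis by simp
qed

lemma hess_E: "hess E \<zeta> v w = 2 * E \<zeta> * hess \<psi> \<zeta> v w + 4 * E \<zeta> * Der \<psi> \<zeta> v * Der \<psi> \<zeta> w"
proof -
  have "((\<lambda>z. (2 * E z) * Der \<psi> z v) has_derivative (\<lambda>w. (2 * E \<zeta>) * hess \<psi> \<zeta> v w + (2 * Der E \<zeta> w) * Der \<psi> \<zeta> v)) (at \<zeta>)"
    by (intro has_derivative_mult has_derivative_mult_right hess_has_derivative[OF smooth_psi UNIV_I]
        smooth_on_has_derivative[OF smooth_E UNIV_I])
  from Der_eq[OF this] show ?thesis
    unfolding hess_def[of E] Der_E[abs_def] by (simp add: Der_E)
qed

text \<open>This is \<open>E\<^sup>2 \<Delta> ln E\<close>, so Liouville's equation says that the left-hand side is constant.\<close>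

lemma liouville_E:
  "E \<zeta> * (hess E \<zeta> 1 1 + hess E \<zeta> \<i> \<i>) - (Der E \<zeta> 1)\<^sup>2 - (Der E \<zeta> \<i>)\<^sup>2 = 2 * (lap \<zeta> * exp (4 * \<psi> \<zeta>))"
proof -
  have "exp (4 * \<psi> \<zeta>) = (E \<zeta>)\<^sup>2" by (simp add: E_exp exp_of_nat_mult[symmetric])
  then show ?thesis unfolding hess_E Der_E lap_def by (simp add: power2_eq_square algebra_simps)
qed

lemma liouville_iff_E:
  "(\<exists>c. \<forall>\<zeta>. lap \<zeta> = c * exp (- 4 * \<psi> \<zeta>)) \<longleftrightarrow>
   (\<exists>c. \<forall>\<zeta>. E \<zeta> * (hess E \<zeta> 1 1 + hess E \<zeta> \<i> \<i>) - (Der E \<zeta> 1)\<^sup>2 - (Der E \<zeta> \<i>)\<^sup>2 = c)"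
proof -
  have *: "lap \<zeta> = c * exp (- 4 * \<psi> \<zeta>) \<longleftrightarrow> 2 * (lap \<zeta> * exp (4 * \<psi> \<zeta>)) = 2 * c" for c \<zeta>
    by (auto simp: exp_minus field_simps)
  show ?thesis
    unfolding liouville_E *
  proof
    assume "\<exists>c. \<forall>\<zeta>. 2 * (lap \<zeta> * exp (4 * \<psi> \<zeta>)) = c"
    then obtain c where "\<forall>\<zeta>. 2 * (lap \<zeta> * exp (4 * \<psi> \<zeta>)) = c" by blast
    then show "\<exists>c. \<forall>\<zeta>. 2 * (lap \<zeta> * exp (4 * \<psi> \<zeta>)) = 2 * c" by (intro exI[of _ "c / 2"]) simp
  qed blast
qed

lemma hess_N2_scale:
  assumes "c \<noteq> 0" "p \<noteq> 0"
  shows "hess (\<lambda>p. (N p)\<^sup>2) (c *s p) (c *s v) (c *s w) = (cmod c)\<^sup>2 * hess (\<lambda>p. (N p)\<^sup>2) p v w"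
proof -
  let ?F = "\<lambda>p. (N p)\<^sup>2"
  have cd: "((\<lambda>v. c *s v) has_derivative (\<lambda>v. c *s v)) (at p)" for p :: "complex^2"
    by (rule bounded_linear_imp_has_derivative[OF bounded_linear_vector_scalar_mult_right])
  have D: "Der ?F (c *s p) (c *s v) = (cmod c)\<^sup>2 * Der ?F p v" if "p \<noteq> 0" for p v
  proof -
    have cp: "c *s p \<in> - {0}" and p: "p \<in> - {0}" using assms(1) that by auto
    from has_derivative_compose[OF cd smooth_on_has_derivative[OF smooth_N2 cp]]
    have 1: "((\<lambda>x. (N (c *s x))\<^sup>2) has_derivative (\<lambda>v. Der ?F (c *s p) (c *s v))) (at p)" .
    have "((\<lambda>x. (cmod c)\<^sup>2 * (N x)\<^sup>2) has_derivative (\<lambda>v. (cmod c)\<^sup>2 * Der ?F p v)) (at p)"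
      by (rule has_derivative_mult_right[OF smooth_on_has_derivative[OF smooth_N2 p]])
    then have 2: "((\<lambda>x. (N (c *s x))\<^sup>2) has_derivative (\<lambda>v. (cmod c)\<^sup>2 * Der ?F p v)) (at p)"
      by (simp add: gauge_scale power_mult_distrib)
    from has_derivative_unique[OF 1 2] show ?thesis by (rule fun_cong)
  qed
  have cp: "c *s p \<in> - {0}" and p: "p \<in> - {0}" using assms by auto
  from has_derivative_compose[OF cd hess_has_derivative[OF smooth_N2 cp]]
  have 1: "((\<lambda>x. Der ?F (c *s x) (c *s v)) has_derivative (\<lambda>w. hess ?F (c *s p) (c *s v) (c *s w))) (at p)" .
  have "((\<lambda>x. (cmod c)\<^sup>2 * Der ?F x v) has_derivative (\<lambda>w. (cmod c)\<^sup>2 * hess ?F p v w)) (at p)"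
    by (rule has_derivative_mult_right[OF hess_has_derivative[OF smooth_N2 p]])
  then have 2: "((\<lambda>x. Der ?F (c *s x) (c *s v)) has_derivative (\<lambda>w. (cmod c)\<^sup>2 * hess ?F p v w)) (at p)"
    by (rule has_derivative_transform_within_open[of _ _ _ _ "- {0}"]) (use assms in \<open>auto simp: D\<close>)
  from has_derivative_unique[OF 1 2] show ?thesis by (rule fun_cong)
qed

text \<open>The second derivatives of \<open>N\<^sup>2\<close> are homogeneous of degree zero, so near infinity they are values near
  \<open>(0, 1)\<close>.\<close>

lemma hess_E_bounded:
  "\<exists>M R0. R0 > 0 \<and> (\<forall>\<zeta> v w. cmod \<zeta> \<ge> R0 \<longrightarrow> cmod v = 1 \<longrightarrow> cmod w = 1 \<longrightarrow> \<bar>hess E \<zeta> v w\<bar> \<le> M)"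
proof -
  let ?F = "\<lambda>p. (N p)\<^sup>2"
  define q where "q \<xi> = axis 1 \<xi> + (axis 2 1 :: complex^2)" for \<xi>
  have q0: "q \<xi> \<noteq> 0" for \<xi> by (simp add: q_def vec_eq_iff forall_2 axis_def)
  define B where "B \<xi> v w = hess ?F (q \<xi>) (axis 2 v) (axis 2 w)" for \<xi> v w
  have cB: "isCont (\<lambda>\<xi>. B \<xi> v w) 0" for v w
  proof -
    have "continuous_on UNIV q"
      unfolding q_def[abs_def] by (intro continuous_intros linear_continuous_on bounded_linear_axis)
    then have "continuous_on UNIV (\<lambda>\<xi>. B \<xi> v w)"
      unfolding B_def
      by (rule continuous_on_compose2[OF smooth_on_continuous[OF smooth_on_hess[OF smooth_N2]]]) (use q0 in auto)
    then show ?thesis by (simp add: continuous_on_eq_continuous_at)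
  qed
  have "\<forall>e e'. \<exists>d>0. \<forall>\<xi>. cmod \<xi> < d \<longrightarrow> \<bar>B \<xi> e e'\<bar> \<le> \<bar>B 0 e e'\<bar> + 1"
  proof (intro allI)
    fix e e'
    obtain d where "d > 0" "\<And>\<xi>. dist \<xi> 0 < d \<Longrightarrow> dist (B \<xi> e e') (B 0 e e') < 1"
      using cB[of e e'] unfolding continuous_at_eps_delta by (metis zero_less_one)
    then show "\<exists>d>0. \<forall>\<xi>. cmod \<xi> < d \<longrightarrow> \<bar>B \<xi> e e'\<bar> \<le> \<bar>B 0 e e'\<bar> + 1"
      by (intro exI[of _ d]) (fastforce simp: dist_real_def)
  qed
  then obtain d where d: "\<And>e e'. d e e' > 0" "\<And>e e' \<xi>. cmod \<xi> < d e e' \<Longrightarrow> \<bar>B \<xi> e e'\<bar> \<le> \<bar>B 0 e e'\<bar> + 1"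
    by metis
  define d0 where "d0 = min (min (d 1 1) (d 1 \<i>)) (min (d \<i> 1) (d \<i> \<i>))"
  define M0 where "M0 = \<bar>B 0 1 1\<bar> + \<bar>B 0 1 \<i>\<bar> + \<bar>B 0 \<i> 1\<bar> + \<bar>B 0 \<i> \<i>\<bar> + 1"
  have d0: "d0 > 0" using d(1) by (simp add: d0_def)
  have "\<bar>hess E \<zeta> v w\<bar> \<le> 4 * M0" if \<zeta>: "cmod \<zeta> \<ge> 2 / d0" and v: "cmod v = 1" and w: "cmod w = 1" for \<zeta> v w
  proof -
    have pos: "2 / d0 > 0" using d0 by simp
    have z: "\<zeta> \<noteq> 0" "cmod \<zeta> > 0" using \<zeta> pos by auto
    define \<xi> where "\<xi> = 1 / \<zeta>"
    have "cmod \<xi> \<le> d0 / 2" using \<zeta> d0 z by (simp add: \<xi>_def norm_divide field_simps)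
    then have small: "cmod \<xi> < d0" using d0 by simp
    have bil: "bilinear (B \<xi>)"
    proof -
      have "q \<xi> \<in> - {0}" using q0 by simp
      from hess_bilinear[OF smooth_N2 this] have b: "bilinear (hess ?F (q \<xi>))" .
      have a: "axis 2 (x + y) = axis 2 x + axis 2 y" "axis 2 (r *\<^sub>R x) = r *\<^sub>R (axis 2 x :: complex^2)" for x y :: complex and r
        by (simp_all add: vec_eq_iff axis_def)
      show ?thesis
        unfolding bilinear_def B_def
        by (intro conjI allI linearI) (simp_all add: a bilinear_ladd[OF b] bilinear_radd[OF b] bilinear_lmul[OF b] bilinear_rmul[OF b])
    qed
    have Bb: "\<bar>B \<xi> e e'\<bar> \<le> M0" if "e \<in> {1, \<i>}" "e' \<in> {1, \<i>}" for e e'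
    proof -
      have "cmod \<xi> < d e e'" using small that by (auto simp: d0_def)
      from d(2)[OF this] show ?thesis using that by (auto simp: M0_def)
    qed
    have e: "affine_pt \<zeta> = \<zeta> *s q \<xi>" "axis 2 v = \<zeta> *s axis 2 (v / \<zeta>)" "axis 2 w = \<zeta> *s axis 2 (w / \<zeta>)"
      using z by (simp_all add: affine_pt_expand q_def \<xi>_def vec_eq_iff forall_2 axis_def)
    have pt: "affine_pt \<zeta> \<in> - {0}" using affine_pt_nonzero by simp
    have DE: "Der E \<zeta> v = Der ?F (affine_pt \<zeta>) (axis 2 v)" for \<zeta> v
    proof -
      have "affine_pt \<zeta> \<in> - {0}" using affine_pt_nonzero by simp
      from Der_eq[OF has_derivative_compose[OF affine_pt_has_derivative smooth_on_has_derivative[OF smooth_N2 this]]]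
      show ?thesis by (simp add: E_def[abs_def])
    qed
    from Der_eq[OF has_derivative_compose[OF affine_pt_has_derivative hess_has_derivative[OF smooth_N2 pt]]]
    have "hess E \<zeta> v w = hess ?F (affine_pt \<zeta>) (axis 2 v) (axis 2 w)"
      by (simp add: hess_def[of E] DE)
    also have "\<dots> = (cmod \<zeta>)\<^sup>2 * B \<xi> (v / \<zeta>) (w / \<zeta>)"
      unfolding e B_def by (rule hess_N2_scale[OF z(1) q0])
    finally have "\<bar>hess E \<zeta> v w\<bar> = (cmod \<zeta>)\<^sup>2 * \<bar>B \<xi> (v / \<zeta>) (w / \<zeta>)\<bar>" by (simp add: abs_mult)
    also have "\<dots> \<le> (cmod \<zeta>)\<^sup>2 * (4 * M0 * (cmod (v / \<zeta>) * cmod (w / \<zeta>)))"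
      by (intro mult_left_mono bilinear_complex_bound[OF bil Bb]) auto
    also have "\<dots> = 4 * M0" using z v w by (simp add: norm_divide power2_eq_square)
    finally show ?thesis .
  qed
  then show ?thesis using d0 by (intro exI[of _ "4 * M0"] exI[of _ "2 / d0"]) auto
qed

lemma E_lower_bound: "\<exists>k>0. \<forall>\<zeta>. E \<zeta> \<ge> k * (cmod \<zeta>)\<^sup>2"
proof -
  obtain c where c: "c > 0" "\<And>v. c * norm v \<le> N v" using gauge_bounds by blast
  have "E \<zeta> \<ge> c\<^sup>2 * (cmod \<zeta>)\<^sup>2" for \<zeta>
  proof -
    have "cmod \<zeta> \<le> norm (affine_pt \<zeta>)"
      using Finite_Cartesian_Product.norm_nth_le[of "affine_pt \<zeta>" 2] by (simp add: affine_pt_def vector_2)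
    then have "c * cmod \<zeta> \<le> N (affine_pt \<zeta>)" using c by (smt (verit) mult_left_mono)
    then have "(c * cmod \<zeta>)\<^sup>2 \<le> (N (affine_pt \<zeta>))\<^sup>2" using c(1) by (intro power_mono) auto
    then show ?thesis by (simp add: E_def power_mult_distrib)
  qed
  then show ?thesis using c(1) by (intro exI[of _ "c\<^sup>2"]) simp
qed

text \<open>For a solution of Liouville's equation \<open>\<psi>\<^sub>\<zeta>\<^sub>\<zeta> + 2 \<psi>\<^sub>\<zeta>\<^sup>2\<close> is holomorphic. In terms of
  \<open>E = exp (2 \<psi>)\<close> it is half of \<open>E\<^sub>\<zeta>\<^sub>\<zeta> / E\<close>, which tends to zero at infinity because the second derivatives
  of \<open>E\<close> are bounded while \<open>E\<close> grows quadratically. Below, \<open>T\<close> is \<open>4 E\<^sub>\<zeta>\<^sub>\<zeta> / E\<close>, and its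
  Cauchy-Riemann equations are the derivatives of Liouville's equation.\<close>

lemma liouville_holomorphic_zero:
  assumes c: "\<And>\<zeta>. E \<zeta> * (hess E \<zeta> 1 1 + hess E \<zeta> \<i> \<i>) - (Der E \<zeta> 1)\<^sup>2 - (Der E \<zeta> \<i>)\<^sup>2 = c"
  shows "hess E \<zeta> 1 1 = hess E \<zeta> \<i> \<i>" and "hess E \<zeta> 1 \<i> = 0"
proof -
  define h1 where "h1 z = hess E z 1 1" for z
  define h2 where "h2 z = hess E z 1 \<i>" for z
  define h3 where "h3 z = hess E z \<i> \<i>" for z
  have h2': "hess E z \<i> 1 = h2 z" for z
    unfolding h2_def by (rule hess_symmetric[OF smooth_E UNIV_I])
  have s: "smooth_on UNIV h1" "smooth_on UNIV h2" "smooth_on UNIV h3"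
    unfolding h1_def[abs_def] h2_def[abs_def] h3_def[abs_def] by (intro smooth_on_hess smooth_E)+
  note d = smooth_on_has_derivative[OF s(1) UNIV_I] smooth_on_has_derivative[OF s(2) UNIV_I]
    smooth_on_has_derivative[OF s(3) UNIV_I] smooth_on_has_derivative[OF smooth_E UNIV_I]
  have sD: "smooth_on UNIV (\<lambda>z. Der E z v)" for v by (rule smooth_on_Der[OF smooth_E])
  have m1: "Der h1 z \<i> = Der h2 z 1" for z
    using hess_symmetric[OF sD[of 1] UNIV_I, of z 1 \<i>]
    by (simp add: hess_def[of "\<lambda>z. Der E z 1"] hess_def[of E, symmetric] h1_def[abs_def] h2_def[abs_def])
  have m2: "Der h3 z 1 = Der h2 z \<i>" for z
  proof -
    have "Der (\<lambda>z. hess E z \<i> 1) z \<i> = Der (\<lambda>z. hess E z \<i> \<i>) z 1"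
      using hess_symmetric[OF sD[of \<i>] UNIV_I, of z 1 \<i>]
      by (simp add: hess_def[of "\<lambda>z. Der E z \<i>"] hess_def[of E, symmetric])
    then show ?thesis by (simp add: h2' h3_def[abs_def])
  qed
  have diff: "Der E z v * (h1 z + h3 z) + E z * (Der h1 z v + Der h3 z v)
      = 2 * Der E z 1 * hess E z 1 v + 2 * Der E z \<i> * hess E z \<i> v" for z v
  proof -
    have "((\<lambda>z. E z * (h1 z + h3 z) - Der E z 1 * Der E z 1 - Der E z \<i> * Der E z \<i>) has_derivative
       (\<lambda>v. (E z * (Der h1 z v + Der h3 z v) + Der E z v * (h1 z + h3 z))
          - (Der E z 1 * hess E z 1 v + hess E z 1 v * Der E z 1)
          - (Der E z \<i> * hess E z \<i> v + hess E z \<i> v * Der E z \<i>))) (at z)"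
      by (intro has_derivative_diff has_derivative_mult has_derivative_add d hess_has_derivative[OF smooth_E UNIV_I])
    moreover have "(\<lambda>z. E z * (h1 z + h3 z) - Der E z 1 * Der E z 1 - Der E z \<i> * Der E z \<i>) = (\<lambda>z. c)"
      using c by (simp add: fun_eq_iff h1_def h3_def power2_eq_square)
    ultimately have "((\<lambda>z. c) has_derivative
       (\<lambda>v. (E z * (Der h1 z v + Der h3 z v) + Der E z v * (h1 z + h3 z))
          - (Der E z 1 * hess E z 1 v + hess E z 1 v * Der E z 1)
          - (Der E z \<i> * hess E z \<i> v + hess E z \<i> v * Der E z \<i>))) (at z)" by simp
    from fun_cong[OF has_derivative_unique[OF this has_derivative_const], of v] show ?thesis
      by (simp add: algebra_simps)
  qed
  define X where "X z = (h1 z - h3 z) / E z" for z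
  define Y where "Y z = - 2 * h2 z / E z" for z
  define T where "T z = Complex (X z) (Y z)" for z
  define X' where "X' z v = ((Der h1 z v - Der h3 z v) * E z - (h1 z - h3 z) * Der E z v) / (E z * E z)" for z v
  define Y' where "Y' z v = ((- 2 * Der h2 z v) * E z - (- 2 * h2 z) * Der E z v) / (E z * E z)" for z v
  have En: "E z \<noteq> 0" for z using E_pos[of z] by simp
  have dX: "(X has_derivative X' z) (at z)" for z
    unfolding X_def[abs_def] X'_def[abs_def] by (intro has_derivative_divide' has_derivative_diff d En)
  have dY: "(Y has_derivative Y' z) (at z)" for z
    unfolding Y_def[abs_def] Y'_def[abs_def] by (intro has_derivative_divide' has_derivative_mult_right d En)
  have CR: "X' z 1 = Y' z \<i>" "X' z \<i> = - Y' z 1" for z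
  proof -
    have "(Der h1 z 1 - Der h3 z 1) * E z - (h1 z - h3 z) * Der E z 1 = (- 2 * Der h2 z \<i>) * E z - (- 2 * h2 z) * Der E z \<i>"
      using diff[of z 1] unfolding h2' h1_def[symmetric] m2 by (simp add: algebra_simps)
    then show "X' z 1 = Y' z \<i>" unfolding X'_def Y'_def by simp
    have e: "(Der h1 z \<i> - Der h3 z \<i>) * E z - (h1 z - h3 z) * Der E z \<i> = - ((- 2 * Der h2 z 1) * E z - (- 2 * h2 z) * Der E z 1)"
      using diff[of z \<i>] unfolding h2_def[symmetric] h3_def[symmetric] m1 by (simp add: algebra_simps)
    show "X' z \<i> = - Y' z 1" unfolding X'_def Y'_def e by (rule minus_divide_left[symmetric])
  qed
  have "(T has_field_derivative Complex (X' z 1) (Y' z 1)) (at z)" for z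
  proof -
    have lX: "linear (X' z)" and lY: "linear (Y' z)"
      using dX dY has_derivative_linear by blast+
    have ex: "f v = Re v * f 1 + Im v * f \<i>" if "linear f" for f :: "complex \<Rightarrow> real" and v
    proof -
      have "f v = f (Re v *\<^sub>R 1 + Im v *\<^sub>R \<i>)" by (rule arg_cong[of _ _ f]) (simp add: complex_eq_iff)
      then show ?thesis using that by (simp add: linear_add linear_scale)
    qed
    have "((\<lambda>z. complex_of_real (X z) + \<i> * complex_of_real (Y z)) has_derivative
       (\<lambda>v. complex_of_real (X' z v) + \<i> * complex_of_real (Y' z v))) (at z)"
      by (intro has_derivative_add has_derivative_of_real has_derivative_mult_right dX dY)
    moreover have "(\<lambda>z. complex_of_real (X z) + \<i> * complex_of_real (Y z)) = T"
      by (simp add: T_def[abs_def] Complex_expand)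
    moreover have "complex_of_real (X' z v) + \<i> * complex_of_real (Y' z v) = Complex (X' z 1) (Y' z 1) * v" for v
      using ex[OF lX, of v] ex[OF lY, of v] CR(1)[of z] CR(2)[of z]
      by (simp add: complex_eq_iff algebra_simps)
    ultimately show ?thesis by (simp add: has_field_derivative_def)
  qed
  then have hol: "T holomorphic_on UNIV"
    by (auto simp: holomorphic_on_def field_differentiable_def)
  have lim: "(T \<longlongrightarrow> 0) at_infinity"
  proof -
    obtain M R0 where M: "R0 > 0" "\<And>\<zeta> v w. cmod \<zeta> \<ge> R0 \<Longrightarrow> cmod v = 1 \<Longrightarrow> cmod w = 1 \<Longrightarrow> \<bar>hess E \<zeta> v w\<bar> \<le> M"
      using hess_E_bounded by blast
    obtain k where k: "k > 0" "\<And>\<zeta>. E \<zeta> \<ge> k * (cmod \<zeta>)\<^sup>2" using E_lower_bound by blast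
    have M0: "M \<ge> 0" using M(2)[of "of_real R0" 1 1] M(1) by (auto simp: abs_le_iff)
    have bnd: "cmod (T \<zeta>) \<le> (4 * M / k) * inverse ((cmod \<zeta>)\<^sup>2)" if "cmod \<zeta> \<ge> R0" for \<zeta>
    proof -
      have z: "cmod \<zeta> > 0" using that M(1) by linarith
      have h: "\<bar>h1 \<zeta>\<bar> \<le> M" "\<bar>h2 \<zeta>\<bar> \<le> M" "\<bar>h3 \<zeta>\<bar> \<le> M"
        unfolding h1_def h2_def h3_def by (intro M(2)[OF that]; simp)+
      have "cmod (T \<zeta>) \<le> \<bar>X \<zeta>\<bar> + \<bar>Y \<zeta>\<bar>"
        using cmod_le[of "T \<zeta>"] by (simp add: T_def)
      also have "\<dots> = (\<bar>h1 \<zeta> - h3 \<zeta>\<bar> + 2 * \<bar>h2 \<zeta>\<bar>) / E \<zeta>"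
        using E_pos[of \<zeta>] by (simp add: X_def Y_def abs_mult add_divide_distrib)
      also have "\<dots> \<le> (4 * M) / (k * (cmod \<zeta>)\<^sup>2)"
        using h k z M0 by (intro frac_le) auto
      also have "\<dots> = (4 * M / k) * inverse ((cmod \<zeta>)\<^sup>2)" by (simp add: field_simps)
      finally show ?thesis .
    qed
    have "((\<lambda>\<zeta>::complex. (4 * M / k) * inverse ((cmod \<zeta>)\<^sup>2)) \<longlongrightarrow> (4 * M / k) * 0) at_infinity"
      by (intro tendsto_mult tendsto_const tendsto_inverse_0_at_top filterlim_pow_at_top filterlim_norm_at_top) simp
    then have "((\<lambda>\<zeta>::complex. (4 * M / k) * inverse ((cmod \<zeta>)\<^sup>2)) \<longlongrightarrow> 0) at_infinity" by simp
    then show ?thesis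
      by (rule Lim_null_comparison[rotated]) (use bnd in \<open>auto simp: eventually_at_infinity\<close>)
  qed
  have "T \<zeta> = 0" by (rule Liouville_weak[OF hol lim])
  then have "X \<zeta> = 0" "Y \<zeta> = 0" by (auto simp: T_def complex_eq_iff)
  then show "hess E \<zeta> 1 1 = hess E \<zeta> \<i> \<i>" "hess E \<zeta> 1 \<i> = 0"
    using En[of \<zeta>] by (auto simp: X_def Y_def h1_def h2_def h3_def)
qed

text \<open>The vanishing of \<open>E\<^sub>\<zeta>\<^sub>\<zeta>\<close> makes all third derivatives vanish; three integrations recover the
  polynomial.\<close>

lemma liouville_quadratic:
  assumes c: "\<And>\<zeta>. E \<zeta> * (hess E \<zeta> 1 1 + hess E \<zeta> \<i> \<i>) - (Der E \<zeta> 1)\<^sup>2 - (Der E \<zeta> \<i>)\<^sup>2 = c"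
  shows "\<exists>\<gamma> P Q K. \<forall>\<zeta>. E \<zeta> = \<gamma> * (cmod \<zeta>)\<^sup>2 + P * Re \<zeta> + Q * Im \<zeta> + K"
proof -
  note z = liouville_holomorphic_zero[OF c]
  have z2: "hess E \<zeta> \<i> 1 = 0" for \<zeta>
    using hess_symmetric[OF smooth_E UNIV_I, of \<zeta> 1 \<i>] z(2) by simp
  have sD: "smooth_on UNIV (\<lambda>z. Der E z v)" for v by (rule smooth_on_Der[OF smooth_E])
  have "\<exists>k. \<forall>\<zeta>. hess E \<zeta> 1 1 = k"
  proof (rule Der_zero_imp_const[OF smooth_on_hess[OF smooth_E]])
    fix \<zeta>
    have "Der (\<lambda>z. hess E z 1 1) \<zeta> \<i> = Der (\<lambda>z. hess E z 1 \<i>) \<zeta> 1"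
      using hess_symmetric[OF sD[of 1] UNIV_I, of \<zeta> 1 \<i>]
      by (simp add: hess_def[of "\<lambda>z. Der E z 1"] hess_def[of E, symmetric])
    then show "Der (\<lambda>z. hess E z 1 1) \<zeta> \<i> = 0" by (simp add: z(2) frechet_derivative_const)
    have "Der (\<lambda>z. hess E z \<i> 1) \<zeta> \<i> = Der (\<lambda>z. hess E z \<i> \<i>) \<zeta> 1"
      using hess_symmetric[OF sD[of \<i>] UNIV_I, of \<zeta> 1 \<i>]
      by (simp add: hess_def[of "\<lambda>z. Der E z \<i>"] hess_def[of E, symmetric])
    then show "Der (\<lambda>z. hess E z 1 1) \<zeta> 1 = 0" by (simp add: z(1) z2 frechet_derivative_const)
  qed
  then obtain g where g: "\<And>\<zeta>. hess E \<zeta> 1 1 = g" by blast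
  have g2: "hess E \<zeta> \<i> \<i> = g" for \<zeta> using z(1)[of \<zeta>] g by simp
  have "\<exists>k. \<forall>\<zeta>. Der E \<zeta> 1 - g * Re \<zeta> = k"
  proof (rule Der_zero_imp_const)
    show "smooth_on UNIV (\<lambda>\<zeta>. Der E \<zeta> 1 - g * Re \<zeta>)"
      by (intro smooth_on_diff sD smooth_on_mult smooth_on_const smooth_on_linear bounded_linear_Re open_UNIV)
    fix \<zeta>
    have "((\<lambda>\<zeta>. Der E \<zeta> 1 - g * Re \<zeta>) has_derivative (\<lambda>v. hess E \<zeta> 1 v - g * Re v)) (at \<zeta>)"
      by (intro has_derivative_diff has_derivative_mult_right hess_has_derivative[OF smooth_E UNIV_I]
          bounded_linear_imp_has_derivative bounded_linear_Re)
    from Der_eq[OF this] show "Der (\<lambda>\<zeta>. Der E \<zeta> 1 - g * Re \<zeta>) \<zeta> 1 = 0" "Der (\<lambda>\<zeta>. Der E \<zeta> 1 - g * Re \<zeta>) \<zeta> \<i> = 0"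
      by (simp_all add: g z(2))
  qed
  then obtain P where P: "\<And>\<zeta>. Der E \<zeta> 1 = g * Re \<zeta> + P" by (metis diff_eq_eq add.commute)
  have "\<exists>k. \<forall>\<zeta>. Der E \<zeta> \<i> - g * Im \<zeta> = k"
  proof (rule Der_zero_imp_const)
    show "smooth_on UNIV (\<lambda>\<zeta>. Der E \<zeta> \<i> - g * Im \<zeta>)"
      by (intro smooth_on_diff sD smooth_on_mult smooth_on_const smooth_on_linear bounded_linear_Im open_UNIV)
    fix \<zeta>
    have "((\<lambda>\<zeta>. Der E \<zeta> \<i> - g * Im \<zeta>) has_derivative (\<lambda>v. hess E \<zeta> \<i> v - g * Im v)) (at \<zeta>)"
      by (intro has_derivative_diff has_derivative_mult_right hess_has_derivative[OF smooth_E UNIV_I]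
          bounded_linear_imp_has_derivative bounded_linear_Im)
    from Der_eq[OF this] show "Der (\<lambda>\<zeta>. Der E \<zeta> \<i> - g * Im \<zeta>) \<zeta> 1 = 0" "Der (\<lambda>\<zeta>. Der E \<zeta> \<i> - g * Im \<zeta>) \<zeta> \<i> = 0"
      by (simp_all add: g2 z2)
  qed
  then obtain Q where Q: "\<And>\<zeta>. Der E \<zeta> \<i> = g * Im \<zeta> + Q" by (metis diff_eq_eq add.commute)
  let ?q = "\<lambda>\<zeta>. g / 2 * (Re \<zeta> * Re \<zeta> + Im \<zeta> * Im \<zeta>) + P * Re \<zeta> + Q * Im \<zeta>"
  have "\<exists>k. \<forall>\<zeta>. E \<zeta> - ?q \<zeta> = k"
  proof (rule Der_zero_imp_const)
    show "smooth_on UNIV (\<lambda>\<zeta>. E \<zeta> - ?q \<zeta>)"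
      by (intro smooth_on_diff smooth_on_add smooth_E smooth_on_mult smooth_on_const smooth_on_linear
          bounded_linear_Re bounded_linear_Im open_UNIV)
    fix \<zeta>
    have "((\<lambda>\<zeta>. E \<zeta> - ?q \<zeta>) has_derivative (\<lambda>v. Der E \<zeta> v -
        (g / 2 * ((Re \<zeta> * Re v + Re v * Re \<zeta>) + (Im \<zeta> * Im v + Im v * Im \<zeta>)) + P * Re v + Q * Im v))) (at \<zeta>)"
      by (intro has_derivative_diff has_derivative_add has_derivative_mult_right has_derivative_mult
          smooth_on_has_derivative[OF smooth_E UNIV_I]
          bounded_linear_imp_has_derivative bounded_linear_Re bounded_linear_Im)
    from Der_eq[OF this] show "Der (\<lambda>\<zeta>. E \<zeta> - ?q \<zeta>) \<zeta> 1 = 0" "Der (\<lambda>\<zeta>. E \<zeta> - ?q \<zeta>) \<zeta> \<i> = 0"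
      by (simp_all add: P Q)
  qed
  then obtain K where "\<And>\<zeta>. E \<zeta> - ?q \<zeta> = K" by blast
  then have "E \<zeta> = g / 2 * (cmod \<zeta>)\<^sup>2 + P * Re \<zeta> + Q * Im \<zeta> + K" for \<zeta>
    by (simp add: cmod_power2 algebra_simps flip: power2_eq_square)
  then show ?thesis by blast
qed

lemma quadratic_imp_liouville:
  assumes E: "\<And>\<zeta>. E \<zeta> = \<gamma> * (cmod \<zeta>)\<^sup>2 + P * Re \<zeta> + Q * Im \<zeta> + K"
  shows "\<exists>c. \<forall>\<zeta>. E \<zeta> * (hess E \<zeta> 1 1 + hess E \<zeta> \<i> \<i>) - (Der E \<zeta> 1)\<^sup>2 - (Der E \<zeta> \<i>)\<^sup>2 = c"
proof -
  have E': "E = (\<lambda>\<zeta>. \<gamma> * (Re \<zeta> * Re \<zeta> + Im \<zeta> * Im \<zeta>) + P * Re \<zeta> + Q * Im \<zeta> + K)"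
    by (simp add: fun_eq_iff E cmod_power2 flip: power2_eq_square)
  have "(E has_derivative (\<lambda>v. \<gamma> * ((Re \<zeta> * Re v + Re v * Re \<zeta>) + (Im \<zeta> * Im v + Im v * Im \<zeta>)) + P * Re v + Q * Im v + 0)) (at \<zeta>)" for \<zeta>
    unfolding E'
    by (intro has_derivative_add has_derivative_mult_right has_derivative_mult has_derivative_const
        bounded_linear_imp_has_derivative bounded_linear_Re bounded_linear_Im)
  from Der_eq[OF this] have D: "Der E \<zeta> 1 = 2 * \<gamma> * Re \<zeta> + P" "Der E \<zeta> \<i> = 2 * \<gamma> * Im \<zeta> + Q" for \<zeta>
    by simp_all
  have "((\<lambda>\<zeta>. 2 * \<gamma> * Re \<zeta> + P) has_derivative (\<lambda>v. 2 * \<gamma> * Re v + 0)) (at \<zeta>)"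
    "((\<lambda>\<zeta>. 2 * \<gamma> * Im \<zeta> + Q) has_derivative (\<lambda>v. 2 * \<gamma> * Im v + 0)) (at \<zeta>)" for \<zeta>
    by (intro has_derivative_add has_derivative_mult_right has_derivative_const
        bounded_linear_imp_has_derivative bounded_linear_Re bounded_linear_Im)+
  from Der_eq[OF this(1)] Der_eq[OF this(2)]
  have H: "hess E \<zeta> 1 1 = 2 * \<gamma>" "hess E \<zeta> \<i> \<i> = 2 * \<gamma>" for \<zeta>
    unfolding hess_def D by simp_all
  have "E \<zeta> * (hess E \<zeta> 1 1 + hess E \<zeta> \<i> \<i>) - (Der E \<zeta> 1)\<^sup>2 - (Der E \<zeta> \<i>)\<^sup>2 = 4 * \<gamma> * K - P\<^sup>2 - Q\<^sup>2" for \<zeta>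
    unfolding H D E cmod_power2 by (simp add: power2_eq_square algebra_simps)
  then show ?thesis by blast
qed

lemma N_split: "p$1 \<noteq> 0 \<Longrightarrow> (N p)\<^sup>2 = (cmod (p$1))\<^sup>2 * E (p$2 / p$1)"
proof -
  assume p: "p$1 \<noteq> 0"
  then have "p = p$1 *s affine_pt (p$2 / p$1)"
    by (simp add: vec_eq_iff forall_2 affine_pt_def vector_2)
  then have "N p = cmod (p$1) * N (affine_pt (p$2 / p$1))" by (metis gauge_scale)
  then show ?thesis by (simp add: E_def power_mult_distrib)
qed

text \<open>Homogenising \<open>E\<close> shows that \<open>N\<^sup>2\<close> is a hermitian form, also on the line \<open>z = 0\<close> by continuity. Completing the
  square writes it as \<open>\<gamma> \<bar>w + \<delta> z\<bar>\<^sup>2 + \<kappa> \<bar>z\<bar>\<^sup>2\<close>, whose coefficients are values of \<open>N\<^sup>2\<close> and hence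
  positive.\<close>

lemma quadratic_imp_linear_image:
  assumes E: "\<And>\<zeta>. E \<zeta> = \<gamma> * (cmod \<zeta>)\<^sup>2 + P * Re \<zeta> + Q * Im \<zeta> + K"
  shows "\<exists>A :: complex^2^2. Z = (\<lambda>x. A *v x) ` sphere 0 1"
proof -
  define H where "H p = \<gamma> * (cmod (p$2))\<^sup>2 + P * Re (p$2 * cnj (p$1)) + Q * Im (p$2 * cnj (p$1)) + K * (cmod (p$1))\<^sup>2"
    for p :: "complex^2"
  have H1: "(N p)\<^sup>2 = H p" if "p$1 \<noteq> 0" for p
  proof -
    have e: "p$2 * cnj (p$1) = of_real ((cmod (p$1))\<^sup>2) * (p$2 / p$1)"
      using that by (simp only: complex_norm_square) (simp add: field_simps)
    have eR: "Re (p$2 * cnj (p$1)) = (cmod (p$1))\<^sup>2 * Re (p$2 / p$1)"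
      and eI: "Im (p$2 * cnj (p$1)) = (cmod (p$1))\<^sup>2 * Im (p$2 / p$1)"
      unfolding e times_complex.simps Re_complex_of_real Im_complex_of_real by simp_all
    have "(cmod (p$1))\<^sup>2 * (cmod (p$2 / p$1))\<^sup>2 = (cmod (p$2))\<^sup>2"
      using that by (simp add: norm_divide power_divide)
    then show ?thesis
      unfolding N_split[OF that] E H_def eR eI by (simp add: algebra_simps)
  qed
  have H2: "(N p)\<^sup>2 = H p" for p
  proof (cases "p$1 = 0")
    case True
    define q where "q t = p + t *\<^sub>R axis 1 1" for t :: real
    have cq: "continuous_on UNIV q" unfolding q_def by (intro continuous_intros)
    have "continuous_on UNIV (\<lambda>t. (N (q t))\<^sup>2)"
      by (intro continuous_intros continuous_on_compose2[OF continuous_gauge cq]) auto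
    then have 1: "((\<lambda>t. (N (q t))\<^sup>2) \<longlongrightarrow> (N (q 0))\<^sup>2) (at 0)"
      by (simp add: continuous_on_eq_continuous_at isCont_def)
    have "continuous_on UNIV (\<lambda>t. H (q t))"
      unfolding H_def by (intro continuous_intros cq)
    then have 2: "((\<lambda>t. H (q t)) \<longlongrightarrow> H (q 0)) (at 0)"
      by (simp add: continuous_on_eq_continuous_at isCont_def)
    have "((\<lambda>t. (N (q t))\<^sup>2) \<longlongrightarrow> H (q 0)) (at 0)"
    proof (rule Lim_transform_within[OF 2 zero_less_one])
      fix t :: real assume "0 < dist t 0"
      then have "q t $ 1 \<noteq> 0" using True by (simp add: q_def axis_def)
      then show "H (q t) = (N (q t))\<^sup>2" by (simp add: H1)
    qed
    from tendsto_unique[OF _ 1 this] show ?thesis by (simp add: q_def)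
  qed (rule H1)
  have \<gamma>: "\<gamma> > 0"
  proof -
    have "axis 2 1 \<noteq> (0::complex^2)" by (simp add: axis_eq_0_iff)
    then have "(N (axis 2 1))\<^sup>2 > 0" using gauge_pos[of "axis 2 1"] by simp
    then show ?thesis unfolding H2 by (simp add: H_def axis_def)
  qed
  define \<delta> where "\<delta> = Complex P Q / of_real (2 * \<gamma>)"
  define \<kappa> where "\<kappa> = K - \<gamma> * (cmod \<delta>)\<^sup>2"
  have sq: "H p = \<gamma> * (cmod (p$2 + \<delta> * p$1))\<^sup>2 + \<kappa> * (cmod (p$1))\<^sup>2" for p
  proof -
    have r: "Re \<delta> = P / (2 * \<gamma>)" "Im \<delta> = Q / (2 * \<gamma>)" by (simp_all add: \<delta>_def)
    have P: "P = 2 * \<gamma> * Re \<delta>" and Q: "Q = 2 * \<gamma> * Im \<delta>" using \<gamma> by (simp_all add: r)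
    show ?thesis
      unfolding H_def \<kappa>_def P Q cmod_power2 by (simp add: power2_eq_square algebra_simps)
  qed
  have \<kappa>: "\<kappa> > 0"
  proof -
    have "affine_pt (- \<delta>) \<noteq> 0" by (rule affine_pt_nonzero)
    then have "(N (affine_pt (- \<delta>)))\<^sup>2 > 0" using gauge_pos[of "affine_pt (- \<delta>)"] by simp
    then show ?thesis unfolding H2 sq by (simp add: affine_pt_def vector_2)
  qed
  define a where "a = complex_of_real (sqrt \<kappa>)"
  define b where "b = complex_of_real (sqrt \<gamma>)"
  have ab: "a \<noteq> 0" "b \<noteq> 0" "(cmod a)\<^sup>2 = \<kappa>" "(cmod b)\<^sup>2 = \<gamma>" using \<kappa> \<gamma> by (simp_all add: a_def b_def)
  define B where "B p = (vector [a * p$1, b * (p$2 + \<delta> * p$1)] :: complex^2)" for p :: "complex^2"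
  define A :: "complex^2^2" where "A = vector [vector [1 / a, 0], vector [- \<delta> / a, 1 / b]]"
  have Av: "A *v x = vector [x$1 / a, x$2 / b - \<delta> * x$1 / a]" for x
    by (simp add: A_def matrix_vector_mult_def vec_eq_iff forall_2 sum_2 vector_2)
  have AB: "A *v (B p) = p" "B (A *v x) = x" for p x
    unfolding Av B_def using ab by (simp_all add: vec_eq_iff forall_2 vector_2 field_simps)
  have nB: "norm (B p) = N p" for p
  proof -
    have "(norm (B p))\<^sup>2 = (cmod (B p $ 1))\<^sup>2 + (cmod (B p $ 2))\<^sup>2"
      by (simp add: norm_vec_def L2_set_def sum_2)
    also have "\<dots> = (N p)\<^sup>2"
      unfolding H2 sq B_def by (simp add: vector_2 norm_mult power_mult_distrib ab)
    finally show ?thesis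
      using gauge_pos[of p] by (cases "p = 0") (auto simp: power2_eq_iff_nonneg)
  qed
  have "Z = (\<lambda>x. A *v x) ` sphere 0 1"
  proof (intro equalityI subsetI)
    fix p assume "p \<in> Z"
    then have "B p \<in> sphere 0 1" by (simp add: nB mem_iff)
    then show "p \<in> (\<lambda>x. A *v x) ` sphere 0 1" by (metis AB(1) imageI)
  next
    fix p assume "p \<in> (\<lambda>x. A *v x) ` sphere 0 1"
    then obtain x where x: "norm x = 1" "p = A *v x" by auto
    then show "p \<in> Z" using nB[of p] by (simp add: AB(2) mem_iff)
  qed
  then show ?thesis by blast
qed

text \<open>Since the surface meets every line, the matrix is invertible, and circularity forces the centre to be the origin.
  Then \<open>N\<close> is a multiple of the norm after the inverse map.\<close>

lemma linear_image_imp_quadratic: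
  fixes A :: "complex^2^2"
  assumes r: "r > 0" and Z: "Z = (\<lambda>x. A *v x) ` sphere c r"
  shows "\<exists>\<gamma> P Q K. \<forall>\<zeta>. E \<zeta> = \<gamma> * (cmod \<zeta>)\<^sup>2 + P * Re \<zeta> + Q * Im \<zeta> + K"
proof -
  have "surj (\<lambda>x. A *v x)"
  proof -
    have "v \<in> range (\<lambda>x. A *v x)" for v
    proof (cases "v = 0")
      case True
      then show ?thesis by (intro range_eqI[of _ _ 0]) simp
    next
      case False
      then obtain x where x: "proj v = A *v x" using proj_in_Z[OF False] Z by auto
      have "v = complex_of_real (N v) *s proj v"
        unfolding proj_eq using gauge_pos[OF False] by simp
      also have "\<dots> = A *v (complex_of_real (N v) *s x)"
        unfolding x by (simp add: matrix_vector_mult_def vec_eq_iff sum_distrib_left mult_ac)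
      finally show ?thesis by blast
    qed
    then show ?thesis by auto
  qed
  then obtain B :: "complex^2^2" where AB: "A ** B = mat 1"
    using matrix_right_invertible_surjective by blast
  then have BA: "B ** A = mat 1" by (simp add: matrix_left_right_inverse)
  have ABv: "A *v (B *v v) = v" "B *v (A *v x) = x" for v x
    by (simp_all add: matrix_vector_mul_assoc AB BA)
  have sc: "B *v (k *s v) = k *s (B *v v)" for k v
    by (simp add: matrix_vector_mult_def vec_eq_iff sum_distrib_left mult_ac)
  have inZ: "norm (B *v v - c) = r" if "v \<in> Z" for v
    using that unfolding Z by (auto simp: ABv dist_norm norm_minus_commute)
  (* Both points of the surface on the real line through A c come from points of the sphere, which is impossible
     for c different from 0 because their preimages are opposite multiples of c. *)
  have c0: "c = 0"
  proof (rule ccontr)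
    assume c: "c \<noteq> 0"
    then have "A *v c \<noteq> 0" using ABv(2)[of c] by (metis matrix_vector_mult_0_right)
    define v where "v = proj (A *v c)"
    define t where "t = inverse (N (A *v c))"
    have t: "t > 0" using gauge_pos[OF \<open>A *v c \<noteq> 0\<close>] by (simp add: t_def)
    have v: "v \<in> Z" "(- 1) *s v \<in> Z"
      using proj_in_Z[OF \<open>A *v c \<noteq> 0\<close>] unfolding v_def mem_iff gauge_scale by simp_all
    have Bv: "B *v v = t *\<^sub>R c"
      unfolding v_def proj_eq sc ABv by (simp add: t_def scaleR_eq_vector_scalar_mult)
    have "norm ((t - 1) *\<^sub>R c) = r" "norm ((- t - 1) *\<^sub>R c) = r"
      using inZ[OF v(1)] inZ[OF v(2)] unfolding sc Bv
      by (simp_all add: algebra_simps scaleR_eq_vector_scalar_mult)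
    then have "\<bar>t - 1\<bar> * norm c = \<bar>- t - 1\<bar> * norm c" by simp
    then show False using c t by simp
  qed
  have Nv: "N v = norm (B *v v) / r" if "v \<noteq> 0" for v
  proof -
    have "norm (B *v (proj v)) = r" using inZ[OF proj_in_Z[OF that]] c0 by simp
    then have "inverse (N v) * norm (B *v v) = r"
      unfolding proj_eq sc norm_vector_scalar_mult using gauge_pos[OF that] by (simp add: norm_inverse)
    then show ?thesis using gauge_pos[OF that] r by (simp add: field_simps)
  qed
  obtain b11 b12 b21 b22 where b: "B$1$1 = b11" "B$1$2 = b12" "B$2$1 = b21" "B$2$2 = b22" by blast
  have "E \<zeta> = ((cmod (b11 + b12 * \<zeta>))\<^sup>2 + (cmod (b21 + b22 * \<zeta>))\<^sup>2) / r\<^sup>2" for \<zeta>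
    unfolding E_def Nv[OF affine_pt_nonzero]
    by (simp add: norm_vec_def L2_set_def sum_2 power_divide matrix_vector_mult_def affine_pt_def vector_2 b)
  moreover have "(cmod (x + y * \<zeta>))\<^sup>2 = (cmod y)\<^sup>2 * (cmod \<zeta>)\<^sup>2 + 2 * Re (cnj x * y) * Re \<zeta> - 2 * Im (cnj x * y) * Im \<zeta> + (cmod x)\<^sup>2"
    for x y \<zeta>
    unfolding cmod_power2 by (simp add: power2_eq_square algebra_simps)
  ultimately have "E \<zeta> = ((cmod b12)\<^sup>2 + (cmod b22)\<^sup>2) / r\<^sup>2 * (cmod \<zeta>)\<^sup>2
     + (2 * Re (cnj b11 * b12) + 2 * Re (cnj b21 * b22)) / r\<^sup>2 * Re \<zeta>
     + (- 2 * Im (cnj b11 * b12) - 2 * Im (cnj b21 * b22)) / r\<^sup>2 * Im \<zeta>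
     + ((cmod b11)\<^sup>2 + (cmod b21)\<^sup>2) / r\<^sup>2" for \<zeta>
    using r by (simp add: divide_simps) (simp add: algebra_simps)
  then show ?thesis by blast
qed

lemma equality_iff_linear_image:
  "isoperimetric_quotient Z = 8 * pi \<longleftrightarrow>
    (\<exists>(A :: complex^2^2) c r. r > 0 \<and> Z = (\<lambda>x. A *v x) ` sphere c r)"
  unfolding equality_iff_liouville liouville_iff_E
proof
  assume "\<exists>c. \<forall>\<zeta>. E \<zeta> * (hess E \<zeta> 1 1 + hess E \<zeta> \<i> \<i>) - (Der E \<zeta> 1)\<^sup>2 - (Der E \<zeta> \<i>)\<^sup>2 = c"
  then obtain \<gamma> P Q K where "\<And>\<zeta>. E \<zeta> = \<gamma> * (cmod \<zeta>)\<^sup>2 + P * Re \<zeta> + Q * Im \<zeta> + K"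
    using liouville_quadratic by metis
  from quadratic_imp_linear_image[OF this]
  show "\<exists>(A :: complex^2^2) c r. r > 0 \<and> Z = (\<lambda>x. A *v x) ` sphere c r" by (metis zero_less_one)
next
  assume "\<exists>(A :: complex^2^2) c r. r > 0 \<and> Z = (\<lambda>x. A *v x) ` sphere c r"
  then show "\<exists>c. \<forall>\<zeta>. E \<zeta> * (hess E \<zeta> 1 1 + hess E \<zeta> \<i> \<i>) - (Der E \<zeta> 1)\<^sup>2 - (Der E \<zeta> \<i>)\<^sup>2 = c"
    using linear_image_imp_quadratic quadratic_imp_liouville by metis
qed

end

theorem theorem18:
  fixes Z :: "(complex^2) set"
  assumes "circular_hypersurface Z"
    and "strongly_pseudoconvex Z"
  shows "isoperimetric_quotient Z \<le> 8 * pi \<and>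
    (isoperimetric_quotient Z = 8 * pi \<longleftrightarrow>
      (\<exists>(A :: complex^2^2) c r. r > 0 \<and> Z = (\<lambda>x. A *v x) ` sphere c r))"
proof -
  interpret circular_surface Z using assms by unfold_locales
  show ?thesis using isoperimetric_inequality equality_iff_linear_image by blast
qed

end
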